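(* Consider the two-user real Gaussian MIMO interference channel with channel matrices $H_1,H_2,H_3,H_4$ and power constraints $P_1,P_2$ (see context), where $H_3=0$ and $H_1,H_2,H_4$ are square and invertible. If $H_2^TH_2\succeq H_4^TH_4$, then the capacity region is the union, over all symmetric positive semidefinite $S_1,S_2$ with $\mathrm{tr}(S_1)\le P_1$ and $\mathrm{tr}(S_2)\le P_2$, of the sets of pairs of nonnegative reals $(R_1,R_2)$ satisfying $$R_1\le\tfrac12\log\left|I+H_1S_1H_1^T\right|,\qquad R_2\le\tfrac12\log\left|I+H_4S_2H_4^T\right|,$$ $$R_1+R_2\le\tfrac12\log\left|I+H_1S_1H_1^T+H_2S_2H_2^T\right| .$$
   Context: Channel: at each use, $y_1=H_1x_1+H_2x_2+z_1$ and $y_2=H_3x_1+H_4x_2+z_2$, where $x_i$ is the real vector sent by transmitter $i$, $y_i$ is the vector seen by receiver $i$, the $H_j$ are fixed real matrices of compatible sizes known to all, and $z_1,z_2$ are Gaussian vectors with zero mean and identity covariance, independent of the inputs and i.i.d. over channel uses. A length-$n$ code with rates $(R_1,R_2)$: independent messages $m_i$ uniform on a set of size $\lceil e^{nR_i}\rceil$; transmitter $i$ maps $m_i$ to $(x_{i,1},\dots,x_{i,n})$ subject to the average power constraint $\frac1n\sum_{j=1}^nE\|x_{i,j}\|^2\le P_i$; receiver $i$ estimates $m_i$ from $(y_{i,1},\dots,y_{i,n})$ only. A pair of nonnegative rates is achievable if there are codes with error probabilities at both receivers tending to $0$ as $n\to\infty$; the capacity region is the closure of the set of achievable pairs. Notation: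 $|X|$ of a matrix is its determinant; $\log$ is natural; $A\succeq B$ means $A-B$ is positive semidefinite. *)

theory Defs
  imports "HOL-Probability.Probability"
begin

definition psd :: "real^'n^'n \<Rightarrow> bool" where
  "psd A \<longleftrightarrow> transpose A = A \<and> (\<forall>x. 0 \<le> x \<bullet> (A *v x))"

text \<open>The law of a Gaussian vector with zero mean and identity covariance.\<close>

definition std_gaussian :: "(real^'n) measure" where
  "std_gaussian = density lborel (\<lambda>z. ennreal (\<Prod>i\<in>UNIV. std_normal_density (z $ i)))"

definition noise :: "nat \<Rightarrow> (nat \<Rightarrow> real^'r) measure" where
  "noise n = PiM {..<n} (\<lambda>_. std_gaussian)"

definition num_messages :: "nat \<Rightarrow> real \<Rightarrow> nat" where
  "num_messages n R = nat \<lceil>exp (real n * R)\<rceil>"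

definition message :: "nat \<Rightarrow> real \<Rightarrow> nat pmf" where
  "message n R = pmf_of_set {..<num_messages n R}"

text \<open>
  Messages are numbered from 0, and so are the channel uses of a block.  An encoder maps a message
  and a channel use to the vector sent; a decoder maps a block of received vectors to a message.
\<close>

type_synonym 't encoder = "nat \<Rightarrow> nat \<Rightarrow> real^'t"
type_synonym 'r decoder = "(nat \<Rightarrow> real^'r) \<Rightarrow> nat"

definition valid_encoder :: "nat \<Rightarrow> real \<Rightarrow> real \<Rightarrow> 't::finite encoder \<Rightarrow> bool" where
  "valid_encoder n R P f \<longleftrightarrow>
     (\<Sum>j<n. measure_pmf.expectation (message n R) (\<lambda>m. (norm (f m j))\<^sup>2)) / real n \<le> P"

definition valid_decoder :: "nat \<Rightarrow> real \<Rightarrow> 'r::finite decoder \<Rightarrow> bool" where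
  "valid_decoder n R g \<longleftrightarrow>
     g \<in> measurable (PiM {..<n} (\<lambda>_. borel)) (count_space {..<num_messages n R})"

definition received ::
  "nat \<Rightarrow> real^'t1^'r \<Rightarrow> real^'t2^'r \<Rightarrow> (nat \<Rightarrow> real^'t1) \<Rightarrow> (nat \<Rightarrow> real^'t2) \<Rightarrow>
   (nat \<Rightarrow> real^'r) \<Rightarrow> nat \<Rightarrow> real^'r" where
  "received n A B x1 x2 z = (\<lambda>j\<in>{..<n}. A *v x1 j + B *v x2 j + z j)"

text \<open>
  The two messages together with the noise at one receiver.  The error probability at a receiver
  does not involve the noise at the other one, so no joint law of the two noises is needed.
\<close>

definition receiver_space ::
  "nat \<Rightarrow> real \<Rightarrow> real \<Rightarrow> (nat \<times> nat \<times> (nat \<Rightarrow> real^'r)) measure" where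
  "receiver_space n R1 R2 =
     measure_pmf (message n R1) \<Otimes>\<^sub>M (measure_pmf (message n R2) \<Otimes>\<^sub>M noise n)"

definition error1 ::
  "real^'t1^'r \<Rightarrow> real^'t2^'r \<Rightarrow> nat \<Rightarrow> real \<Rightarrow> real \<Rightarrow>
   't1::finite encoder \<Rightarrow> 't2::finite encoder \<Rightarrow> 'r::finite decoder \<Rightarrow> real" where
  "error1 H1 H2 n R1 R2 f1 f2 g1 =
     measure (receiver_space n R1 R2)
       {(m1, m2, z) \<in> space (receiver_space n R1 R2).
          g1 (received n H1 H2 (f1 m1) (f2 m2) z) \<noteq> m1}"

definition error2 ::
  "real^'t1^'r \<Rightarrow> real^'t2^'r \<Rightarrow> nat \<Rightarrow> real \<Rightarrow> real \<Rightarrow>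
   't1::finite encoder \<Rightarrow> 't2::finite encoder \<Rightarrow> 'r::finite decoder \<Rightarrow> real" where
  "error2 H3 H4 n R1 R2 f1 f2 g2 =
     measure (receiver_space n R1 R2)
       {(m1, m2, z) \<in> space (receiver_space n R1 R2).
          g2 (received n H3 H4 (f1 m1) (f2 m2) z) \<noteq> m2}"

definition achievable ::
  "real^'t1^'r1 \<Rightarrow> real^'t2^'r1 \<Rightarrow> real^'t1^'r2 \<Rightarrow> real^'t2^'r2 \<Rightarrow>
   real \<Rightarrow> real \<Rightarrow> real \<Rightarrow> real \<Rightarrow> bool" where
  "achievable H1 H2 H3 H4 P1 P2 R1 R2 \<longleftrightarrow>
     0 \<le> R1 \<and> 0 \<le> R2 \<and>
     (\<exists>f1 f2 g1 g2.
        (\<forall>n\<ge>1. valid_encoder n R1 P1 (f1 n) \<and> valid_encoder n R2 P2 (f2 n) \<and>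
                valid_decoder n R1 (g1 n) \<and> valid_decoder n R2 (g2 n)) \<and>
        (\<lambda>n. error1 H1 H2 n R1 R2 (f1 n) (f2 n) (g1 n)) \<longlonglongrightarrow> 0 \<and>
        (\<lambda>n. error2 H3 H4 n R1 R2 (f1 n) (f2 n) (g2 n)) \<longlonglongrightarrow> 0)"

definition capacity_region ::
  "real^'t1^'r1 \<Rightarrow> real^'t2^'r1 \<Rightarrow> real^'t1^'r2 \<Rightarrow> real^'t2^'r2 \<Rightarrow>
   real \<Rightarrow> real \<Rightarrow> (real \<times> real) set" where
  "capacity_region H1 H2 H3 H4 P1 P2 =
     closure {(R1, R2). achievable H1 H2 H3 H4 P1 P2 R1 R2}"

end

theory Submission
  imports Defs
begin

text \<open>
  Since \<open>H3 = 0\<close>, receiver 2 sees a point-to-point channel. Since \<open>H2\<^sup>T H2 \<succeq> H4\<^sup>T H4\<close>, receiver 1 can decode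
  whatever receiver 2 can: having decoded and removed the signal of transmitter 1, it applies \<open>H4 H2\<^sup>-\<^sup>1\<close> and adds
  independent noise to obtain an output with the law of that of receiver 2. So the converse is the one of a
  multiple access channel. Take the covariances \<open>S1\<close>, \<open>S2\<close> of the inputs of a code, averaged over messages and
  channel uses. Fano's inequality, with the output law compared to the Gaussian law of the same average covariance,
  gives the three bounds up to terms that vanish with the block length, and compactness of the set of admissible
  pairs \<open>(S1, S2)\<close> yields the limit.

  For the direct part, codewords are drawn as \<open>A u\<close> with \<open>u\<close> white Gaussian and \<open>A A\<^sup>T = t S\<close> for some \<open>t < 1\<close>.
  The receivers test the information density; receiver 1 accepts \<open>m1\<close> as soon as some \<open>m2\<close> fits, so that an error in
  \<open>m2\<close> alone does not hurt. A Chernoff bound controls the rejection of the true codewords and a Gaussian integral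
  the acceptance of independent ones. By Markov's inequality the codebooks satisfy the power constraints with a
  probability that is bounded below independently of the block length, so some codebook has both properties.
\<close>

section \<open>Linear maps and the standard Gaussian law\<close>

text \<open>Given the messages, an output block is a shifted white Gaussian, but its unconditional
  law is a mixture without a usable density. The converse avoids that mixture: each shifted law is
  compared with one Gaussian reference law, and the average covariance is what makes the quadratic
  terms cancel after averaging over messages and channel uses. Entropy never occurs; a linear change
  of variables for Gaussian densities does the work. Imitating receiver 2 is a randomised operation,
  so a decision must be a family of weights with sum at most 1, not a set of decoding regions. The
  mean of each codebook is removed at every channel use separately; otherwise the covariances of the
  two users would not add. Input covariances may be singular and are never inverted; codewords are
  images of white blocks under possibly singular maps, and the noise keeps \<open>I + S\<close>
  invertible. Two degenerate cases shape the direct part: at power 0 Markov's inequality cannot be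
  divided by the power, and at rate 0 a strict inequality below the bound may be impossible, but
  then there is a single message and no wrong candidate.\<close>

lemma borel_measurable_vec_lambda [measurable (raw)]:
  assumes [measurable]: "\<And>i. (\<lambda>x. f x i) \<in> borel_measurable M"
  shows "(\<lambda>x. (\<chi> i. f x i) :: real^'n) \<in> borel_measurable M"
  by (subst borel_measurable_euclidean_space) (auto simp: Basis_vec_def inner_axis)

lemma borel_measurable_matrix_vector [measurable (raw)]:
  fixes A :: "real^'n^'m"
  assumes "f \<in> borel_measurable M"
  shows "(\<lambda>x. A *v f x) \<in> borel_measurable M"
proof -
  have "continuous_on UNIV (\<lambda>x. A *v x)"
    by (intro linear_continuous_on) (simp add: linear_linear)
  then have "(\<lambda>x. A *v x) \<in> borel_measurable borel"
    by (rule borel_measurable_continuous_onI)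
  from measurable_compose[OF assms this] show ?thesis .
qed

lemma matrix_vector_borel:
  fixes A :: "real^'n^'m"
  shows "(\<lambda>x. A *v x) \<in> measurable borel borel" "(\<lambda>x. A *v x) \<in> measurable lborel borel"
  by measurable

text \<open>Both measures agree on open boxes. The product form is what allows swaps and shears of
  coordinates to be treated by Fubini's theorem.\<close>

lemma lborel_vec: "lborel = distr (PiM UNIV (\<lambda>_. lborel)) borel (\<lambda>f. (\<chi> i. f i) :: real^'n)"
proof (rule lborel_eqI)
  interpret product_sigma_finite "\<lambda>_::'n. lborel :: real measure" ..
  have meas: "(\<lambda>f. (\<chi> i. f i) :: real^'n) \<in> borel_measurable (PiM UNIV (\<lambda>_. lborel))"
    by measurable
  fix l u :: "real^'n" assume le: "\<And>b. b \<in> Basis \<Longrightarrow> l \<bullet> b \<le> u \<bullet> b"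
  have le': "l $ i \<le> u $ i" for i
    using le[of "axis i 1"] by (simp add: inner_axis)
  have pre: "(\<lambda>f. (\<chi> i. f i)) -` box l u \<inter> space (PiM UNIV (\<lambda>_. lborel)) = (\<Pi>\<^sub>E i\<in>UNIV. {l $ i <..< u $ i})"
    by (auto simp: box_vec_eq_empty mem_box_cart space_PiM PiE_def Pi_def extensional_def)
  have "(\<Prod>b\<in>Basis. (u - l) \<bullet> b) = (\<Prod>i\<in>UNIV. u $ i - l $ i)"
    by (simp add: Basis_vec_def prod.reindex inj_on_def axis_eq_axis inner_axis
        UNION_singleton_eq_range)
  then show "emeasure (distr (PiM UNIV (\<lambda>_. lborel)) borel (\<lambda>f. (\<chi> i. f i) :: real^'n)) (box l u)
     = (\<Prod>b\<in>Basis. (u - l) \<bullet> b)"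
    using meas by (simp add: emeasure_distr pre emeasure_PiM le' prod_ennreal)
qed simp

lemma nn_integral_lborel_vec:
  assumes "F \<in> borel_measurable borel"
  shows "(\<integral>\<^sup>+x. F x \<partial>(lborel :: (real^'n) measure)) = (\<integral>\<^sup>+f. F (\<chi> i. f i) \<partial>PiM UNIV (\<lambda>_. lborel))"
proof -
  have meas: "(\<lambda>f. (\<chi> i. f i) :: real^'n) \<in> borel_measurable (PiM UNIV (\<lambda>_. lborel))"
    by measurable
  show ?thesis
    by (subst lborel_vec) (use meas assms in \<open>simp add: nn_integral_distr\<close>)
qed

text \<open>Elementary matrices suffice: a diagonal matrix scales the coordinates, a swap permutes
  equal factors of a product measure, a shear translates one coordinate while the others are frozen.
  Keeping the Jacobian on the left avoids division in \<open>ennreal\<close>.\<close>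

lemma nn_integral_lborel_linear:
  fixes B :: "real^'n^'n"
  assumes "det B \<noteq> 0" "F \<in> borel_measurable borel"
  shows "(\<integral>\<^sup>+x. ennreal \<bar>det B\<bar> * F (B *v x) \<partial>lborel) = (\<integral>\<^sup>+x. F x \<partial>lborel)"
proof -
  have "det B \<noteq> 0 \<longrightarrow> (\<forall>F. F \<in> borel_measurable borel \<longrightarrow>
      (\<integral>\<^sup>+x. ennreal \<bar>det B\<bar> * F (B *v x) \<partial>lborel) = (\<integral>\<^sup>+x. F x \<partial>lborel))" (is "?P B")
  proof (induction B rule: induct_matrix_elementary)
    case (1 A B)
    show ?case
    proof (intro impI allI)
      assume "det (A ** B) \<noteq> 0"
      then have nz: "det A \<noteq> 0" "det B \<noteq> 0" by (auto simp: det_mul)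
      fix F :: "real^'n \<Rightarrow> ennreal" assume [measurable]: "F \<in> borel_measurable borel"
      have "(\<integral>\<^sup>+x. F x \<partial>lborel) = (\<integral>\<^sup>+x. ennreal \<bar>det A\<bar> * F (A *v x) \<partial>lborel)"
        using 1 nz by auto
      also have "\<dots> = (\<integral>\<^sup>+x. ennreal \<bar>det B\<bar> * (ennreal \<bar>det A\<bar> * F (A *v (B *v x))) \<partial>lborel)"
        by (rule 1(2)[rule_format, OF nz(2), of "\<lambda>x. ennreal \<bar>det A\<bar> * F (A *v x)", symmetric]) measurable
      finally show "(\<integral>\<^sup>+x. ennreal \<bar>det (A ** B)\<bar> * F ((A ** B) *v x) \<partial>lborel) = (\<integral>\<^sup>+x. F x \<partial>lborel)"
        by (simp add: det_mul abs_mult ennreal_mult mult_ac matrix_vector_mul_assoc)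
    qed
  next
    case (2 A i)
    then have "det A = 0" by (auto intro: det_zero_row)
    then show ?case by simp
  next
    case (3 A)
    show ?case
    proof (intro impI allI)
      assume "det A \<noteq> 0"
      then have nz: "A $ i $ i \<noteq> 0" for i
        by (auto simp: det_diagonal[OF 3])
      fix F :: "real^'n \<Rightarrow> ennreal" assume [measurable]: "F \<in> borel_measurable borel"
      \<comment> \<open>\<open>lborel_affine_euclidean\<close> takes scale factors indexed by
        \<open>Basis\<close>, so \<open>c\<close> recovers the index \<open>i\<close> from
        \<open>axis i 1\<close>.\<close>
      define c where "c b = (let i = (SOME i. b = axis i (1::real)) in A $ i $ i)" for b :: "real^'n"
      have c: "c (axis i 1) = A $ i $ i" for i
        by (simp add: c_def axis_eq_axis)
      have T: "0 + (\<Sum>j\<in>Basis. (c j * (x \<bullet> j)) *\<^sub>R j) = A *v x" for x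
      proof -
        have "(\<Sum>j\<in>Basis. (c j * (x \<bullet> j)) *\<^sub>R j) = (\<Sum>i\<in>UNIV. (A $ i $ i * x $ i) *\<^sub>R axis i 1)"
          by (simp add: Basis_vec_def sum.reindex inj_on_def axis_eq_axis inner_axis
              UNION_singleton_eq_range c)
        also have "\<dots> = A *v x"
        proof (simp add: vec_eq_iff matrix_vector_mult_def axis_def if_distrib cong: if_cong, intro allI)
          fix i
          have "(\<Sum>j\<in>UNIV. A $ i $ j * x $ j) = (\<Sum>j\<in>{i}. A $ i $ j * x $ j)"
            by (rule sum.mono_neutral_right) (auto simp: 3)
          then show "A $ i $ i * x $ i = (\<Sum>j\<in>UNIV. A $ i $ j * x $ j)" by simp
        qed
        finally show ?thesis by simp
      qed
      have "(\<Prod>j\<in>Basis. \<bar>c j\<bar>) = \<bar>det A\<bar>"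
        by (simp add: Basis_vec_def prod.reindex inj_on_def axis_eq_axis
              UNION_singleton_eq_range c det_diagonal[OF 3] abs_prod)
      moreover have "lborel = density (distr lborel borel (\<lambda>x. 0 + (\<Sum>j\<in>Basis. (c j * (x \<bullet> j)) *\<^sub>R j)))
          (\<lambda>_. (\<Prod>j\<in>Basis. \<bar>c j\<bar>))"
        by (rule lborel_affine_euclidean) (auto simp: Basis_vec_def c nz)
      ultimately have l: "lborel = density (distr lborel borel (\<lambda>x. A *v x)) (\<lambda>_. ennreal \<bar>det A\<bar>)"
        by (simp only: T)
      show "(\<integral>\<^sup>+x. ennreal \<bar>det A\<bar> * F (A *v x) \<partial>lborel) = (\<integral>\<^sup>+x. F x \<partial>lborel)"
        by (subst (2) l, subst nn_integral_density)
          (auto simp: nn_integral_distr matrix_vector_borel)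
    qed
  next
    case (4 m n)
    define A :: "real^'n^'n" where "A = (\<chi> i j. mat 1 $ i $ Transposition.transpose m n j)"
    have Ax: "A *v x = (\<chi> i. x $ Transposition.transpose m n i)" for x
    proof -
      have "(\<Sum>j\<in>UNIV. A $ i $ j * x $ j) = x $ Transposition.transpose m n i" for i
      proof -
        have "(\<Sum>j\<in>UNIV. A $ i $ j * x $ j) = (\<Sum>j\<in>{Transposition.transpose m n i}. A $ i $ j * x $ j)"
          by (rule sum.mono_neutral_right) (auto simp: A_def mat_def)
        then show ?thesis by (simp add: A_def mat_def)
      qed
      then show ?thesis by (simp add: matrix_vector_mult_def)
    qed
    \<comment> \<open>An involution has determinant of modulus 1, so the sign of the permutation
      need not be computed.\<close>
    have "A ** A = mat 1"
      by (simp add: matrix_eq matrix_vector_mul_assoc[symmetric] Ax)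
    then have "\<bar>det A\<bar> * \<bar>det A\<bar> = 1"
      by (metis abs_mult abs_one det_I det_mul)
    then have dA: "\<bar>det A\<bar> = 1"
      using power2_eq_1_iff[of "\<bar>det A\<bar>"] abs_ge_zero[of "det A"] by (auto simp: power2_eq_square)
    interpret product_sigma_finite "\<lambda>_::'n. lborel :: real measure" ..
    have "PiM UNIV (\<lambda>_. lborel) = distr (PiM UNIV (\<lambda>_. lborel)) (PiM UNIV (\<lambda>_. lborel :: real measure)) 
        (\<lambda>f. \<lambda>i\<in>UNIV. f (Transposition.transpose m n i))" (is "_ = distr ?M ?M ?T")
    proof (rule PiM_eqI[symmetric])
      have T: "?T \<in> measurable ?M ?M" by measurable
      fix X :: "'n \<Rightarrow> real set" assume X: "\<And>i. i \<in> UNIV \<Longrightarrow> X i \<in> sets lborel"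
      have pre: "?T -` (Pi\<^sub>E UNIV X) \<inter> space ?M = Pi\<^sub>E UNIV (\<lambda>i. X (Transposition.transpose m n i))"
        by (auto simp: space_PiM PiE_def Pi_def extensional_def) (metis transpose_involutory)+
      have "emeasure (distr ?M ?M ?T) (Pi\<^sub>E UNIV X) = emeasure ?M (Pi\<^sub>E UNIV (\<lambda>i. X (Transposition.transpose m n i)))"
        using T X by (subst emeasure_distr) (auto simp: pre intro!: sets_PiM_I_finite)
      also have "\<dots> = (\<Prod>i\<in>UNIV. emeasure lborel (X (Transposition.transpose m n i)))"
        using X by (subst emeasure_PiM) auto
      also have "\<dots> = (\<Prod>i\<in>UNIV. emeasure lborel (X i))"
        by (rule prod.reindex_bij_witness[where i = "Transposition.transpose m n" and j = "Transposition.transpose m n"]) auto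
      finally show "emeasure (distr ?M ?M ?T) (Pi\<^sub>E UNIV X) = (\<Prod>i\<in>UNIV. emeasure lborel (X i))" .
    qed auto
    note PT = this
    have "(\<integral>\<^sup>+x. F (A *v x) \<partial>lborel) = (\<integral>\<^sup>+x. F x \<partial>lborel)"
      if [measurable]: "F \<in> borel_measurable borel" for F :: "real^'n \<Rightarrow> ennreal"
    proof -
      have meas: "(\<lambda>f. (\<chi> i. f i) :: real^'n) \<in> borel_measurable (PiM UNIV (\<lambda>_. lborel))"
        by measurable
      have [measurable]: "(\<lambda>f. F (\<chi> i. f i)) \<in> borel_measurable (PiM UNIV (\<lambda>_. lborel))"
        by (rule measurable_compose[OF meas that])
      have "(\<integral>\<^sup>+x. F x \<partial>lborel) = (\<integral>\<^sup>+f. F (\<chi> i. f i) \<partial>PiM UNIV (\<lambda>_. lborel))"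
        by (rule nn_integral_lborel_vec[OF that])
      also have "\<dots> = (\<integral>\<^sup>+f. F (A *v (\<chi> i. f i)) \<partial>PiM UNIV (\<lambda>_. lborel))"
        by (subst PT, subst nn_integral_distr) (auto simp: Ax)
      also have "\<dots> = (\<integral>\<^sup>+x. F (A *v x) \<partial>lborel)"
        by (rule nn_integral_lborel_vec[symmetric]) measurable
      finally show ?thesis ..
    qed
    then show ?case by (simp add: A_def[symmetric] dA)
  next
    case (5 m n c)
    define A :: "real^'n^'n" where "A = (\<chi> i j. if i = m \<and> j = n then c else of_bool (i = j))"
    have Ax: "A *v x = (\<chi> i. if i = m then x $ m + c * x $ n else x $ i)" for x
    proof -
      have "(\<Sum>j\<in>UNIV. A $ i $ j * x $ j) = (if i = m then x $ m + c * x $ n else x $ i)" for i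
      proof -
        have "(\<Sum>j\<in>UNIV. A $ i $ j * x $ j) = (\<Sum>j\<in>{i} \<union> (if i = m then {n} else {}). A $ i $ j * x $ j)"
          by (rule sum.mono_neutral_right) (auto simp: A_def)
        then show ?thesis using 5 by (simp add: A_def)
      qed
      then show ?thesis by (simp add: matrix_vector_mult_def)
    qed
    have "A = (\<chi> k. if k = m then row m (mat 1) + c *s row n (mat 1) else row k (mat 1))"
      using 5 by (auto simp: A_def vec_eq_iff row_def mat_def)
    then have dA: "det A = 1"
      using det_row_operation[OF 5, of "mat 1 :: real^'n^'n" c] by (simp only: det_I)
    interpret product_sigma_finite "\<lambda>_::'n. lborel :: real measure" ..
    have "(\<integral>\<^sup>+x. F (A *v x) \<partial>lborel) = (\<integral>\<^sup>+x. F x \<partial>lborel)"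
      if [measurable]: "F \<in> borel_measurable borel" for F :: "real^'n \<Rightarrow> ennreal"
    proof -
      have meas: "(\<lambda>f. (\<chi> i. f i) :: real^'n) \<in> borel_measurable (PiM UNIV (\<lambda>_. lborel))"
        by measurable
      have U: "(UNIV :: 'n set) = insert m (UNIV - {m})" by auto
      have *: "(\<integral>\<^sup>+x. G x \<partial>lborel) = (\<integral>\<^sup>+f. (\<integral>\<^sup>+y. G (\<chi> i. (f(m := y)) i) \<partial>lborel) \<partial>PiM (UNIV - {m}) (\<lambda>_. lborel))"
        if "G \<in> borel_measurable borel" for G :: "real^'n \<Rightarrow> ennreal"
      proof -
        have "(\<lambda>f. G (\<chi> i. f i)) \<in> borel_measurable (PiM (insert m (UNIV - {m})) (\<lambda>_. lborel))"
          using measurable_compose[OF meas that] by (simp only: U[symmetric])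
        from product_nn_integral_insert[OF _ _ this] show ?thesis
          by (simp only: nn_integral_lborel_vec[OF that] U[symmetric]) auto
      qed
      \<comment> \<open>With the other coordinates frozen, the shear translates coordinate
        \<open>m\<close> by \<open>c * f n\<close>; since \<open>m\<close> and \<open>n\<close>
        differ, this amount does not depend on the integration variable.\<close>
      have "(\<integral>\<^sup>+y. F (A *v (\<chi> i. (f(m := y)) i)) \<partial>lborel) = (\<integral>\<^sup>+y. F (\<chi> i. (f(m := y)) i) \<partial>lborel)" for f
      proof -
        have v: "(\<lambda>y. (\<chi> i. (f(m := y)) i)) \<in> borel_measurable borel"
          by (auto simp: fun_upd_def)
        have "(\<integral>\<^sup>+y. F (\<chi> i. (f(m := y)) i) \<partial>lborel) = (\<integral>\<^sup>+y. F (\<chi> i. (f(m := y)) i) \<partial>distr lborel borel ((+) (c * f n)))"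
          by (simp add: lborel_distr_plus)
        also have "\<dots> = (\<integral>\<^sup>+y. F (\<chi> i. (f(m := c * f n + y)) i) \<partial>lborel)"
          by (subst nn_integral_distr) (auto intro!: measurable_compose[OF v])
        also have "\<dots> = (\<integral>\<^sup>+y. F (A *v (\<chi> i. (f(m := y)) i)) \<partial>lborel)"
          using 5 by (intro nn_integral_cong arg_cong[of _ _ F]) (auto simp: Ax vec_eq_iff)
        finally show ?thesis ..
      qed
      then show ?thesis
        by (simp add: * del: fun_upd_apply)
    qed
    then show ?case by (simp add: A_def[symmetric] dA)
  qed
  then show ?thesis using assms by auto
qed

lemma nn_integral_lborel_matrix:
  fixes B :: "real^'n^'n" and s :: "real^'n"
  assumes "invertible B" and [measurable]: "f \<in> borel_measurable borel"
  shows "(\<integral>\<^sup>+x. ennreal \<bar>det B\<bar> * f (B *v x + s) \<partial>lborel) = (\<integral>\<^sup>+x. f x \<partial>lborel)"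
proof -
  have "(\<integral>\<^sup>+x. f x \<partial>lborel) = (\<integral>\<^sup>+x. f x \<partial>distr lborel borel ((+) s))"
    by (simp add: lborel_distr_plus)
  also have "\<dots> = (\<integral>\<^sup>+x. f (s + x) \<partial>lborel)"
    by (subst nn_integral_distr) auto
  also have "\<dots> = (\<integral>\<^sup>+x. ennreal \<bar>det B\<bar> * f (B *v x + s) \<partial>lborel)"
    using assms(1) by (subst nn_integral_lborel_linear[symmetric, of B])
      (auto simp: invertible_det_nz add.commute)
  finally show ?thesis by simp
qed

definition gauss :: "real^'n \<Rightarrow> real" where
  "gauss z = (1 / sqrt (2 * pi)) ^ CARD('n) * exp (- (norm z)\<^sup>2 / 2)"

lemma gauss_pos: "gauss z > 0" and gauss_nonneg [simp]: "0 \<le> gauss z"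
  by (simp_all add: gauss_def)

lemma gauss_nz [simp]: "gauss z \<noteq> 0"
  using gauss_pos[of z] by simp

lemma gauss_measurable [measurable]: "gauss \<in> borel_measurable borel"
  unfolding gauss_def[abs_def] by measurable

lemma power2_norm_vec: "(norm (z::real^'n))\<^sup>2 = (\<Sum>i\<in>UNIV. (z $ i)\<^sup>2)"
  by (simp add: norm_vec_def L2_set_def sum_nonneg)

lemma gauss_prod: "(\<Prod>i\<in>UNIV. std_normal_density (z $ i)) = gauss z"
  by (simp add: normal_density_def gauss_def prod.distrib exp_sum[symmetric] power2_norm_vec
      sum_negf sum_divide_distrib prod_dividef power_one_over)

lemma std_gaussian_density: "std_gaussian = density lborel (\<lambda>z. ennreal (gauss z))"
  by (simp add: std_gaussian_def gauss_prod)

lemma sets_std_gaussian [simp, measurable_cong]: "sets std_gaussian = sets borel"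
  and space_std_gaussian [simp]: "space std_gaussian = UNIV"
  by (simp_all add: std_gaussian_density)

lemma nn_integral_std_gaussian:
  "f \<in> borel_measurable borel \<Longrightarrow>
   (\<integral>\<^sup>+z. f z \<partial>std_gaussian) = (\<integral>\<^sup>+z. ennreal (gauss z) * f z \<partial>lborel)"
  unfolding std_gaussian_density by (subst nn_integral_density) auto

lemma Basis_vec_axis: "(Basis :: (real^'n) set) = (\<lambda>i. axis i 1) ` UNIV"
  by (auto simp: Basis_vec_def)

lemma nn_integral_lborel_vec_prod:
  fixes f :: "'n::finite \<Rightarrow> real \<Rightarrow> real"
  assumes "\<And>i. f i \<in> borel_measurable borel" "\<And>i x. 0 \<le> f i x"
  shows "(\<integral>\<^sup>+z. ennreal (\<Prod>i\<in>UNIV. f i (z $ i)) \<partial>(lborel :: (real^'n) measure))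
       = (\<Prod>i\<in>UNIV. \<integral>\<^sup>+x. ennreal (f i x) \<partial>lborel)"
proof -
  define g where "g b x = ennreal (f (SOME i. b = axis i (1::real)) x)" for b :: "real^'n" and x
  have g: "g (axis i 1) = (\<lambda>x. ennreal (f i x))" for i
    by (simp add: g_def axis_eq_axis fun_eq_iff)
  have inj: "inj_on (\<lambda>i. axis i (1::real)) (UNIV :: 'n set)"
    by (auto simp: inj_on_def axis_eq_axis)
  have "(\<integral>\<^sup>+z. (\<Prod>b\<in>Basis. g b (z \<bullet> b)) \<partial>(lborel :: (real^'n) measure))
      = (\<Prod>b\<in>Basis. \<integral>\<^sup>+x. g b x \<partial>lborel)"
    by (rule nn_integral_lborel_prod) (auto simp: g_def assms intro!: measurable_compose[OF assms(1)])
  then show ?thesis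
    by (simp add: Basis_vec_axis prod.reindex[OF inj] g inner_axis prod_ennreal assms)
qed

lemma nn_integral_gauss: "(\<integral>\<^sup>+z. ennreal (gauss z) \<partial>lborel) = 1"
proof -
  have "(\<integral>\<^sup>+x. ennreal (std_normal_density x) \<partial>lborel) = 1"
    using prob_space.emeasure_space_1[OF prob_space_normal_density[of 1 0]]
    by (simp add: emeasure_density)
  then show ?thesis
    using nn_integral_lborel_vec_prod[of "\<lambda>_. std_normal_density"]
    by (simp add: gauss_prod)
qed

lemma prob_space_std_gaussian: "prob_space std_gaussian"
  by standard (simp add: std_gaussian_density emeasure_density nn_integral_gauss)

interpretation std_gaussian: prob_space std_gaussian
  by (rule prob_space_std_gaussian)

text \<open>The weight is a likelihood ratio: \<open>\<bar>det B\<bar> * gauss (B *v z + s)\<close>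
  is the density at \<open>z\<close> of the vector that \<open>B\<close> and \<open>s\<close> map to
  a standard Gaussian one. Phrased relative to \<open>std_gaussian\<close> instead of
  \<open>lborel\<close>, the identity carries over to product measures.\<close>

lemma std_gaussian_affine:
  fixes B :: "real^'n^'n"
  assumes "invertible B" and [measurable]: "F \<in> borel_measurable borel"
  shows "(\<integral>\<^sup>+z. ennreal (\<bar>det B\<bar> * gauss (B *v z + s) / gauss z) * F (B *v z + s) \<partial>std_gaussian)
       = (\<integral>\<^sup>+z. F z \<partial>std_gaussian)"
proof -
  have "(\<integral>\<^sup>+z. ennreal (\<bar>det B\<bar> * gauss (B *v z + s) / gauss z) * F (B *v z + s) \<partial>std_gaussian)
     = (\<integral>\<^sup>+z. ennreal (gauss z) * (ennreal (\<bar>det B\<bar> * gauss (B *v z + s) / gauss z) * F (B *v z + s)) \<partial>lborel)"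
    by (subst nn_integral_std_gaussian) auto
  also have "\<dots> = (\<integral>\<^sup>+z. ennreal \<bar>det B\<bar> * (ennreal (gauss (B *v z + s)) * F (B *v z + s)) \<partial>lborel)"
    by (intro nn_integral_cong)
      (auto simp: mult.assoc[symmetric] ennreal_mult'[symmetric])
  also have "\<dots> = (\<integral>\<^sup>+z. ennreal (gauss z) * F z \<partial>lborel)"
    using nn_integral_lborel_matrix[OF assms(1), of "\<lambda>z. ennreal (gauss z) * F z" s] by simp
  finally show ?thesis by (simp add: nn_integral_std_gaussian)
qed

section \<open>Positive semidefinite matrices\<close>

text \<open>Keeps \<^term>\<open>transpose A *v x\<close> from being rewritten to \<^term>\<open>x v* A\<close>.\<close>

declare transpose_matrix_vector [simp del]

lemma symmetric_entry: "transpose S = S \<Longrightarrow> S $ i $ j = S $ j $ i"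
  by (metis transpose_def vec_lambda_beta)

lemma inner_transpose: "x \<bullet> (transpose A *v y) = (A *v x) \<bullet> (y :: real^'m)"
  by (metis dot_lmul_matrix vector_transpose_matrix)

lemma psd_mult_transpose: "psd (A ** transpose A)"
  by (auto simp: psd_def matrix_transpose_mul matrix_vector_mul_assoc[symmetric] inner_transpose)
    (metis inner_ge_zero inner_transpose transpose_transpose)

lemma psd_add: "psd A \<Longrightarrow> psd B \<Longrightarrow> psd (A + B)"
  by (auto simp: psd_def matrix_vector_mult_add_rdistrib inner_add_right transpose_def vec_eq_iff)

lemma psd_conj: "psd S \<Longrightarrow> psd (M ** S ** transpose M)"
  by (auto simp: psd_def matrix_transpose_mul matrix_mul_assoc)
    (metis inner_transpose matrix_vector_mul_assoc transpose_transpose)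

lemma psd_scaleR: "psd S \<Longrightarrow> 0 \<le> t \<Longrightarrow> psd (t *\<^sub>R S)"
  by (auto simp: psd_def transpose_def vec_eq_iff scaleR_matrix_vector_assoc[symmetric])

lemma inner_matrix_axis: "axis i 1 \<bullet> (S *v x) = (S *v x) $ i" for S :: "real^'n^'m"
  by (simp add: inner_axis' )

lemma matrix_axis: "(S *v axis j 1) $ i = S $ i $ j" for S :: "real^'n^'m"
  by (simp add: matrix_vector_mult_basis column_def)

lemma psd_diag: "psd S \<Longrightarrow> 0 \<le> S $ i $ i"
  unfolding psd_def by (metis inner_matrix_axis matrix_axis)

lemma psd_trace_nonneg: "psd S \<Longrightarrow> 0 \<le> trace S"
  by (simp add: trace_def psd_diag sum_nonneg)

lemma psd_entry_bound:
  assumes "psd S"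
  shows "2 * \<bar>S $ i $ j\<bar> \<le> S $ i $ i + S $ j $ j"
proof -
  have sym: "S $ j $ i = S $ i $ j" using assms by (intro symmetric_entry) (simp add: psd_def)
  have "0 \<le> (axis i 1 + c *\<^sub>R axis j 1) \<bullet> (S *v (axis i 1 + c *\<^sub>R axis j 1))" for c
    using assms by (simp add: psd_def)
  then have "0 \<le> S $ i $ i + 2 * c * S $ i $ j + c\<^sup>2 * S $ j $ j" for c
    by (simp add: matrix_vector_right_distrib matrix_vector_mult_scaleR inner_add_left inner_matrix_axis
        matrix_axis sym power2_eq_square algebra_simps)
  from this[of 1] this[of "-1"] show ?thesis by simp
qed

text \<open>Symmetric elimination, by induction on the number of nonzero diagonal entries:
  subtracting the rank-one matrix of the scaled row \<open>v\<close> leaves the Schur complement,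
  whose entry at \<open>i\<close> is 0. The claim about zero columns keeps column \<open>i\<close>
  of the smaller factor free to receive \<open>v\<close>; no eigenvalues are needed.\<close>

lemma psd_factor: "psd S \<Longrightarrow> \<exists>A. S = A ** transpose A \<and> (\<forall>j. S $ j $ j = 0 \<longrightarrow> column j A = 0)"
proof (induction "card {i. S $ i $ i \<noteq> 0}" arbitrary: S rule: less_induct)
  case less
  note psd = less.prems
  have sym: "S $ j $ i = S $ i $ j" for i j using psd by (intro symmetric_entry) (simp add: psd_def)
  show ?case
  proof (cases "\<forall>i. S $ i $ i = 0")
    case True
    then have "S = 0" using psd_entry_bound[OF psd] by (auto simp: vec_eq_iff)
    then show ?thesis
      by (intro exI[of _ 0]) (auto simp: column_def vec_eq_iff matrix_matrix_mult_def)
  next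
    case False
    then obtain i where i: "S $ i $ i \<noteq> 0" by auto
    with psd_diag[OF psd, of i] have s: "S $ i $ i > 0" by simp
    define v where "v = (1 / sqrt (S $ i $ i)) *\<^sub>R row i S"
    define S' where "S' = S - (\<chi> a b. v $ a * v $ b)"
    have vi: "v $ i * v $ i = S $ i $ i"
      using s by (simp add: v_def row_def)
    have vx: "v \<bullet> x = (S *v x) $ i / sqrt (S $ i $ i)" for x
      by (simp add: v_def inner_vec_def column_def matrix_vector_mult_def sum_divide_distrib row_def)
    have quad: "x \<bullet> (S' *v x) = x \<bullet> (S *v x) - (v \<bullet> x)\<^sup>2" for x
    proof -
      have "(\<chi> a b. v $ a * v $ b) *v x = (v \<bullet> x) *\<^sub>R v"
        by (simp add: vec_eq_iff matrix_vector_mult_def inner_vec_def sum_distrib_left mult_ac)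
      then show ?thesis
        by (simp add: S'_def matrix_vector_mult_diff_rdistrib inner_diff_right power2_eq_square inner_commute)
    qed
    have "psd S'"
      unfolding psd_def
    proof (intro conjI allI)
      show "transpose S' = S'"
      proof -
        have "S' $ b $ a = S' $ a $ b" for a b
          by (simp add: S'_def mult.commute[of "v $ b"] sym[of b a])
        then show ?thesis by (simp add: transpose_def vec_eq_iff)
      qed
      fix x
      \<comment> \<open>\<open>t\<close> minimises the quadratic form of \<open>S\<close> along the
        line \<open>x - t *\<^sub>R axis i 1\<close>, and the minimum is the value of the Schur
        complement at \<open>x\<close>.\<close>
      define t where "t = (S *v x) $ i / S $ i $ i"
      have xs: "(\<chi> k. S $ k $ i) \<bullet> x = (S *v x) $ i" "x \<bullet> (\<chi> k. S $ k $ i) = (S *v x) $ i"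
        by (simp_all add: inner_vec_def column_def matrix_vector_mult_def sym mult.commute)
      have "0 \<le> (x - t *\<^sub>R axis i 1) \<bullet> (S *v (x - t *\<^sub>R axis i 1))"
        using psd by (simp add: psd_def)
      also have "\<dots> = x \<bullet> (S *v x) - 2 * t * (S *v x) $ i + t\<^sup>2 * S $ i $ i"
        by (simp add: matrix_vector_mult_diff_distrib matrix_vector_mult_scaleR inner_diff_left inner_diff_right inner_matrix_axis
            matrix_axis power2_eq_square algebra_simps matrix_vector_mult_basis xs inner_axis' column_def)
      also have "\<dots> = x \<bullet> (S' *v x)"
      proof -
        have "(v \<bullet> x)\<^sup>2 = ((S *v x) $ i)\<^sup>2 / S $ i $ i"
          using s by (simp add: vx power_divide)
        moreover have "2 * t * (S *v x) $ i - t\<^sup>2 * S $ i $ i = ((S *v x) $ i)\<^sup>2 / S $ i $ i"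
          using s by (simp add: t_def power_divide power2_eq_square)
        ultimately show ?thesis unfolding quad by linarith
      qed
      finally show "0 \<le> x \<bullet> (S' *v x)" .
    qed
    moreover have S'i: "S' $ i $ i = 0" by (simp add: S'_def vi)
    moreover have S'j: "S' $ j $ j = 0" if "S $ j $ j = 0" for j
    proof -
      have *: "S' $ j $ j = - (v $ j * v $ j)" using that by (simp add: S'_def)
      then show ?thesis
        using psd_diag[OF \<open>psd S'\<close>, of j] zero_le_square[of "v $ j"] by linarith
    qed
    have "{j. S' $ j $ j \<noteq> 0} \<subset> {j. S $ j $ j \<noteq> 0}"
      using S'i S'j i by auto
    then have "card {j. S' $ j $ j \<noteq> 0} < card {j. S $ j $ j \<noteq> 0}"
      by (intro psubset_card_mono) auto
    ultimately obtain A where A: "S' = A ** transpose A" "\<And>j. S' $ j $ j = 0 \<Longrightarrow> column j A = 0"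
      using less.hyps by blast
    define A' where "A' = (\<chi> a b. if b = i then v $ a else A $ a $ b)"
    have Ai: "A $ a $ i = 0" for a using A(2)[OF S'i] by (simp add: column_def vec_eq_iff)
    have "A' ** transpose A' = S"
    proof -
      have "(\<Sum>k\<in>UNIV. A' $ a $ k * A' $ b $ k) = v $ a * v $ b + (\<Sum>k\<in>UNIV. A $ a $ k * A $ b $ k)" for a b
      proof -
        have "(\<Sum>k\<in>UNIV. A' $ a $ k * A' $ b $ k)
          = (\<Sum>k\<in>UNIV. (if k = i then v $ a * v $ b else 0) + A $ a $ k * A $ b $ k)"
          by (rule sum.cong) (auto simp: A'_def Ai)
        then show ?thesis by (simp add: sum.distrib)
      qed
      moreover have "S' $ a $ b = (\<Sum>k\<in>UNIV. A $ a $ k * A $ b $ k)" for a b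
        by (simp add: A(1) matrix_matrix_mult_def transpose_def)
      ultimately show ?thesis
        by (simp add: vec_eq_iff matrix_matrix_mult_def transpose_def) (simp add: S'_def algebra_simps)
    qed
    moreover have "column j A' = 0" if "S $ j $ j = 0" for j
      using A(2)[OF S'j[OF that]] that i by (auto simp: column_def A'_def vec_eq_iff)
    ultimately show ?thesis by metis
  qed
qed

lemma psd_factor_mat1:
  fixes S :: "real^'n^'n"
  assumes "psd S"
  obtains L :: "real^'n^'n" where "invertible L" "mat 1 + S = L ** transpose L" "det (mat 1 + S) = (det L)\<^sup>2"
proof -
  have "psd (mat 1 + S)"
    by (rule psd_add[OF _ assms]) (simp add: psd_def)
  then obtain L :: "real^'n^'n" where L: "mat 1 + S = L ** transpose L" using psd_factor[of "mat 1 + S"] by metis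
  have "x = 0" if "transpose L *v x = 0" for x
  proof -
    have "(mat 1 + S) *v x = 0" using that by (simp add: L matrix_vector_mul_assoc[symmetric])
    then have "x \<bullet> x + x \<bullet> (S *v x) = 0"
      by (metis inner_add_right inner_zero_right matrix_vector_mul_lid matrix_vector_mult_add_rdistrib)
    then show ?thesis using assms
      by (metis add_nonneg_eq_0_iff inner_eq_zero_iff inner_ge_zero psd_def)
  qed
  then have "inj ((*v) (transpose L))"
    by (simp add: linear_injective_0)
  then have "invertible (transpose L)"
    by (simp add: invertible_left_inverse matrix_left_invertible_injective)
  then have "invertible L" by (simp add: invertible_det_nz)
  then show ?thesis using that[OF _ L] by (simp add: L det_mul power2_eq_square)
qed

text \<open>\<open>B\<close> is the inverse of the factor of \<open>mat 1 + S\<close>. Its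
  determinant is the only way in which the rate \<open>1 / 2 * ln (det (mat 1 + S))\<close> enters
  the probabilistic arguments: as the Jacobian of whitening.\<close>

lemma psd_whitening:
  fixes S :: "real^'n^'n"
  assumes "psd S"
  obtains B :: "real^'n^'n" where "invertible B" "B ** (mat 1 + S) ** transpose B = mat 1"
    "- ln \<bar>det B\<bar> = 1 / 2 * ln (det (mat 1 + S))" "det (mat 1 + S) \<noteq> 0"
proof -
  obtain L :: "real^'n^'n" where L: "invertible L" "mat 1 + S = L ** transpose L" "det (mat 1 + S) = (det L)\<^sup>2"
    using psd_factor_mat1[OF assms] .
  obtain B where BL: "B ** L = mat 1" "L ** B = mat 1"
    using L(1) by (auto simp: invertible_def)
  have "det B * det L = 1" by (metis BL(1) det_I det_mul)
  then have "\<bar>det B\<bar> * \<bar>det L\<bar> = 1" "det L \<noteq> 0"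
    by (auto simp flip: abs_mult)
  then have dB: "\<bar>det B\<bar> = 1 / \<bar>det L\<bar>" "det L \<noteq> 0"
    by (simp_all add: field_simps)
  have "B ** (mat 1 + S) ** transpose B = (B ** L) ** transpose (B ** L)"
    by (simp add: L(2) matrix_transpose_mul matrix_mul_assoc)
  then have "B ** (mat 1 + S) ** transpose B = mat 1" by (simp add: BL)
  moreover have "invertible B" using BL by (auto simp: invertible_def)
  moreover have "- ln \<bar>det B\<bar> = 1 / 2 * ln (det (mat 1 + S))"
  proof -
    have "ln ((det L)\<^sup>2) = ln (\<bar>det L\<bar> ^ 2)" by simp
    also have "\<dots> = 2 * ln \<bar>det L\<bar>" using dB(2) by (subst ln_realpow) auto
    finally show ?thesis using dB by (simp add: L(3) ln_div)
  qed
  ultimately show ?thesis using that dB L(3) by simp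
qed

text \<open>One-sided inverses of square matrices are two-sided, so \<open>transpose B ** B\<close>
  is the inverse of the covariance \<open>K\<close>; this supplies the vector \<open>k\<close> used
  in completing the square.\<close>

lemma whitening_inverse:
  fixes B K :: "real^'n^'n"
  assumes "B ** K ** transpose B = mat 1"
  shows "invertible B" "K ** (transpose B ** B) = mat 1"
proof -
  have *: "B ** (K ** transpose B) = mat 1" using assms by (simp add: matrix_mul_assoc)
  then show "invertible B" by (metis invertible_right_inverse)
  from * have "(K ** transpose B) ** B = mat 1" by (simp add: matrix_left_right_inverse)
  then show "K ** (transpose B ** B) = mat 1" by (simp add: matrix_mul_assoc)
qed

section \<open>Sums of Gaussian vectors\<close>

lemma matrix_add_mult_distrib_right:
  fixes A B :: "real^'n^'m"
  shows "(A + B) ** C = A ** C + B ** C"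
  by (simp add: matrix_matrix_mult_def vec_eq_iff sum.distrib distrib_right)

lemma gauss_mult:
  "gauss (x :: real^'n) * gauss (y :: real^'n) = ((1 / sqrt (2 * pi)) ^ CARD('n))\<^sup>2 * exp (- ((norm x)\<^sup>2 + (norm y)\<^sup>2) / 2)"
proof -
  have *: "- ((norm x)\<^sup>2 + (norm y)\<^sup>2) / 2 = - (norm x)\<^sup>2 / 2 + - (norm y)\<^sup>2 / 2" by simp
  show ?thesis unfolding * exp_add gauss_def power2_eq_square[of "_ ^ _"] by (simp only: mult_ac)
qed

text \<open>Completing the square: with \<^term>\<open>k\<close> the solution of \<open>(I + G G\<^sup>T) k = y\<close>, the minimum over \<open>u\<close> is attained at \<open>G\<^sup>T k\<close>.\<close>

lemma complete_square:
  fixes B G E :: "real^'n^'n" and y u :: "real^'n"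
  assumes B: "B ** (mat 1 + G ** transpose G) ** transpose B = mat 1"
    and E: "mat 1 + transpose G ** G = transpose E ** E"
  defines "k \<equiv> (transpose B ** B) *v y"
  shows "(norm (y - G *v u))\<^sup>2 + (norm u)\<^sup>2
    = (norm (B *v y))\<^sup>2 + (norm (E *v u - E *v (transpose G *v k)))\<^sup>2"
proof -
  have "(mat 1 + G ** transpose G) *v k = y"
    unfolding k_def matrix_vector_mul_assoc whitening_inverse(2)[OF B] by simp
  then have yk: "y = k + G *v (transpose G *v k)"
    by (simp add: matrix_vector_mult_add_rdistrib matrix_vector_mul_assoc)
  have Bk: "(norm (B *v y))\<^sup>2 = y \<bullet> k"
    by (simp add: k_def power2_norm_eq_inner inner_transpose matrix_vector_mul_assoc[symmetric])
  have En: "(norm (E *v v))\<^sup>2 = (norm v)\<^sup>2 + (norm (G *v v))\<^sup>2" for v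
  proof -
    have "(norm (E *v v))\<^sup>2 = v \<bullet> (transpose E *v (E *v v))"
      by (simp add: power2_norm_eq_inner inner_transpose)
    also have "\<dots> = v \<bullet> ((mat 1 + transpose G ** G) *v v)"
      by (simp add: E matrix_vector_mul_assoc)
    also have "\<dots> = (norm v)\<^sup>2 + (norm (G *v v))\<^sup>2"
      by (simp add: power2_norm_eq_inner matrix_vector_mult_add_rdistrib inner_add_right
          matrix_vector_mul_assoc[symmetric] inner_transpose)
    finally show ?thesis .
  qed
  define v where "v = u - transpose G *v k"
  have u: "u = v + transpose G *v k" by (simp add: v_def)
  have yu: "y - G *v u = k - G *v v"
    by (subst yk) (simp add: u matrix_vector_right_distrib)
  have "(norm (y - G *v u))\<^sup>2 + (norm u)\<^sup>2
      = k \<bullet> k + (transpose G *v k) \<bullet> (transpose G *v k) + (norm v)\<^sup>2 + (norm (G *v v))\<^sup>2"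
    unfolding yu unfolding u power2_norm_eq_inner
    by (simp add: inner_diff_left inner_diff_right inner_add_left inner_add_right inner_transpose
        inner_commute[of "transpose G *v k" v] inner_commute[of k "G *v v"] matrix_vector_right_distrib)
  also have "k \<bullet> k + (transpose G *v k) \<bullet> (transpose G *v k) = y \<bullet> k"
    using arg_cong[OF yk, of "\<lambda>z. z \<bullet> k"] by (simp add: inner_add_left inner_add_right inner_transpose inner_commute)
  finally have "(norm (y - G *v u))\<^sup>2 + (norm u)\<^sup>2 = (norm (B *v y))\<^sup>2 + (norm (E *v v))\<^sup>2"
    by (simp add: Bk En)
  then show ?thesis
    by (simp add: v_def matrix_vector_mult_diff_distrib)
qed

text \<open>The left side is the density at \<open>y\<close> of \<open>G u\<close> plus white noise.
  Completing the square separates \<open>y\<close> from \<open>u\<close>, and the integral over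
  \<open>u\<close> leaves a constant \<open>1 / \<bar>det E\<bar>\<close> that still has to be
  identified with \<open>\<bar>det B\<bar>\<close>.\<close>

lemma gauss_convolution:
  fixes B G :: "real^'n^'n"
  assumes B: "B ** (mat 1 + G ** transpose G) ** transpose B = mat 1"
  shows "(\<integral>\<^sup>+u. ennreal (gauss (y - G *v u)) \<partial>std_gaussian) = ennreal (\<bar>det B\<bar> * gauss (B *v y))"
proof -
  obtain L :: "real^'n^'n" where L: "invertible L"
    "mat 1 + transpose G ** transpose (transpose G) = L ** transpose L"
    using psd_factor_mat1[OF psd_mult_transpose[of "transpose G"]] by metis
  define E where "E = transpose L"
  have E: "invertible E" "mat 1 + transpose G ** G = transpose E ** E"
    using L by (simp_all add: E_def invertible_det_nz)
  then have dE: "det E \<noteq> 0" by (simp add: invertible_det_nz)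
  have conv: "(\<integral>\<^sup>+u. ennreal (gauss (y - G *v u)) \<partial>std_gaussian) = ennreal (gauss (B *v y) / \<bar>det E\<bar>)" for y
  proof -
    define s where "s = - (E *v (transpose G *v ((transpose B ** B) *v y)))"
    have "(\<integral>\<^sup>+u. ennreal (gauss (y - G *v u)) \<partial>std_gaussian)
        = (\<integral>\<^sup>+u. ennreal (gauss (y - G *v u) * gauss u) \<partial>lborel)"
      by (subst nn_integral_std_gaussian) (auto simp: ennreal_mult' mult.commute)
    also have "\<dots> = (\<integral>\<^sup>+u. ennreal (gauss (B *v y) / \<bar>det E\<bar>) * (ennreal \<bar>det E\<bar> * ennreal (gauss (E *v u + s))) \<partial>lborel)"
    proof (rule nn_integral_cong)
      fix u
      have "gauss (y - G *v u) * gauss u = gauss (B *v y) * gauss (E *v u + s)"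
        unfolding gauss_mult complete_square[OF B E(2)] s_def by simp
      also have "\<dots> = gauss (B *v y) / \<bar>det E\<bar> * (\<bar>det E\<bar> * gauss (E *v u + s))"
        using dE by simp
      finally show "ennreal (gauss (y - G *v u) * gauss u) = ennreal (gauss (B *v y) / \<bar>det E\<bar>) * (ennreal \<bar>det E\<bar> * ennreal (gauss (E *v u + s)))"
        by (simp only: ennreal_mult' ennreal_mult'' abs_ge_zero gauss_nonneg divide_nonneg_nonneg)
    qed
    also have "\<dots> = ennreal (gauss (B *v y) / \<bar>det E\<bar>) * (\<integral>\<^sup>+u. ennreal (gauss (u :: real^'n)) \<partial>lborel)"
      using nn_integral_lborel_matrix[OF E(1), of "\<lambda>u. ennreal (gauss u)" s]
      by (subst nn_integral_cmult) auto
    finally show ?thesis by (simp add: nn_integral_gauss)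
  qed
  interpret L: pair_sigma_finite "lborel :: (real^'n) measure" "std_gaussian :: (real^'n) measure"
    by (intro pair_sigma_finite.intro) (auto intro: prob_space_imp_sigma_finite prob_space_std_gaussian sigma_finite_lborel)
  have shift: "(\<integral>\<^sup>+y. ennreal (gauss (y - G *v u)) \<partial>lborel) = 1" for u
  proof -
    have "(\<integral>\<^sup>+y. ennreal \<bar>det (mat 1 :: real^'n^'n)\<bar> * ennreal (gauss (mat 1 *v y + (- (G *v u)))) \<partial>lborel) = 1"
      by (subst nn_integral_lborel_matrix[where f = "\<lambda>z. ennreal (gauss z)"]) (auto simp: nn_integral_gauss invertible_det_nz)
    then show ?thesis by simp
  qed
  \<comment> \<open>A density has total mass 1. Evaluating this mass in both orders of integration
    gives \<open>\<bar>det B\<bar> = 1 / \<bar>det E\<bar>\<close>, which stands in for the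
    determinant identity relating \<open>I + G G^T\<close> and \<open>I + G^T G\<close>.\<close>
  have "(\<integral>\<^sup>+u. (\<integral>\<^sup>+y. ennreal (gauss (y - G *v u)) \<partial>lborel) \<partial>std_gaussian) = 1"
    by (simp only: shift) (simp add: std_gaussian.emeasure_space_1[simplified])
  then have "1 = (\<integral>\<^sup>+y. (\<integral>\<^sup>+u. ennreal (gauss (y - G *v u)) \<partial>std_gaussian) \<partial>lborel)"
    by (subst L.Fubini'[symmetric]) auto
  also have "\<dots> = (\<integral>\<^sup>+y. ennreal (1 / (\<bar>det E\<bar> * \<bar>det B\<bar>)) * (ennreal \<bar>det B\<bar> * ennreal (gauss (B *v y + 0))) \<partial>lborel)"
  proof -
    have "det B \<noteq> 0" using whitening_inverse(1)[OF B] by (simp add: invertible_det_nz)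
    then have *: "gauss (B *v y) / \<bar>det E\<bar> = 1 / (\<bar>det E\<bar> * \<bar>det B\<bar>) * (\<bar>det B\<bar> * gauss (B *v y + 0))" for y
      by simp
    show ?thesis unfolding conv *
      by (intro nn_integral_cong) (simp only: ennreal_mult' ennreal_mult'' abs_ge_zero gauss_nonneg divide_nonneg_nonneg mult_nonneg_nonneg zero_le_one)
  qed
  also have "\<dots> = ennreal (1 / (\<bar>det E\<bar> * \<bar>det B\<bar>))"
    using nn_integral_lborel_matrix[OF whitening_inverse(1)[OF B], of "\<lambda>u. ennreal (gauss u)" 0]
    by (subst nn_integral_cmult) (auto simp: nn_integral_gauss)
  finally have "1 / (\<bar>det E\<bar> * \<bar>det B\<bar>) = 1" 
    by (metis ennreal_1 ennreal_inj abs_ge_zero divide_nonneg_nonneg mult_nonneg_nonneg zero_le_one)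
  then have "\<bar>det B\<bar> = 1 / \<bar>det E\<bar>" using dE by (auto simp: field_simps split: if_splits)
  then show ?thesis by (simp add: conv)
qed

text \<open>Substituting the sum for the inner variable \<open>w\<close> and exchanging the
  integrals produces the convolved density, which the change of variables by \<open>B\<close> turns
  into the standard one.\<close>

lemma nn_integral_std_gaussian_sum1:
  fixes B G :: "real^'n^'n"
  assumes B: "B ** (mat 1 + G ** transpose G) ** transpose B = mat 1" and [measurable]: "F \<in> borel_measurable borel"
  shows "(\<integral>\<^sup>+u. \<integral>\<^sup>+w. F (B *v (G *v u + w)) \<partial>std_gaussian \<partial>std_gaussian) = (\<integral>\<^sup>+v. F v \<partial>std_gaussian)"
proof -
  interpret L: pair_sigma_finite "lborel :: (real^'n) measure" "std_gaussian :: (real^'n) measure"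
    by (intro pair_sigma_finite.intro) (auto intro: prob_space_imp_sigma_finite prob_space_std_gaussian sigma_finite_lborel)
  have "(\<integral>\<^sup>+w. F (B *v (G *v u + w)) \<partial>std_gaussian) = (\<integral>\<^sup>+y. ennreal (gauss (y - G *v u)) * F (B *v y) \<partial>lborel)" for u
  proof -
    have "(\<integral>\<^sup>+w. F (B *v (G *v u + w)) \<partial>std_gaussian)
        = (\<integral>\<^sup>+w. ennreal (gauss w) * F (B *v (G *v u + w)) \<partial>lborel)"
      by (rule nn_integral_std_gaussian) measurable
    also have "\<dots> = (\<integral>\<^sup>+w. ennreal \<bar>det (mat 1 :: real^'n^'n)\<bar> * (ennreal (gauss (mat 1 *v w + G *v u - G *v u)) * F (B *v (mat 1 *v w + G *v u))) \<partial>lborel)"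
      by (simp add: add.commute)
    also have "\<dots> = (\<integral>\<^sup>+y. ennreal (gauss (y - G *v u)) * F (B *v y) \<partial>lborel)"
      by (rule nn_integral_lborel_matrix[where f = "\<lambda>y. ennreal (gauss (y - G *v u)) * F (B *v y)"]) (auto simp: invertible_det_nz)
    finally show ?thesis .
  qed
  then have "(\<integral>\<^sup>+u. \<integral>\<^sup>+w. F (B *v (G *v u + w)) \<partial>std_gaussian \<partial>std_gaussian)
     = (\<integral>\<^sup>+u. \<integral>\<^sup>+y. ennreal (gauss (y - G *v u)) * F (B *v y) \<partial>lborel \<partial>std_gaussian)"
    by simp
  also have "\<dots> = (\<integral>\<^sup>+y. \<integral>\<^sup>+u. ennreal (gauss (y - G *v u)) * F (B *v y) \<partial>std_gaussian \<partial>lborel)"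
    by (subst L.Fubini'[symmetric]) auto
  also have "\<dots> = (\<integral>\<^sup>+y. ennreal \<bar>det B\<bar> * (ennreal (gauss (B *v y + 0)) * F (B *v y + 0)) \<partial>lborel)"
    by (simp add: nn_integral_multc gauss_convolution[OF B] ennreal_mult' mult.assoc)
  also have "\<dots> = (\<integral>\<^sup>+v. ennreal (gauss v) * F v \<partial>lborel)"
    by (rule nn_integral_lborel_matrix[OF whitening_inverse(1)[OF B], where f = "\<lambda>y. ennreal (gauss y) * F y"]) auto
  finally show ?thesis by (simp add: nn_integral_std_gaussian)
qed

text \<open>Factoring out \<open>C\<close> reduces the claim to unit noise: \<open>B ** C\<close>
  whitens \<open>I + G' G'^T\<close>, where \<open>G'\<close> is the inverse of \<open>C\<close>
  times \<open>G\<close>. Hence only the matrix of the inner variable has to be invertible.\<close>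

lemma nn_integral_std_gaussian_sum:
  fixes B C G :: "real^'n^'n"
  assumes B: "B ** (C ** transpose C + G ** transpose G) ** transpose B = mat 1" and "invertible C"
    and F: "F \<in> borel_measurable borel"
  shows "(\<integral>\<^sup>+u. \<integral>\<^sup>+w. F (B *v (G *v u + C *v w)) \<partial>std_gaussian \<partial>std_gaussian) = (\<integral>\<^sup>+v. F v \<partial>std_gaussian)"
proof -
  obtain D where D: "C ** D = mat 1" "D ** C = mat 1" using assms(2) by (auto simp: invertible_def)
  define G' where "G' = D ** G"
  have G: "G = C ** G'" by (simp add: G'_def matrix_mul_assoc D)
  have "C ** transpose C + G ** transpose G = C ** (mat 1 + G' ** transpose G') ** transpose C"
    by (simp add: G matrix_add_ldistrib matrix_add_mult_distrib_right matrix_transpose_mul matrix_mul_assoc)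
  then have B': "(B ** C) ** (mat 1 + G' ** transpose G') ** transpose (B ** C) = mat 1"
    using B by (simp add: matrix_transpose_mul matrix_mul_assoc)
  have "B *v (G *v u + C *v w) = (B ** C) *v (G' *v u + w)" for u w
    by (simp add: G matrix_vector_right_distrib matrix_vector_mul_assoc matrix_mul_assoc)
  then show ?thesis using nn_integral_std_gaussian_sum1[OF B' F] by simp
qed

section \<open>Gaussian laws of blocks of channel uses\<close>

abbreviation block_space :: "nat \<Rightarrow> (nat \<Rightarrow> real^'n) measure" where
  "block_space n \<equiv> PiM {..<n} (\<lambda>_. borel)"

lemma sets_noise [measurable_cong]: "sets (noise n) = sets (block_space n)"
  unfolding noise_def by (intro sets_PiM_cong) auto

lemma prob_space_noise: "prob_space (noise n)"
  unfolding noise_def by (intro prob_space_PiM prob_space_std_gaussian)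

interpretation noise: prob_space "noise n" for n
  by (rule prob_space_noise)

interpretation std_gaussians: product_sigma_finite "\<lambda>_::nat. std_gaussian"
  by standard (rule std_gaussian.sigma_finite_countable)

lemma nn_integral_noise_prod:
  assumes "\<And>j. j < n \<Longrightarrow> f j \<in> borel_measurable borel"
  shows "(\<integral>\<^sup>+z. (\<Prod>j<n. f j (z j)) \<partial>noise n) = (\<Prod>j<n. \<integral>\<^sup>+z. f j z \<partial>std_gaussian)"
  unfolding noise_def by (rule std_gaussians.product_nn_integral_prod) (use assms in auto)

lemma noise_eqI:
  assumes "sets M = sets (block_space n)"
    and "\<And>A. (\<And>j. j < n \<Longrightarrow> A j \<in> sets borel) \<Longrightarrow>
      emeasure M (Pi\<^sub>E {..<n} A) = (\<Prod>j<n. emeasure std_gaussian (A j))"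
  shows "M = noise n"
  unfolding noise_def
  by (rule std_gaussians.PiM_eqI) (use assms in \<open>auto simp: sets_noise[unfolded noise_def]\<close>)

lemma indicator_PiE_prod:
  "finite I \<Longrightarrow> indicator (Pi\<^sub>E I A) (\<lambda>j\<in>I. f j) = (\<Prod>j\<in>I. indicator (A j) (f j) :: ennreal)"
  by (auto simp: indicator_def PiE_def Pi_def prod_zero_iff)

text \<open>It suffices to compare measures on rectangles, where everything factorises over the
  channel uses. The shift \<open>s j\<close> varies with \<open>j\<close> because it will be a
  whitened codeword, while \<open>B\<close> stays the same.\<close>

lemma nn_integral_noise_affine:
  fixes B :: "real^'n^'n"
  assumes "invertible B" and F [measurable]: "F \<in> borel_measurable (block_space n)"
  shows "(\<integral>\<^sup>+z. (\<Prod>j<n. ennreal (\<bar>det B\<bar> * gauss (B *v z j + s j) / gauss (z j))) * F (\<lambda>j\<in>{..<n}. B *v z j + s j) \<partial>noise n)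
       = (\<integral>\<^sup>+z. F z \<partial>noise n)"
proof -
  define r where "r z = (\<Prod>j<n. ennreal (\<bar>det B\<bar> * gauss (B *v z j + s j) / gauss (z j)))" for z
  define T where "T z = (\<lambda>j\<in>{..<n}. B *v z j + s j)" for z :: "nat \<Rightarrow> real^'n"
  have [measurable]: "r \<in> borel_measurable (noise n)" "T \<in> measurable (noise n) (block_space n)"
    unfolding r_def[abs_def] T_def[abs_def] by measurable
  have "distr (density (noise n) r) (block_space n) T = noise n"
  proof (rule noise_eqI)
    fix A :: "nat \<Rightarrow> (real^'n) set" assume [measurable]: "\<And>j. j < n \<Longrightarrow> A j \<in> sets borel"
    have A: "Pi\<^sub>E {..<n} A \<in> sets (block_space n)"
      by (rule sets_PiM_I_finite) auto
    have "emeasure (distr (density (noise n) r) (block_space n) T) (Pi\<^sub>E {..<n} A)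
        = (\<integral>\<^sup>+x. indicator (Pi\<^sub>E {..<n} A) x \<partial>distr (density (noise n) r) (block_space n) T)"
      using A by simp
    also have "\<dots> = (\<integral>\<^sup>+z. r z * indicator (Pi\<^sub>E {..<n} A) (T z) \<partial>noise n)"
      using A by (subst nn_integral_distr, simp, simp, subst nn_integral_density) auto
    also have "\<dots> = (\<integral>\<^sup>+z. (\<Prod>j<n. ennreal (\<bar>det B\<bar> * gauss (B *v z j + s j) / gauss (z j)) * indicator (A j) (B *v z j + s j)) \<partial>noise n)"
      by (simp add: r_def T_def indicator_PiE_prod prod.distrib)
    also have "\<dots> = (\<Prod>j<n. \<integral>\<^sup>+z. ennreal (\<bar>det B\<bar> * gauss (B *v z + s j) / gauss z) * indicator (A j) (B *v z + s j) \<partial>std_gaussian)"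
      by (rule nn_integral_noise_prod) measurable
    also have "\<dots> = (\<Prod>j<n. emeasure std_gaussian (A j))"
      by (intro prod.cong refl) (simp add: std_gaussian_affine[OF assms(1)])
    finally show "emeasure (distr (density (noise n) r) (block_space n) T) (Pi\<^sub>E {..<n} A)
      = (\<Prod>j<n. emeasure std_gaussian (A j))" .
  qed simp
  then have "(\<integral>\<^sup>+z. F z \<partial>noise n) = (\<integral>\<^sup>+z. F z \<partial>distr (density (noise n) r) (block_space n) T)"
    by simp
  also have "\<dots> = (\<integral>\<^sup>+z. r z * F (T z) \<partial>noise n)"
    by (subst nn_integral_distr, simp, simp, subst nn_integral_density) auto
  finally show ?thesis by (simp add: r_def T_def)
qed

text \<open>Again a comparison on rectangles: the double integral of a product of indicators is a
  product of double integrals over single channel uses, each given by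
  \<open>nn_integral_std_gaussian_sum\<close>.\<close>

lemma nn_integral_noise_sum:
  fixes B C G :: "real^'n^'n"
  assumes B: "B ** (C ** transpose C + G ** transpose G) ** transpose B = mat 1" "invertible C"
    and F [measurable]: "F \<in> borel_measurable (block_space n)"
  shows "(\<integral>\<^sup>+u. \<integral>\<^sup>+w. F (\<lambda>j\<in>{..<n}. B *v (G *v u j + C *v w j)) \<partial>noise n \<partial>noise n) = (\<integral>\<^sup>+z. F z \<partial>noise n)"
proof -
  define T where "T = (\<lambda>(u, w). (\<lambda>j\<in>{..<n}. B *v (G *v u j + C *v w j)) :: nat \<Rightarrow> real^'n)"
  have T [measurable]: "T \<in> measurable (noise n \<Otimes>\<^sub>M noise n) (block_space n)"
    unfolding T_def by measurable
  have "distr (noise n \<Otimes>\<^sub>M noise n) (block_space n) T = noise n"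
  proof (rule noise_eqI)
    fix A :: "nat \<Rightarrow> (real^'n) set" assume [measurable]: "\<And>j. j < n \<Longrightarrow> A j \<in> sets borel"
    have A [measurable]: "Pi\<^sub>E {..<n} A \<in> sets (block_space n)"
      by (rule sets_PiM_I_finite) auto
    have "emeasure (distr (noise n \<Otimes>\<^sub>M noise n) (block_space n) T) (Pi\<^sub>E {..<n} A)
        = (\<integral>\<^sup>+x. indicator (Pi\<^sub>E {..<n} A) x \<partial>distr (noise n \<Otimes>\<^sub>M noise n) (block_space n) T)"
      using A by simp
    also have "\<dots> = (\<integral>\<^sup>+x. indicator (Pi\<^sub>E {..<n} A) (T x) \<partial>(noise n \<Otimes>\<^sub>M noise n))"
      by (subst nn_integral_distr) auto
    also have "\<dots> = (\<integral>\<^sup>+u. \<integral>\<^sup>+w. indicator (Pi\<^sub>E {..<n} A) (T (u, w)) \<partial>noise n \<partial>noise n)"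
      by (rule noise.nn_integral_fst[symmetric]) measurable
    also have "\<dots> = (\<integral>\<^sup>+u. \<integral>\<^sup>+w. (\<Prod>j<n. indicator (A j) (B *v (G *v u j + C *v w j))) \<partial>noise n \<partial>noise n)"
      by (simp add: T_def indicator_PiE_prod)
    also have "\<dots> = (\<integral>\<^sup>+u. (\<Prod>j<n. \<integral>\<^sup>+w. indicator (A j) (B *v (G *v u j + C *v w)) \<partial>std_gaussian) \<partial>noise n)"
      by (intro nn_integral_cong nn_integral_noise_prod) measurable
    also have "\<dots> = (\<Prod>j<n. \<integral>\<^sup>+u. \<integral>\<^sup>+w. indicator (A j) (B *v (G *v u + C *v w)) \<partial>std_gaussian \<partial>std_gaussian)"
      by (rule nn_integral_noise_prod) measurable
    also have "\<dots> = (\<Prod>j<n. emeasure std_gaussian (A j))"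
      by (intro prod.cong refl) (simp add: nn_integral_std_gaussian_sum[OF B])
    finally show "emeasure (distr (noise n \<Otimes>\<^sub>M noise n) (block_space n) T) (Pi\<^sub>E {..<n} A)
      = (\<Prod>j<n. emeasure std_gaussian (A j))" .
  qed simp
  then have "(\<integral>\<^sup>+z. F z \<partial>noise n) = (\<integral>\<^sup>+z. F z \<partial>distr (noise n \<Otimes>\<^sub>M noise n) (block_space n) T)"
    by simp
  also have "\<dots> = (\<integral>\<^sup>+x. F (T x) \<partial>(noise n \<Otimes>\<^sub>M noise n))"
    by (subst nn_integral_distr) auto
  also have "\<dots> = (\<integral>\<^sup>+u. \<integral>\<^sup>+w. F (T (u, w)) \<partial>noise n \<partial>noise n)"
    by (rule noise.nn_integral_fst[symmetric]) measurable
  finally show ?thesis by (simp add: T_def)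
qed

section \<open>The converse\<close>

lemma distr_noise_component:
  assumes "j < n"
  shows "distr (noise n) std_gaussian (\<lambda>z. z j) = (std_gaussian :: (real^'n) measure)"
  unfolding noise_def by (rule distr_PiM_component) (use assms prob_space_std_gaussian in auto)

lemma measurable_noise_component:
  assumes "j < n"
  shows "(\<lambda>z. z j) \<in> measurable (noise n) (std_gaussian :: (real^'n) measure)"
  unfolding noise_def by (rule measurable_component_singleton) (use assms in simp)

lemma has_bochner_integral_noise_component:
  fixes f :: "real^'n \<Rightarrow> real"
  assumes "has_bochner_integral std_gaussian f x" "j < n"
  shows "has_bochner_integral (noise n) (\<lambda>z. f (z j)) x"
proof -
  have [measurable]: "(\<lambda>z. z j) \<in> measurable (noise n) (std_gaussian :: (real^'n) measure)"
    using assms(2) by (rule measurable_noise_component)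
  have [measurable]: "f \<in> borel_measurable std_gaussian"
    using assms(1) by (auto simp: has_bochner_integral_iff)
  have "has_bochner_integral (distr (noise n) std_gaussian (\<lambda>z. z j)) f x"
    using assms(1) by (simp only: distr_noise_component[OF assms(2)])
  then show ?thesis
    by (simp add: has_bochner_integral_iff integrable_distr_eq integral_distr)
qed

text \<open>The standard density depends on the norm alone, which sign changes preserve. This
  symmetry makes the means and the mixed second moments vanish without evaluating an
  integral.\<close>

lemma sign_flip_std_gaussian:
  fixes e :: "'n::finite \<Rightarrow> real"
  assumes e: "\<And>i. \<bar>e i\<bar> = 1"
  shows "distr std_gaussian borel (\<lambda>z. \<chi> i. e i * z $ i) = std_gaussian"
proof (rule measure_eqI)
  define D :: "real^'n^'n" where "D = (\<chi> i j. if i = j then e i else 0)"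
  have Dz: "D *v z = (\<chi> i. e i * z $ i)" for z
  proof -
    have "(if i = j then e i else 0) * z $ j = (if i = j then e i * z $ j else 0)" for i j by simp
    then show ?thesis by (simp add: D_def matrix_vector_mult_def vec_eq_iff)
  qed
  have dD: "\<bar>det D\<bar> = 1"
    by (subst det_diagonal) (auto simp: D_def abs_prod e)
  then have inv: "invertible D" by (auto simp: invertible_det_nz)
  have "(norm (D *v z))\<^sup>2 = (norm z)\<^sup>2" for z
  proof -
    have "(e i)\<^sup>2 = 1" for i using power2_abs[of "e i"] by (simp only: e) simp
    then show ?thesis by (simp add: power2_norm_vec Dz power_mult_distrib)
  qed
  then have gD: "gauss (D *v z) = gauss z" for z by (simp add: gauss_def)
  fix A :: "(real^'n) set" assume "A \<in> sets (distr std_gaussian borel (\<lambda>z. \<chi> i. e i * z $ i))"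
  then have [measurable]: "A \<in> sets borel" by simp
  have "emeasure (distr std_gaussian borel (\<lambda>z. \<chi> i. e i * z $ i)) A
      = (\<integral>\<^sup>+z. indicator A z \<partial>distr std_gaussian borel (\<lambda>z. D *v z))"
    by (simp add: Dz)
  also have "\<dots> = (\<integral>\<^sup>+z. indicator A (D *v z) \<partial>std_gaussian)"
    by (subst nn_integral_distr) auto
  also have "\<dots> = emeasure std_gaussian A"
    using std_gaussian_affine[OF inv, of "indicator A" 0] by (simp add: gD dD)
  finally show "emeasure (distr std_gaussian borel (\<lambda>z. \<chi> i. e i * z $ i)) A = emeasure std_gaussian A" .
qed simp

lemma std_gaussian_square_coord:
  "has_bochner_integral std_gaussian (\<lambda>z. (z $ i)\<^sup>2) (1 :: real)"
proof (rule has_bochner_integral_nn_integral)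
  have m: "has_bochner_integral lborel (\<lambda>x. std_normal_density x * x\<^sup>2) 1"
    using std_normal_moment_even[of 1] by simp
  then have m': "(\<integral>\<^sup>+x. ennreal (std_normal_density x * x\<^sup>2) \<partial>lborel) = 1"
    by (subst nn_integral_eq_integral) (auto simp: has_bochner_integral_iff)
  have one: "(\<integral>\<^sup>+x. ennreal (std_normal_density x) \<partial>lborel) = 1"
    using prob_space.emeasure_space_1[OF prob_space_normal_density[of 1 0]]
    by (simp add: emeasure_density)
  define f where "f k x = std_normal_density x * (if k = i then x\<^sup>2 else 1)" for k :: 'a and x
  have "(\<integral>\<^sup>+z. ennreal ((z $ i)\<^sup>2) \<partial>std_gaussian) = (\<integral>\<^sup>+z. ennreal (\<Prod>k\<in>UNIV. f k (z $ k)) \<partial>lborel)"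
    by (subst nn_integral_std_gaussian) (auto simp: f_def prod.distrib gauss_prod ennreal_mult'')
  also have "\<dots> = (\<Prod>k\<in>UNIV. \<integral>\<^sup>+x. ennreal (f k x) \<partial>lborel)"
    by (rule nn_integral_lborel_vec_prod) (auto simp: f_def)
  also have "\<dots> = 1"
  proof (rule prod.neutral, intro ballI)
    fix k show "(\<integral>\<^sup>+x. ennreal (f k x) \<partial>lborel) = 1"
      by (cases "k = i") (simp_all add: f_def m' one)
  qed
  finally show "(\<integral>\<^sup>+z. ennreal ((z $ i)\<^sup>2) \<partial>std_gaussian) = ennreal 1" by simp
qed auto

lemma std_gaussian_cross_coord:
  assumes "i \<noteq> j"
  shows "has_bochner_integral std_gaussian (\<lambda>z. z $ i * z $ j) (0 :: real)"
proof -
  have int: "integrable std_gaussian (\<lambda>z. z $ i * z $ j)"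
  proof (rule Bochner_Integration.integrable_bound)
    show "integrable std_gaussian (\<lambda>z. (z $ i)\<^sup>2 + (z $ j)\<^sup>2)"
      using std_gaussian_square_coord[of i] std_gaussian_square_coord[of j] by (auto simp: has_bochner_integral_iff)
    show "AE z in std_gaussian. norm (z $ i * z $ j) \<le> norm ((z $ i)\<^sup>2 + (z $ j)\<^sup>2)"
    proof (rule AE_I2)
      fix z :: "real^'a"
      have "2 * (\<bar>z $ i\<bar> * \<bar>z $ j\<bar>) \<le> (z $ i)\<^sup>2 + (z $ j)\<^sup>2"
        using sum_squares_bound[of "\<bar>z $ i\<bar>" "\<bar>z $ j\<bar>"] by simp
      moreover have "\<bar>z $ i\<bar> * \<bar>z $ j\<bar> \<le> 2 * (\<bar>z $ i\<bar> * \<bar>z $ j\<bar>)" by simp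
      ultimately have "\<bar>z $ i\<bar> * \<bar>z $ j\<bar> \<le> (z $ i)\<^sup>2 + (z $ j)\<^sup>2" by (rule order_trans[rotated])
      then show "norm (z $ i * z $ j) \<le> norm ((z $ i)\<^sup>2 + (z $ j)\<^sup>2)"
        by (simp add: abs_mult)
    qed
  qed auto
  \<comment> \<open>Only coordinate \<open>i\<close> is flipped, so \<open>z $ i * z $ j\<close>
    changes sign and its integral equals its own negative.\<close>
  define e where "e k = (if k = i then - 1 else 1 :: real)" for k
  have "integral\<^sup>L std_gaussian (\<lambda>z. z $ i * z $ j) = integral\<^sup>L (distr std_gaussian borel (\<lambda>z. \<chi> k. e k * z $ k)) (\<lambda>z. z $ i * z $ j)"
    by (subst sign_flip_std_gaussian) (auto simp: e_def)
  also have "\<dots> = integral\<^sup>L std_gaussian (\<lambda>z. - (z $ i * z $ j))"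
    using assms by (subst integral_distr) (auto simp: e_def)
  finally show ?thesis using int by (simp add: has_bochner_integral_iff)
qed

lemma std_gaussian_coord:
  "has_bochner_integral std_gaussian (\<lambda>z. z $ i) (0 :: real)"
proof -
  have int: "integrable std_gaussian (\<lambda>z. z $ i)"
  proof (rule Bochner_Integration.integrable_bound)
    show "integrable std_gaussian (\<lambda>z. 1 + (z $ i)\<^sup>2)"
      using std_gaussian_square_coord[of i] by (auto simp: has_bochner_integral_iff)
    show "AE z in std_gaussian. norm (z $ i) \<le> norm (1 + (z $ i)\<^sup>2)"
    proof (rule AE_I2)
      fix z :: "real^'a"
      have "2 * \<bar>z $ i\<bar> \<le> 1 + (z $ i)\<^sup>2"
        using sum_squares_bound[of 1 "\<bar>z $ i\<bar>"] by simp
      then show "norm (z $ i) \<le> norm (1 + (z $ i)\<^sup>2)" by simp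
    qed
  qed auto
  have "integral\<^sup>L std_gaussian (\<lambda>z. z $ i) = integral\<^sup>L (distr std_gaussian borel (\<lambda>z. \<chi> k. - 1 * z $ k)) (\<lambda>z. z $ i)"
    by (subst sign_flip_std_gaussian) auto
  also have "\<dots> = integral\<^sup>L std_gaussian (\<lambda>z. - (z $ i))"
    by (subst integral_distr) auto
  finally show ?thesis using int by (simp add: has_bochner_integral_iff)
qed

lemma std_gaussian_inner_square:
  "has_bochner_integral std_gaussian (\<lambda>z. (c + a \<bullet> z)\<^sup>2) (c\<^sup>2 + (norm (a :: real^'n))\<^sup>2)"
proof -
  have "has_bochner_integral std_gaussian (\<lambda>z. \<Sum>i\<in>UNIV. \<Sum>j\<in>UNIV. (a $ i * a $ j) * (z $ i * z $ j))
      (\<Sum>i\<in>UNIV. \<Sum>j\<in>UNIV. (a $ i * a $ j) * (if i = j then 1 else 0))"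
    by (intro has_bochner_integral_sum has_bochner_integral_mult_right)
      (use std_gaussian_square_coord std_gaussian_cross_coord in \<open>auto simp: power2_eq_square\<close>)
  moreover have "has_bochner_integral std_gaussian (\<lambda>z. \<Sum>i\<in>UNIV. (2 * c * a $ i) * z $ i) (\<Sum>i\<in>UNIV. (2 * c * a $ i) * 0)"
    by (intro has_bochner_integral_sum has_bochner_integral_mult_right std_gaussian_coord)
  moreover have "has_bochner_integral (std_gaussian :: (real^'n) measure) (\<lambda>z. c\<^sup>2) (c\<^sup>2)"
    by (auto simp: has_bochner_integral_iff std_gaussian.prob_space[simplified])
  ultimately have "has_bochner_integral std_gaussian (\<lambda>z. c\<^sup>2 + ((\<Sum>i\<in>UNIV. (2 * c * a $ i) * z $ i) + (\<Sum>i\<in>UNIV. \<Sum>j\<in>UNIV. (a $ i * a $ j) * (z $ i * z $ j))))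
      (c\<^sup>2 + ((\<Sum>i\<in>UNIV. (2 * c * a $ i) * 0) + (\<Sum>i\<in>UNIV. \<Sum>j\<in>UNIV. (a $ i * a $ j) * (if i = j then 1 else 0))))"
    by (intro has_bochner_integral_add)
  moreover have "c\<^sup>2 + ((\<Sum>i\<in>UNIV. (2 * c * a $ i) * z $ i) + (\<Sum>i\<in>UNIV. \<Sum>j\<in>UNIV. (a $ i * a $ j) * (z $ i * z $ j))) = (c + a \<bullet> z)\<^sup>2" for z
  proof -
    have "(\<Sum>i\<in>UNIV. (2 * c * a $ i) * z $ i) = 2 * c * (a \<bullet> z)"
      by (simp add: inner_vec_def sum_distrib_left mult_ac)
    moreover have "(\<Sum>i\<in>UNIV. \<Sum>j\<in>UNIV. (a $ i * a $ j) * (z $ i * z $ j)) = (a \<bullet> z) * (a \<bullet> z)"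
      by (simp add: inner_vec_def sum_product mult_ac)
    ultimately show ?thesis by (simp add: power2_eq_square algebra_simps)
  qed
  moreover have "(\<Sum>i\<in>UNIV. \<Sum>j\<in>UNIV. (a $ i * a $ j) * (if i = j then 1 else 0)) = (norm a)\<^sup>2"
    unfolding power2_norm_vec by (simp add: power2_eq_square if_distrib cong: if_cong)
  ultimately show ?thesis by simp
qed

lemma trace_mult_transpose: "trace (A ** transpose A) = (\<Sum>i\<in>UNIV. (norm (A $ i))\<^sup>2)" for A :: "real^'n^'n"
  unfolding power2_norm_vec by (simp add: trace_def matrix_matrix_mult_def transpose_def power2_eq_square)

text \<open>The cross term has mean zero, and each row of \<open>B\<close> contributes its squared
  norm. This is the expectation of the quadratic part of a log-likelihood.\<close>

lemma std_gaussian_norm_square: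
  fixes B :: "real^'n^'n"
  shows "has_bochner_integral std_gaussian (\<lambda>z. (norm (B *v (v + z)))\<^sup>2) ((norm (B *v v))\<^sup>2 + trace (B ** transpose B))"
proof -
  have eq: "(norm (B *v x))\<^sup>2 = (\<Sum>i\<in>UNIV. (B $ i \<bullet> x)\<^sup>2)" for x
    by (simp add: power2_norm_vec matrix_vector_mult_def inner_vec_def)
  have "has_bochner_integral std_gaussian (\<lambda>z. \<Sum>i\<in>UNIV. (B $ i \<bullet> v + B $ i \<bullet> z)\<^sup>2) (\<Sum>i\<in>UNIV. (B $ i \<bullet> v)\<^sup>2 + (norm (B $ i))\<^sup>2)"
    by (intro has_bochner_integral_sum std_gaussian_inner_square)
  then show ?thesis
    by (simp add: eq inner_add_right sum.distrib trace_mult_transpose)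
qed

lemma trace_mat1: "trace (mat 1 :: real^'n^'n) = CARD('n)"
  by (simp add: trace_def mat_def)

lemma std_gaussian_norm_square0:
  "has_bochner_integral std_gaussian (\<lambda>z :: real^'n. (norm z)\<^sup>2) (real CARD('n))"
  using std_gaussian_norm_square[of "mat 1" "0 :: real^'n"] by (simp add: trace_mat1 transpose_mat)

section \<open>Average covariance of a family of codewords\<close>

definition outer :: "real^'n \<Rightarrow> real^'n^'n" where
  "outer v = (\<chi> a b. v $ a * v $ b)"

lemma outer_mult_vec: "outer v *v x = (v \<bullet> x) *\<^sub>R v"
  by (simp add: outer_def vec_eq_iff matrix_vector_mult_def inner_vec_def sum_distrib_left mult_ac)

lemma psd_outer: "psd (outer v)"
  by (simp add: psd_def outer_mult_vec inner_commute) (simp add: outer_def transpose_def vec_eq_iff mult.commute)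

lemma outer_matrix: "outer (H *v v) = H ** outer v ** transpose H"
proof -
  have "(H ** outer v ** transpose H) *v x = outer (H *v v) *v x" for x
    by (simp add: outer_mult_vec matrix_vector_mul_assoc[symmetric] matrix_vector_mult_scaleR inner_transpose)
  then show ?thesis by (simp add: matrix_eq)
qed

lemma trace_outer: "trace (outer v) = (norm v)\<^sup>2"
  unfolding power2_norm_vec by (simp add: trace_def outer_def power2_eq_square)

lemma trace_conj_outer: "trace (B ** outer v ** transpose B) = (norm (B *v v))\<^sup>2"
  by (simp flip: outer_matrix add: trace_outer)

lemma trace_add: "trace (A + B) = trace A + trace (B :: real^'n^'n)"
  by (simp add: trace_def sum.distrib)

lemma trace_sum: "trace (\<Sum>m\<in>M. A m) = (\<Sum>m\<in>M. trace (A m :: real^'n^'n))"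
  unfolding trace_def sum_component by (rule sum.swap)

lemma trace_scaleR: "trace (c *\<^sub>R A) = c * trace (A :: real^'n^'n)"
  by (simp add: trace_def sum_distrib_left)

lemma matrix_conj_sum:
  fixes A :: "'m \<Rightarrow> real^'n^'n"
  shows "B ** (\<Sum>m\<in>M. A m) ** C = (\<Sum>m\<in>M. B ** A m ** C)"
  by (induction M rule: infinite_finite_induct) (auto simp: matrix_add_ldistrib matrix_add_mult_distrib_right)

lemma matrix_conj_scaleR:
  fixes A :: "real^'n^'n"
  shows "B ** (c *\<^sub>R A) ** C = c *\<^sub>R (B ** A ** C)"
  by (simp add: matrix_matrix_mult_def vec_eq_iff sum_distrib_left sum_distrib_right mult_ac)

text \<open>Centring is left to the caller, and the index set is arbitrary, so that one definition
  covers both a single codebook and pairs of messages.\<close>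

definition avg_cov :: "'m set \<Rightarrow> nat \<Rightarrow> ('m \<Rightarrow> nat \<Rightarrow> real^'n) \<Rightarrow> real^'n^'n" where
  "avg_cov M n v = (1 / (real n * real (card M))) *\<^sub>R (\<Sum>j<n. \<Sum>m\<in>M. outer (v m j))"

lemma psd_sum: "(\<And>m. m \<in> M \<Longrightarrow> psd (A m)) \<Longrightarrow> psd (\<Sum>m\<in>M. A m)"
proof (induction M rule: infinite_finite_induct)
  case (insert x F)
  then show ?case by (simp add: psd_add)
qed (simp_all add: psd_def transpose_def vec_eq_iff)

lemma psd_avg_cov: "psd (avg_cov M n v)"
  unfolding avg_cov_def by (intro psd_scaleR psd_sum psd_outer) simp

lemma trace_conj_avg_cov:
  "trace (B ** avg_cov M n v ** transpose B) = (\<Sum>j<n. \<Sum>m\<in>M. (norm (B *v v m j))\<^sup>2) / (real n * real (card M))"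
  by (simp add: avg_cov_def matrix_conj_scaleR matrix_conj_sum trace_scaleR trace_sum trace_conj_outer)

lemma trace_avg_cov:
  "trace (avg_cov M n v) = (\<Sum>j<n. \<Sum>m\<in>M. (norm (v m j))\<^sup>2) / (real n * real (card M))"
  by (simp add: avg_cov_def trace_scaleR trace_sum trace_outer)

lemma avg_cov_matrix: "avg_cov M n (\<lambda>m j. H *v v m j) = H ** avg_cov M n v ** transpose H"
  by (simp add: avg_cov_def matrix_conj_scaleR matrix_conj_sum outer_matrix)

lemma gauss_ln_ratio:
  assumes "det (B :: real^'n^'n) \<noteq> 0"
  shows "ln (\<bar>det B\<bar> * gauss (x :: real^'n) / gauss (z :: real^'n)) = ln \<bar>det B\<bar> - (norm x)\<^sup>2 / 2 + (norm z)\<^sup>2 / 2"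
  using assms by (simp add: gauss_def ln_mult ln_div)

text \<open>Fano's inequality with soft decisions \<open>\<kappa>\<close>, obtained from \<open>ln x \<le> x - 1\<close> applied to the likelihood ratio
  \<open>L\<close> of the Gaussian output law with covariance \<open>I + S\<close> against the law of the output given the message.\<close>

lemma gaussian_converse:
  fixes s :: "'m \<Rightarrow> nat \<Rightarrow> real^'n" and \<mu> :: "nat \<Rightarrow> real^'n" and \<kappa> :: "'m \<Rightarrow> (nat \<Rightarrow> real^'n) \<Rightarrow> real"
  assumes M: "finite M" "M \<noteq> {}" and n: "0 < n"
    and meas [measurable]: "\<And>m. m \<in> M \<Longrightarrow> \<kappa> m \<in> borel_measurable (block_space n)"
    and pos: "\<And>m y. m \<in> M \<Longrightarrow> 0 \<le> \<kappa> m y"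
    and le1: "\<And>y. (\<Sum>m\<in>M. \<kappa> m y) \<le> 1"
  defines "S \<equiv> avg_cov M n (\<lambda>m j. s m j - \<mu> j)"
  shows "(\<Sum>m\<in>M. integral\<^sup>L (noise n) (\<lambda>z. \<kappa> m (\<lambda>j\<in>{..<n}. s m j + z j))) * ln (card M)
      \<le> card M * (n * (1 / 2 * ln (det (mat 1 + S))) + ln 2)"
proof -
  have "psd S" unfolding S_def by (rule psd_avg_cov)
  then obtain B :: "real^'n^'n" where B: "invertible B" "B ** (mat 1 + S) ** transpose B = mat 1"
    "- ln \<bar>det B\<bar> = 1 / 2 * ln (det (mat 1 + S))"
    by (rule psd_whitening)
  have dB: "det B \<noteq> 0" using B(1) by (simp add: invertible_det_nz)
  obtain C where C: "B ** C = mat 1" "C ** B = mat 1" using B(1) by (auto simp: invertible_def)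
  define N where "N = real (card M)"
  have N: "1 \<le> N" using M by (simp add: N_def Suc_le_eq card_gt_0_iff)
  define v where "v m j = s m j - \<mu> j" for m j
  \<comment> \<open>At the output \<open>y = s m j + z\<close> one has
    \<open>B *v z + B *v v m j = B *v (y - \<mu> j)\<close>. So \<open>\<rho>\<close> divides the
    density at \<open>y\<close> of the Gaussian with mean \<open>\<mu> j\<close> and covariance
    \<open>I + S\<close> by the density of \<open>y\<close> given \<open>m\<close>.\<close>
  define \<rho> where "\<rho> m j z = \<bar>det B\<bar> * gauss (B *v z + B *v v m j) / gauss z" for m j z
  have \<rho>pos: "0 < \<rho> m j z" for m j z using dB by (simp add: \<rho>_def gauss_pos)
  define L where "L m z = (\<Prod>j<n. \<rho> m j (z j))" for m z
  have Lpos: "0 < L m z" for m z by (simp add: L_def prod_pos \<rho>pos)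
  define K where "K m z = \<kappa> m (\<lambda>j\<in>{..<n}. s m j + z j)" for m z
  have K1: "K m z \<le> 1" if "m \<in> M" for m z
  proof -
    have "\<kappa> m y \<le> (\<Sum>m\<in>M. \<kappa> m y)" for y
      using that M pos by (intro member_le_sum) auto
    then show ?thesis using le1 order_trans unfolding K_def by blast
  qed
  have K0: "0 \<le> K m z" if "m \<in> M" for m z using pos[OF that] by (simp add: K_def)
  have [measurable]: "(\<lambda>z. \<rho> m j z) \<in> borel_measurable borel" for m j unfolding \<rho>_def by measurable
  have KL0: "0 \<le> K m z * L m z" if "m \<in> M" for m z
    using K0[OF that, of z] Lpos[of m z] by simp
  have Lm [measurable]: "L m \<in> borel_measurable (noise n)" for m unfolding L_def[abs_def] by measurable
  have Km [measurable]: "K m \<in> borel_measurable (noise n)" if "m \<in> M" for m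
    unfolding K_def[abs_def] by (rule measurable_compose[OF _ meas[OF that]]) measurable
  \<comment> \<open>Reweighting with \<open>L m\<close> replaces the output law given
    \<open>m\<close> by the reference law, which is the same for all messages. Only after this can
    the decision weights of different messages be summed under one integral.\<close>
  have change: "(\<integral>\<^sup>+z. ennreal (L m z) * F (\<lambda>j\<in>{..<n}. B *v z j + B *v v m j) \<partial>noise n) = (\<integral>\<^sup>+z. F z \<partial>noise n)"
    if "F \<in> borel_measurable (block_space n)" for F m
    using nn_integral_noise_affine[OF B(1) that, of "\<lambda>j. B *v v m j"]
    by (simp add: L_def \<rho>_def prod_ennreal)
  have nnL: "(\<integral>\<^sup>+z. ennreal (L m z) \<partial>noise n) = ennreal 1" for m
    using change[of "\<lambda>_. 1" m] by (simp add: noise.emeasure_space_1)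
  have bL: "has_bochner_integral (noise n) (L m) 1" for m
    using Lpos by (intro has_bochner_integral_nn_integral nnL) (auto intro: less_imp_le)
  have intL: "integrable (noise n) (L m)" and EL: "integral\<^sup>L (noise n) (L m) = 1" for m
    using bL by (auto simp: has_bochner_integral_iff)
  have intK: "integrable (noise n) (K m)" if "m \<in> M" for m
    by (rule noise.integrable_const_bound[where B = 1]) (use K0 K1 that in auto)
  have intKL: "integrable (noise n) (\<lambda>z. K m z * L m z)" if "m \<in> M" for m
    by (rule Bochner_Integration.integrable_bound[OF intL[of m]])
      (use K0 K1 Lpos that in \<open>auto simp: abs_mult intro!: AE_I2 mult_left_le_one_le\<close>)
  \<comment> \<open>\<open>C\<close> is the inverse of \<open>B\<close>, so
    \<open>\<mu> j + C *v z j\<close> has the reference law when \<open>z\<close> is white: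
    \<open>\<kappa>'\<close> is the decision expressed in whitened coordinates.\<close>
  define \<kappa>' where "\<kappa>' m z = \<kappa> m (\<lambda>j\<in>{..<n}. \<mu> j + C *v z j)" for m z
  have \<kappa>'m [measurable]: "\<kappa>' m \<in> borel_measurable (block_space n)" if "m \<in> M" for m
    unfolding \<kappa>'_def[abs_def] by (rule measurable_compose[OF _ meas[OF that]]) measurable
  have KL: "ennreal (integral\<^sup>L (noise n) (\<lambda>z. K m z * L m z)) = (\<integral>\<^sup>+z. ennreal (\<kappa>' m z) \<partial>noise n)" if "m \<in> M" for m
  proof -
    have "ennreal (integral\<^sup>L (noise n) (\<lambda>z. K m z * L m z)) = (\<integral>\<^sup>+z. ennreal (K m z * L m z) \<partial>noise n)"
      using that KL0 by (intro nn_integral_eq_integral[symmetric] intKL AE_I2)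
    also have "\<dots> = (\<integral>\<^sup>+z. ennreal (L m z) * ennreal (\<kappa>' m (\<lambda>j\<in>{..<n}. B *v z j + B *v v m j)) \<partial>noise n)"
    proof (rule nn_integral_cong)
      fix z :: "nat \<Rightarrow> real^'n"
      have *: "\<mu> j + C *v (B *v z j + B *v v m j) = s m j + z j" for j
        by (simp add: matrix_vector_right_distrib matrix_vector_mul_assoc C v_def)
      have "\<kappa>' m (\<lambda>j\<in>{..<n}. B *v z j + B *v v m j) = K m z"
        unfolding \<kappa>'_def K_def by (rule arg_cong[of _ _ "\<kappa> m"]) (auto simp: fun_eq_iff *)
      then show "ennreal (K m z * L m z) = ennreal (L m z) * ennreal (\<kappa>' m (\<lambda>j\<in>{..<n}. B *v z j + B *v v m j))"
        using K0[OF that] Lpos[of m z] by (simp add: ennreal_mult' mult.commute)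
    qed
    also have "\<dots> = (\<integral>\<^sup>+z. ennreal (\<kappa>' m z) \<partial>noise n)"
      using that by (intro change) measurable
    finally show ?thesis .
  qed
  have sumKL: "(\<Sum>m\<in>M. integral\<^sup>L (noise n) (\<lambda>z. K m z * L m z)) \<le> 1"
  proof -
    have "ennreal (\<Sum>m\<in>M. integral\<^sup>L (noise n) (\<lambda>z. K m z * L m z)) = (\<Sum>m\<in>M. ennreal (integral\<^sup>L (noise n) (\<lambda>z. K m z * L m z)))"
      using KL0 by (intro sum_ennreal[symmetric] integral_nonneg_AE AE_I2)
    also have "\<dots> = (\<integral>\<^sup>+z. (\<Sum>m\<in>M. ennreal (\<kappa>' m z)) \<partial>noise n)"
      by (subst nn_integral_sum) (auto simp: KL)
    also have "\<dots> \<le> (\<integral>\<^sup>+(z :: nat \<Rightarrow> real^'n). 1 \<partial>noise n)"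
    proof (rule nn_integral_mono)
      fix z
      have "(\<Sum>m\<in>M. ennreal (\<kappa>' m z)) = ennreal (\<Sum>m\<in>M. \<kappa>' m z)"
        using pos by (intro sum_ennreal) (simp add: \<kappa>'_def)
      also have "\<dots> \<le> ennreal 1" unfolding \<kappa>'_def using le1 by (rule ennreal_leI)
      finally show "(\<Sum>m\<in>M. ennreal (\<kappa>' m z)) \<le> 1" by simp
    qed
    finally show ?thesis by (simp add: noise.emeasure_space_1)
  qed
  define \<tau> where "\<tau> = trace (B ** transpose B)"
  define d where "d = real CARD('n)"
  have bl: "has_bochner_integral (noise n) (\<lambda>z. ln (L m z))
      (\<Sum>j<n. ln \<bar>det B\<bar> - ((norm (B *v v m j))\<^sup>2 + \<tau>) / 2 + d / 2)" for m
  proof -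
    have "ln (L m z) = (\<Sum>j<n. ln \<bar>det B\<bar> - (norm (B *v (v m j + z j)))\<^sup>2 / 2 + (norm (z j))\<^sup>2 / 2)" for z
    proof -
      have "ln (L m z) = (\<Sum>j<n. ln (\<rho> m j (z j)))"
        unfolding L_def by (rule ln_prod) (auto simp: \<rho>pos less_imp_neq[symmetric])
      then show ?thesis
        by (simp add: \<rho>_def gauss_ln_ratio[OF dB] matrix_vector_right_distrib add.commute)
    qed
    moreover have "has_bochner_integral (noise n) (\<lambda>z. \<Sum>j<n. ln \<bar>det B\<bar> - (norm (B *v (v m j + z j)))\<^sup>2 / 2 + (norm (z j))\<^sup>2 / 2)
      (\<Sum>j<n. ln \<bar>det B\<bar> - ((norm (B *v v m j))\<^sup>2 + \<tau>) / 2 + d / 2)"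
    proof (intro has_bochner_integral_sum has_bochner_integral_add has_bochner_integral_diff)
      fix j assume "j \<in> {..<n}"
      then have j: "j < n" by simp
      show "has_bochner_integral (noise n :: (nat \<Rightarrow> real^'n) measure) (\<lambda>z. ln \<bar>det B\<bar>) (ln \<bar>det B\<bar>)"
        by (simp add: has_bochner_integral_iff noise.prob_space)
      show "has_bochner_integral (noise n) (\<lambda>z. (norm (B *v (v m j + z j)))\<^sup>2 / 2) (((norm (B *v v m j))\<^sup>2 + \<tau>) / 2)"
        unfolding \<tau>_def
        by (rule has_bochner_integral_noise_component[OF has_bochner_integral_divide_zero[OF std_gaussian_norm_square] j])
      show "has_bochner_integral (noise n) (\<lambda>z. (norm (z j :: real^'n))\<^sup>2 / 2) (d / 2)"
        unfolding d_def
        by (rule has_bochner_integral_noise_component[OF has_bochner_integral_divide_zero[OF std_gaussian_norm_square0] j])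
    qed
    ultimately show ?thesis by simp
  qed
  then have intl: "integrable (noise n) (\<lambda>z. ln (L m z))" for m by (auto simp: has_bochner_integral_iff)
  \<comment> \<open>This is where the choice of \<open>S\<close> pays off. Whitening gives
    \<open>\<tau> + trace (B ** S ** transpose B) = d\<close>, so on average the squared norms of
    the whitened output cancel those of the noise, and only the Jacobian
    \<open>ln \<bar>det B\<bar>\<close> is left per channel use.\<close>
  have suml: "(\<Sum>m\<in>M. integral\<^sup>L (noise n) (\<lambda>z. ln (L m z))) = N * n * ln \<bar>det B\<bar>"
  proof -
    have "trace (B ** (mat 1 + S) ** transpose B) = d"
      by (simp add: B(2) trace_mat1 d_def)
    then have tr: "\<tau> + trace (B ** S ** transpose B) = d"
      by (simp add: matrix_add_ldistrib matrix_add_mult_distrib_right trace_add \<tau>_def)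
    have tr2: "(\<Sum>m\<in>M. \<Sum>j<n. (norm (B *v v m j))\<^sup>2) = n * N * trace (B ** S ** transpose B)"
      unfolding S_def trace_conj_avg_cov using n N by (subst sum.swap) (simp add: N_def v_def)
    have "(\<Sum>m\<in>M. integral\<^sup>L (noise n) (\<lambda>z. ln (L m z)))
      = (\<Sum>m\<in>M. \<Sum>j<n. ln \<bar>det B\<bar> - ((norm (B *v v m j))\<^sup>2 + \<tau>) / 2 + d / 2)"
      using bl by (simp add: has_bochner_integral_iff)
    also have "\<dots> = (\<Sum>m\<in>M. \<Sum>j<n. (ln \<bar>det B\<bar> - \<tau> / 2 + d / 2) - (norm (B *v v m j))\<^sup>2 / 2)"
      by (simp add: add_divide_distrib algebra_simps)
    also have "\<dots> = N * n * (ln \<bar>det B\<bar> - \<tau> / 2 + d / 2) - (\<Sum>m\<in>M. \<Sum>j<n. (norm (B *v v m j))\<^sup>2) / 2"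
      unfolding sum_subtractf sum_divide_distrib[symmetric] by (simp add: N_def)
    also have "\<dots> = N * n * ln \<bar>det B\<bar>"
      unfolding tr2 tr[symmetric] by (simp add: algebra_simps)
    finally show ?thesis .
  qed
  \<comment> \<open>The logarithm lies below its tangent at 2. The tangent is used at
    \<open>N * L\<close> with weight \<open>K\<close> and at \<open>L\<close> with weight
    \<open>1 - K\<close>. Averaged over messages, the two linear parts contribute at most 1/2 each
    and cancel the constant -1, which is why exactly \<open>ln 2\<close> remains, the bound on the
    binary entropy in Fano's inequality.\<close>
  have pw: "K m z * ln N + ln (L m z) \<le> N / 2 * (K m z * L m z) + L m z / 2 - 1 + ln 2" if m: "m \<in> M" for m z
  proof -
    have ln2: "ln x \<le> x / 2 - 1 + ln 2" if "0 < x" for x :: real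
      using ln_add_one_self_le_self2[of "x / 2 - 1"] that by (simp add: ln_div)
    have "ln (N * L m z) \<le> N * L m z / 2 - 1 + ln 2"
      using N Lpos[of m z] by (intro ln2) simp
    then have 1: "K m z * (ln N + ln (L m z)) \<le> K m z * (N * L m z / 2 - 1 + ln 2)"
      using N Lpos[of m z] K0[OF m] by (intro mult_left_mono) (auto simp: ln_mult)
    have 2: "(1 - K m z) * ln (L m z) \<le> (1 - K m z) * (L m z / 2 - 1 + ln 2)"
      using K1[OF m] Lpos[of m z] by (intro mult_left_mono ln2) auto
    have 3: "0 \<le> K m z * L m z" by (rule KL0[OF m])
    show ?thesis using 1 2 3 by (simp add: algebra_simps diff_divide_distrib)
  qed
  have each: "integral\<^sup>L (noise n) (K m) * ln N + integral\<^sup>L (noise n) (\<lambda>z. ln (L m z))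
      \<le> N / 2 * integral\<^sup>L (noise n) (\<lambda>z. K m z * L m z) + 1 / 2 - 1 + ln 2" if m: "m \<in> M" for m
  proof -
    have "integral\<^sup>L (noise n) (\<lambda>z. K m z * ln N + ln (L m z))
        \<le> integral\<^sup>L (noise n) (\<lambda>z. N / 2 * (K m z * L m z) + L m z / 2 - 1 + ln 2)"
      using m pw by (intro integral_mono Bochner_Integration.integrable_add Bochner_Integration.integrable_diff
          integrable_mult_left integrable_mult_right integrable_divide_zero intK intl intKL intL) auto
    then show ?thesis
      using intK[OF m] intl[of m] intKL[OF m] intL[of m] EL[of m]
      by (simp add: noise.prob_space)
  qed
  have "(\<Sum>m\<in>M. integral\<^sup>L (noise n) (K m)) * ln N + (\<Sum>m\<in>M. integral\<^sup>L (noise n) (\<lambda>z. ln (L m z)))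
      \<le> N / 2 * (\<Sum>m\<in>M. integral\<^sup>L (noise n) (\<lambda>z. K m z * L m z)) + N * (1 / 2 - 1 + ln 2)"
  proof -
    have "(\<Sum>m\<in>M. integral\<^sup>L (noise n) (K m) * ln N + integral\<^sup>L (noise n) (\<lambda>z. ln (L m z)))
      \<le> (\<Sum>m\<in>M. N / 2 * integral\<^sup>L (noise n) (\<lambda>z. K m z * L m z) + (1 / 2 - 1 + ln 2))"
    proof (rule sum_mono)
      fix m assume "m \<in> M"
      from each[OF this] show "integral\<^sup>L (noise n) (K m) * ln N + integral\<^sup>L (noise n) (\<lambda>z. ln (L m z))
        \<le> N / 2 * integral\<^sup>L (noise n) (\<lambda>z. K m z * L m z) + (1 / 2 - 1 + ln 2)" by linarith
    qed
    then show ?thesis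
      by (simp only: sum.distrib sum_distrib_left sum_distrib_right sum_constant N_def distrib_left)
  qed
  also have "\<dots> \<le> N / 2 * 1 + N * (1 / 2 - 1 + ln 2)"
    using sumKL N by (intro add_right_mono mult_left_mono) auto
  finally have "(\<Sum>m\<in>M. integral\<^sup>L (noise n) (K m)) * ln N \<le> N * (n * (- ln \<bar>det B\<bar>) + ln 2)"
    unfolding suml by (simp add: algebra_simps)
  then show ?thesis unfolding B(3) by (simp add: N_def K_def[abs_def])
qed

text \<open>The information rate, in nats per channel use, of a Gaussian signal with covariance
  \<open>A\<close> in white noise of unit covariance.\<close>

definition half_logdet :: "real^'n^'n \<Rightarrow> real" where
  "half_logdet A = 1 / 2 * ln (det (mat 1 + A))"

section \<open>Error probabilities of a code as averages over messages\<close>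

lemma num_messages_ge: "exp (real n * R) \<le> real (num_messages n R)"
  by (simp add: num_messages_def of_nat_nat)

lemma num_messages_pos: "0 < num_messages n R"
  using num_messages_ge[of n R] exp_gt_zero[of "real n * R"] by (metis less_le_trans of_nat_0_less_iff)

lemma ln_num_messages: "real n * R \<le> ln (num_messages n R)"
  using num_messages_ge[of n R] num_messages_pos[of n R] by (simp add: ln_ge_iff)

lemma expectation_message:
  "measure_pmf.expectation (message n R) h = (\<Sum>m<num_messages n R. h m :: real) / num_messages n R"
  using num_messages_pos[of n R] unfolding message_def
  by (subst integral_pmf_of_set) (auto simp: lessThan_empty_iff)

lemma received_measurable [measurable]:
  "(\<lambda>z. received n A B x1 x2 z) \<in> measurable (noise n) (block_space n)"
  unfolding received_def by measurable

text \<open>The message pairs form a countable space, so measurability in the noise for each pair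
  already gives joint measurability; Fubini's theorem then yields the uniform average.\<close>

lemma measure_receiver_space:
  fixes P :: "nat \<Rightarrow> nat \<Rightarrow> (nat \<Rightarrow> real^'n) \<Rightarrow> bool"
  assumes [measurable]: "\<And>m1 m2. Measurable.pred (noise n) (P m1 m2)"
  shows "measure (receiver_space n R1 R2) {(m1, m2, z) \<in> space (receiver_space n R1 R2). P m1 m2 z}
    = (\<Sum>m1<num_messages n R1. \<Sum>m2<num_messages n R2. measure (noise n) {z \<in> space (noise n). P m1 m2 z})
        / (num_messages n R1 * num_messages n R2)"
proof -
  define N1 N2 where "N1 = num_messages n R1" and "N2 = num_messages n R2"
  have N: "0 < N1" "0 < N2" by (simp_all add: N1_def N2_def num_messages_pos)
  interpret pmf2: prob_space "measure_pmf (message n R2) \<Otimes>\<^sub>M (noise n :: (nat \<Rightarrow> real^'n) measure)"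
    by (intro prob_space_pair prob_space_noise measure_pmf.prob_space_axioms)
  interpret rs: prob_space "receiver_space n R1 R2 :: (nat \<times> nat \<times> (nat \<Rightarrow> real^'n)) measure"
    unfolding receiver_space_def by (intro prob_space_pair prob_space_noise measure_pmf.prob_space_axioms)
  let ?E = "{(m1, m2, z) \<in> space (receiver_space n R1 R2). P m1 m2 z}"
  have [measurable_cong]: "sets (receiver_space n R1 R2) = sets (count_space UNIV \<Otimes>\<^sub>M (count_space UNIV \<Otimes>\<^sub>M noise n))"
    unfolding receiver_space_def by (intro sets_pair_measure_cong) auto
  have "(\<lambda>x. P (fst x) (fst (snd x)) (snd (snd x))) \<in> measurable (count_space UNIV \<Otimes>\<^sub>M (count_space UNIV \<Otimes>\<^sub>M noise n)) (count_space UNIV)"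
    by (intro measurable_pair_measure_countable1 countableI_type) auto
  then have [measurable]: "Measurable.pred (receiver_space n R1 R2) (\<lambda>x. P (fst x) (fst (snd x)) (snd (snd x)))"
    by measurable
  have "?E = {x \<in> space (receiver_space n R1 R2). P (fst x) (fst (snd x)) (snd (snd x))}" by auto
  then have E: "?E \<in> sets (receiver_space n R1 R2)" by simp
  have E': "?E \<in> sets (measure_pmf (message n R1) \<Otimes>\<^sub>M (measure_pmf (message n R2) \<Otimes>\<^sub>M noise n))"
    using E unfolding receiver_space_def .
  have p: "emeasure (noise n) (Pair m2 -` Pair m1 -` ?E) = ennreal (measure (noise n) {z \<in> space (noise n). P m1 m2 z})" for m1 m2
    by (subst noise.emeasure_eq_measure[symmetric], rule arg_cong[of _ _ "emeasure (noise n)"])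
      (auto simp: receiver_space_def space_pair_measure)
  have "emeasure (receiver_space n R1 R2) ?E
     = (\<integral>\<^sup>+m1. \<integral>\<^sup>+m2. emeasure (noise n) (Pair m2 -` Pair m1 -` ?E) \<partial>message n R2 \<partial>message n R1)"
    unfolding receiver_space_def
    by (subst pmf2.emeasure_pair_measure_alt[OF E'[unfolded receiver_space_def]], intro nn_integral_cong,
        subst noise.emeasure_pair_measure_alt[OF sets_Pair1[OF E'[unfolded receiver_space_def]]], rule refl)
  also have "\<dots> = (\<Sum>m1<N1. (\<Sum>m2<N2. ennreal (measure (noise n) {z \<in> space (noise n). P m1 m2 z})) / N2) / N1"
    using N unfolding p message_def N1_def[symmetric] N2_def[symmetric]
    by (subst nn_integral_pmf_of_set) (auto simp: lessThan_empty_iff nn_integral_pmf_of_set)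
  also have "\<dots> = ennreal ((\<Sum>m1<N1. (\<Sum>m2<N2. measure (noise n) {z \<in> space (noise n). P m1 m2 z}) / N2) / N1)"
    using N by (simp add: sum_nonneg divide_ennreal sum_ennreal divide_nonneg_nonneg flip: ennreal_of_nat_eq_real_of_nat)
      (simp add: sum_nonneg divide_ennreal sum_ennreal ennreal_of_nat_eq_real_of_nat)
  finally have "measure (receiver_space n R1 R2) ?E = (\<Sum>m1<N1. (\<Sum>m2<N2. measure (noise n) {z \<in> space (noise n). P m1 m2 z}) / N2) / N1"
    by (simp add: measure_def sum_nonneg)
  then show ?thesis by (simp add: N1_def N2_def sum_divide_distrib mult.commute)
qed

lemma valid_decoder_pred:
  assumes "valid_decoder n R g" "T \<in> measurable M (block_space n)"
  shows "Measurable.pred M (\<lambda>z. g (T z) = m)" "Measurable.pred M (\<lambda>z. g (T z) \<noteq> m)"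
proof -
  have g: "g \<in> measurable (block_space n) (count_space {..<num_messages n R})"
    using assms(1) by (simp add: valid_decoder_def)
  have [measurable]: "(\<lambda>z. g (T z)) \<in> measurable M (count_space UNIV)"
    by (rule measurable_compose[OF measurable_compose[OF assms(2) g] measurable_count_space]) 
  show "Measurable.pred M (\<lambda>z. g (T z) = m)" "Measurable.pred M (\<lambda>z. g (T z) \<noteq> m)"
    by measurable
qed

text \<open>Only the noiseless received block \<open>s\<close> matters. The success probability is
  written as the integral of an indicator because \<open>gaussian_converse\<close> takes decisions
  as real-valued weights.\<close>

definition correct_prob :: "'r::finite decoder \<Rightarrow> nat \<Rightarrow> nat \<Rightarrow> (nat \<Rightarrow> real^'r) \<Rightarrow> real" where
  "correct_prob g n m s = integral\<^sup>L (noise n) (\<lambda>z. indicator {y. g y = m} (\<lambda>j\<in>{..<n}. s j + z j))"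

lemma correct_prob_measure:
  assumes g: "valid_decoder n R g"
  shows "measure (noise n) {z \<in> space (noise n). g (received n A B x1 x2 z) \<noteq> m}
     = 1 - correct_prob g n m (\<lambda>j. A *v x1 j + B *v x2 j)"
proof -
  note valid_decoder_pred[OF g received_measurable, measurable]
  have "correct_prob g n m (\<lambda>j. A *v x1 j + B *v x2 j)
      = integral\<^sup>L (noise n) (indicator {z \<in> space (noise n). g (received n A B x1 x2 z) = m})"
    unfolding correct_prob_def received_def
    by (intro Bochner_Integration.integral_cong) (auto simp: indicator_def)
  also have "\<dots> = measure (noise n) {z \<in> space (noise n). g (received n A B x1 x2 z) = m}"
    by simp
  finally show ?thesis
    using noise.prob_neg[of n "\<lambda>z. g (received n A B x1 x2 z) = m"] by simp
qed

lemma error1_correct: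
  assumes "valid_decoder n R1 g1"
  shows "1 - error1 H1 H2 n R1 R2 f1 f2 g1
     = (\<Sum>m1<num_messages n R1. \<Sum>m2<num_messages n R2. correct_prob g1 n m1 (\<lambda>j. H1 *v f1 m1 j + H2 *v f2 m2 j))
        / (num_messages n R1 * num_messages n R2)"
  using num_messages_pos[of n R1] num_messages_pos[of n R2] unfolding error1_def
  by (subst measure_receiver_space[OF valid_decoder_pred(2)[OF assms received_measurable]])
    (simp add: correct_prob_measure[OF assms] sum_subtractf diff_divide_distrib)

lemma error2_correct:
  assumes "valid_decoder n R2 g2"
  shows "1 - error2 0 H4 n R1 R2 f1 f2 g2
     = (\<Sum>m2<num_messages n R2. correct_prob g2 n m2 (\<lambda>j. H4 *v f2 m2 j)) / num_messages n R2"
  using num_messages_pos[of n R1] num_messages_pos[of n R2] unfolding error2_def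
  by (subst measure_receiver_space[OF valid_decoder_pred(2)[OF assms received_measurable]])
    (simp add: correct_prob_measure[OF assms] sum_subtractf diff_divide_distrib)

lemma indicator_decoder_measurable:
  assumes "valid_decoder n R g" "T \<in> measurable M (block_space n)"
  shows "(\<lambda>z. indicator {y. g y = m} (T z) :: real) \<in> borel_measurable M"
proof -
  note valid_decoder_pred(1)[OF assms, measurable]
  have "(\<lambda>z. if g (T z) = m then 1 else 0 :: real) \<in> borel_measurable M" by measurable
  then show ?thesis by (simp add: indicator_def)
qed

lemma sum_indicator_decoder: "(\<Sum>m<N. indicator {y. g y = (m :: nat)} y) \<le> (1 :: real)"
proof -
  have "(\<Sum>m<N. indicator {y. g y = m} y) = (\<Sum>m<N. if m = g y then 1 else 0 :: real)"
    by (rule sum.cong) (auto simp: indicator_def)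
  then show ?thesis by simp
qed

text \<open>\<open>b\<close> is the signal of the other transmitter for a fixed message. It shifts
  the signal and the reference mean alike and so drops out of the covariance.\<close>

lemma gaussian_converse_decoder:
  fixes f :: "nat \<Rightarrow> nat \<Rightarrow> real^'n" and b :: "nat \<Rightarrow> real^'n"
  assumes g: "valid_decoder n R g" and n: "0 < n"
  defines "N \<equiv> num_messages n R"
  shows "(\<Sum>m<N. correct_prob g n m (\<lambda>j. H *v f m j + b j)) * ln N
     \<le> N * (n * half_logdet (H ** avg_cov {..<N} n (\<lambda>m j. f m j - \<mu> j) ** transpose H) + ln 2)"
proof -
  have diff: "avg_cov {..<N} n (\<lambda>m j. H *v f m j - H *v \<mu> j)
      = H ** avg_cov {..<N} n (\<lambda>m j. f m j - \<mu> j) ** transpose H"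
    by (simp add: matrix_vector_mult_diff_distrib flip: avg_cov_matrix)
  show ?thesis
    using gaussian_converse[of "{..<N}" n "\<lambda>m. indicator {y. g y = m}" "\<lambda>m j. H *v f m j + b j" "\<lambda>j. H *v \<mu> j + b j",
        OF _ _ n indicator_decoder_measurable[OF g measurable_ident_sets[OF refl]] _ sum_indicator_decoder] num_messages_pos[of n R]
    by (simp add: correct_prob_def half_logdet_def diff N_def[symmetric] lessThan_empty_iff add.assoc)
qed

definition message_mean :: "nat \<Rightarrow> (nat \<Rightarrow> nat \<Rightarrow> real^'n) \<Rightarrow> nat \<Rightarrow> real^'n" where
  "message_mean N f j = (1 / real N) *\<^sub>R (\<Sum>m<N. f m j)"

text \<open>Each channel use has its own mean. Removing it makes the cross terms in
  \<open>avg_cov_pair\<close> vanish and cannot increase the trace.\<close>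

definition code_cov :: "nat \<Rightarrow> nat \<Rightarrow> (nat \<Rightarrow> nat \<Rightarrow> real^'n) \<Rightarrow> real^'n^'n" where
  "code_cov N n f = avg_cov {..<N} n (\<lambda>m j. f m j - message_mean N f j)"

lemma message_mean_diff:
  assumes "0 < N"
  shows "(\<Sum>m<N. f m j - message_mean N f j) = 0"
  using assms by (simp add: sum_subtractf message_mean_def sum_constant_scaleR del: sum_constant)

text \<open>At each channel use the second moment is the variance plus the squared norm of the mean,
  so centring only lowers the power.\<close>

lemma trace_code_cov:
  assumes f: "valid_encoder n R P f" and n: "0 < n"
  shows "trace (code_cov (num_messages n R) n f) \<le> P"
proof -
  define N where "N = num_messages n R"
  have N: "0 < N" by (simp add: N_def num_messages_pos)
  have *: "(\<Sum>m<N. (norm (f m j - message_mean N f j))\<^sup>2) \<le> (\<Sum>m<N. (norm (f m j))\<^sup>2)" for j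
  proof -
    let ?\<mu> = "message_mean N f j"
    have "(\<Sum>m<N. (norm (f m j))\<^sup>2) = (\<Sum>m<N. (norm (f m j - ?\<mu>))\<^sup>2 + 2 * ((f m j - ?\<mu>) \<bullet> ?\<mu>) + (norm ?\<mu>)\<^sup>2)"
      by (rule sum.cong) (auto simp: power2_norm_eq_inner inner_diff_left inner_diff_right inner_commute)
    also have "\<dots> = (\<Sum>m<N. (norm (f m j - ?\<mu>))\<^sup>2) + 2 * ((\<Sum>m<N. f m j - ?\<mu>) \<bullet> ?\<mu>) + N * (norm ?\<mu>)\<^sup>2"
      by (simp add: sum.distrib inner_sum_left sum_distrib_left)
    finally show ?thesis using message_mean_diff[OF N, of f j] by simp
  qed
  have "trace (code_cov N n f) = (\<Sum>j<n. (\<Sum>m<N. (norm (f m j - message_mean N f j))\<^sup>2)) / (n * N)"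
    by (simp add: code_cov_def trace_avg_cov)
  also have "\<dots> \<le> (\<Sum>j<n. (\<Sum>m<N. (norm (f m j))\<^sup>2)) / (n * N)"
    by (intro divide_right_mono sum_mono *) simp
  also have "\<dots> = (\<Sum>j<n. measure_pmf.expectation (message n R) (\<lambda>m. (norm (f m j))\<^sup>2)) / n"
    by (simp add: expectation_message N_def sum_divide_distrib mult.commute)
  also have "\<dots> \<le> P" using f by (simp add: valid_encoder_def)
  finally show ?thesis by (simp add: N_def)
qed

text \<open>A cross term is a product of a sum over \<open>m1\<close> and a sum over
  \<open>m2\<close>, both zero by centring. This is the additivity of covariances for independent
  messages.\<close>

lemma avg_cov_pair:
  fixes a b :: "nat \<Rightarrow> nat \<Rightarrow> real^'n"
  assumes N: "0 < N1" "0 < N2" and a: "\<And>j. (\<Sum>m<N1. a m j) = 0" and b: "\<And>j. (\<Sum>m<N2. b m j) = 0"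
  shows "avg_cov ({..<N1} \<times> {..<N2}) n (\<lambda>(m1, m2) j. a m1 j + b m2 j) = avg_cov {..<N1} n a + avg_cov {..<N2} n b"
proof -
  have a0: "(\<Sum>m<N1. a m j $ p) = 0" for j p using a[of j] by (metis sum_component zero_index)
  have b0: "(\<Sum>m<N2. b m j $ p) = 0" for j p using b[of j] by (metis sum_component zero_index)
  have "(\<Sum>x\<in>{..<N1} \<times> {..<N2}. outer (case x of (m1, m2) \<Rightarrow> a m1 j + b m2 j)) 
     = real N2 *\<^sub>R (\<Sum>m<N1. outer (a m j)) + real N1 *\<^sub>R (\<Sum>m<N2. outer (b m j))" for j
  proof -
    have "(\<Sum>m1<N1. \<Sum>m2<N2. (a m1 j + b m2 j) $ p * (a m1 j + b m2 j) $ q)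
      = real N2 * (\<Sum>m<N1. a m j $ p * a m j $ q) + real N1 * (\<Sum>m<N2. b m j $ p * b m j $ q)" for p q
    proof -
      have "(\<Sum>m1<N1. \<Sum>m2<N2. (a m1 j + b m2 j) $ p * (a m1 j + b m2 j) $ q)
        = (\<Sum>m1<N1. \<Sum>m2<N2. a m1 j $ p * a m1 j $ q) + (\<Sum>m1<N1. \<Sum>m2<N2. a m1 j $ p * b m2 j $ q)
          + (\<Sum>m1<N1. \<Sum>m2<N2. a m1 j $ q * b m2 j $ p) + (\<Sum>m1<N1. \<Sum>m2<N2. b m2 j $ p * b m2 j $ q)"
        by (simp add: sum.distrib algebra_simps)
      also have "(\<Sum>m1<N1. \<Sum>m2<N2. a m1 j $ p * b m2 j $ q) = 0"
        by (simp flip: sum_product add: a0)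
      also have "(\<Sum>m1<N1. \<Sum>m2<N2. a m1 j $ q * b m2 j $ p) = 0"
        by (simp flip: sum_product add: a0)
      finally show ?thesis by (simp add: sum_distrib_left)
    qed
    then show ?thesis
      by (simp add: vec_eq_iff outer_def sum.cartesian_product' split_def)
  qed
  then have "(\<Sum>x\<in>{..<N1} \<times> {..<N2}. outer ((case x of (m1, m2) \<Rightarrow> \<lambda>j. a m1 j + b m2 j) j))
     = real N2 *\<^sub>R (\<Sum>m<N1. outer (a m j)) + real N1 *\<^sub>R (\<Sum>m<N2. outer (b m j))" for j
    by (simp add: split_def)
  then show ?thesis using N
    by (simp add: avg_cov_def sum.distrib scaleR_sum_right[symmetric] scaleR_add_right card_cartesian_product)
qed


section \<open>Degradedness and the bound on the sum rate\<close>

lemma psd_contraction_transpose: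
  fixes B :: "real^'n^'n"
  assumes "\<And>v. norm (B *v v) \<le> norm v"
  shows "psd (mat 1 - B ** transpose B)"
proof -
  have "0 \<le> x \<bullet> ((mat 1 - B ** transpose B) *v x)" for x
  proof -
    define y where "y = transpose B *v x"
    have yx: "y \<bullet> y = x \<bullet> (B *v y)"
      unfolding y_def by (metis inner_transpose inner_commute transpose_transpose)
    \<comment> \<open>The Cauchy-Schwarz inequality transfers the contraction property from
      \<open>B\<close> to its transpose: the square of the norm of \<open>y\<close> is at most
      \<open>norm x * norm y\<close>.\<close>
    also have "\<dots> \<le> norm x * norm (B *v y)" by (rule norm_cauchy_schwarz)
    also have "\<dots> \<le> norm x * norm y" using assms by (intro mult_left_mono) auto
    finally have "norm y * norm y \<le> norm x * norm y"
      by (simp add: power2_norm_eq_inner[symmetric] power2_eq_square)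
    then have "norm y \<le> norm x" by (cases "norm y = 0") (auto simp: mult_le_cancel_right)
    then have "y \<bullet> y \<le> x \<bullet> x" by (simp add: norm_le)
    then show ?thesis
      by (simp add: matrix_vector_mult_diff_rdistrib inner_diff_right matrix_vector_mul_assoc[symmetric] yx[symmetric] flip: y_def)
  qed
  then show ?thesis
    by (auto simp: psd_def vec_eq_iff transpose_def mat_def matrix_matrix_mult_def mult.commute)
qed

text \<open>Receiver 1, once it has removed the signal of transmitter 1, can imitate receiver 2 by applying \<open>B\<close> and
  adding independent noise.\<close>

lemma correct_prob_degraded:
  fixes B C :: "real^'n^'n"
  assumes g: "valid_decoder n R g" and BC: "B ** transpose B + C ** transpose C = mat 1" "invertible B"
  shows "integral\<^sup>L (noise n) (\<lambda>z. integral\<^sup>L (noise n) (\<lambda>w. indicator {y. g y = m} (\<lambda>j\<in>{..<n}. s j + (B *v z j + C *v w j))))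
     = correct_prob g n m s"
proof -
  interpret P: pair_prob_space "noise n :: (nat \<Rightarrow> real^'n) measure" "noise n :: (nat \<Rightarrow> real^'n) measure" ..
  define F where "F v = (indicator {y. g y = m} (\<lambda>j\<in>{..<n}. s j + v j) :: real)" for v
  have Fm: "(\<lambda>x. F (T x)) \<in> borel_measurable M" if "T \<in> measurable M (block_space n)" for T M
    unfolding F_def by (rule indicator_decoder_measurable[OF g]) (use that in measurable)
  have F01: "0 \<le> F v" "F v \<le> 1" for v by (auto simp: F_def indicator_def)
  define T where "T z w = (\<lambda>j\<in>{..<n}. B *v z j + C *v w j)" for z w :: "nat \<Rightarrow> real^'n"
  have T [measurable]: "(\<lambda>(z, w). F (T z w)) \<in> borel_measurable (noise n \<Otimes>\<^sub>M noise n)"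
    unfolding split_def by (rule Fm) (unfold T_def, measurable)
  have T2 [measurable]: "(\<lambda>w. F (T z w)) \<in> borel_measurable (noise n)" for z
    by (rule Fm) (unfold T_def, measurable)
  have q: "ennreal (integral\<^sup>L (noise n) (\<lambda>w. F (T z w))) = (\<integral>\<^sup>+w. ennreal (F (T z w)) \<partial>noise n)" for z
    by (intro nn_integral_eq_integral[symmetric] noise.integrable_const_bound[where B = 1]) (use F01 in auto)
  have "ennreal (integral\<^sup>L (noise n) (\<lambda>z. integral\<^sup>L (noise n) (\<lambda>w. F (T z w))))
      = (\<integral>\<^sup>+z. ennreal (integral\<^sup>L (noise n) (\<lambda>w. F (T z w))) \<partial>noise n)"
  proof (intro nn_integral_eq_integral[symmetric] noise.integrable_const_bound[where B = 1] AE_I2)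
    fix z
    show "0 \<le> integral\<^sup>L (noise n) (\<lambda>w. F (T z w))" using F01 by (intro integral_nonneg_AE) auto
    have "integral\<^sup>L (noise n) (\<lambda>w. F (T z w)) \<le> integral\<^sup>L (noise n :: (nat \<Rightarrow> real^'n) measure) (\<lambda>w. 1)"
      by (intro integral_mono noise.integrable_const_bound[where B = 1]) (use F01 in auto)
    then show "norm (integral\<^sup>L (noise n) (\<lambda>w. F (T z w))) \<le> 1"
      using \<open>0 \<le> integral\<^sup>L (noise n) (\<lambda>w. F (T z w))\<close> by (simp add: noise.prob_space)
  qed measurable
  \<comment> \<open>The integrals are exchanged because \<open>nn_integral_noise_sum\<close> wants
    the matrix of the inner variable invertible; that is \<open>B\<close>, whereas \<open>C\<close>
    may be singular.\<close>
  also have "\<dots> = (\<integral>\<^sup>+w. \<integral>\<^sup>+z. ennreal (F (T z w)) \<partial>noise n \<partial>noise n)"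
    unfolding q by (rule P.Fubini') measurable
  also have "\<dots> = (\<integral>\<^sup>+w. \<integral>\<^sup>+z. ennreal (F (\<lambda>j\<in>{..<n}. mat 1 *v (C *v w j + B *v z j))) \<partial>noise n \<partial>noise n)"
    by (simp add: T_def add.commute)
  also have "\<dots> = (\<integral>\<^sup>+z. ennreal (F z) \<partial>noise n)"
  proof (rule nn_integral_noise_sum)
    show "mat 1 ** (B ** transpose B + C ** transpose C) ** transpose (mat 1) = mat 1"
      by (simp add: BC transpose_mat)
    show "(\<lambda>z. ennreal (F z)) \<in> borel_measurable (block_space n)"
      using Fm[of "\<lambda>x. x"] by measurable
  qed fact
  also have "\<dots> = ennreal (integral\<^sup>L (noise n) F)"
  proof -
    have "F \<in> borel_measurable (noise n)" using Fm[of "\<lambda>x. x" "noise n"] by (simp add: measurable_ident_sets sets_noise)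
    then show ?thesis
      using F01 by (intro nn_integral_eq_integral noise.integrable_const_bound[where B = 1]) auto
  qed
  finally have "integral\<^sup>L (noise n) (\<lambda>z. integral\<^sup>L (noise n) (\<lambda>w. F (T z w))) = integral\<^sup>L (noise n) F"
    using F01 by (subst (asm) ennreal_inj) (auto intro!: integral_nonneg_AE)
  moreover have "F (T z w) = indicator {y. g y = m} (\<lambda>j\<in>{..<n}. s j + (B *v z j + C *v w j))" for z w
    unfolding F_def T_def by (rule arg_cong[of _ _ "indicator _"]) auto
  ultimately show ?thesis by (simp add: F_def[abs_def] correct_prob_def)
qed

text \<open>\<open>gaussian_converse\<close> is applied to pairs of messages. The weight
  \<open>\<kappa> (m1, m2) y\<close> is the probability, over the noise \<open>w\<close> added by
  receiver 1, that \<open>g1\<close> decides \<open>m1\<close> and that \<open>g2\<close>, fed with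
  the imitated output, decides \<open>m2\<close>; the codeword subtracted in \<open>q m1 m2\<close>
  is therefore always the one that \<open>g1\<close> has decided on. Contractivity of
  \<open>B\<close> is exactly the semidefinite order between the two Gram matrices, and it makes
  room for the covariance \<open>C C^T\<close> of the added noise.\<close>

lemma sum_rate_converse:
  fixes H1 H2 H4 :: "real^'n^'n"
  assumes g1: "valid_decoder n R1 g1" and g2: "valid_decoder n R2 g2" and n: "0 < n"
    and inv: "invertible H2" "invertible H4" and psd: "psd (transpose H2 ** H2 - transpose H4 ** H4)"
  defines "N1 \<equiv> num_messages n R1" and "N2 \<equiv> num_messages n R2"
  shows "(\<Sum>m1<N1. \<Sum>m2<N2. correct_prob g1 n m1 (\<lambda>j. H1 *v f1 m1 j + H2 *v f2 m2 j) + correct_prob g2 n m2 (\<lambda>j. H4 *v f2 m2 j) - 1)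
      * ln (N1 * N2)
    \<le> N1 * N2 * (n * half_logdet (H1 ** code_cov N1 n f1 ** transpose H1 + H2 ** code_cov N2 n f2 ** transpose H2) + ln 2)"
proof -
  have N: "0 < N1" "0 < N2" by (simp_all add: N1_def N2_def num_messages_pos)
  obtain D where D: "H2 ** D = mat 1" "D ** H2 = mat 1" using inv(1) by (auto simp: invertible_def)
  define B where "B = H4 ** D"
  have BH: "B *v (H2 *v x) = H4 *v x" for x
    by (simp add: B_def matrix_vector_mul_assoc matrix_mul_assoc[symmetric] D)
  have "det D \<noteq> 0" using D(1) by (metis det_I det_mul mult_zero_right zero_neq_one)
  then have invB: "invertible B" using inv(2) by (simp add: B_def invertible_det_nz det_mul)
  have "norm (B *v v) \<le> norm v" for v
  proof -
    define x where "x = D *v v"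
    have v: "v = H2 *v x" by (simp add: x_def matrix_vector_mul_assoc D)
    have "0 \<le> x \<bullet> ((transpose H2 ** H2 - transpose H4 ** H4) *v x)" using psd by (simp add: psd_def)
    also have "\<dots> = (H2 *v x) \<bullet> (H2 *v x) - (H4 *v x) \<bullet> (H4 *v x)"
      by (simp add: matrix_vector_mult_diff_rdistrib inner_diff_right matrix_vector_mul_assoc[symmetric] inner_transpose)
    finally show ?thesis by (simp add: v BH norm_le)
  qed
  from psd_factor[OF psd_contraction_transpose[OF this]] obtain C :: "real^'n^'n"
    where "mat 1 - B ** transpose B = C ** transpose C" by metis
  then have BC: "B ** transpose B + C ** transpose C = mat 1" by (simp add: algebra_simps)
  define s where "s = (\<lambda>(m1, m2) j. H1 *v f1 m1 j + H2 *v f2 m2 j)"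
  define \<mu> where "\<mu> j = H1 *v message_mean N1 f1 j + H2 *v message_mean N2 f2 j" for j
  define q where "q m1 m2 y = integral\<^sup>L (noise n) (\<lambda>w. indicator {y. g2 y = m2} (\<lambda>j\<in>{..<n}. B *v (y j - H1 *v f1 m1 j) + C *v w j) :: real)"
    for m1 m2 y
  define \<kappa> where "\<kappa> = (\<lambda>(m1, m2) y. indicator {y. g1 y = m1} y * q m1 m2 y)"
  have i2 [measurable]: "(\<lambda>(y, w). indicator {y. g2 y = m2} (\<lambda>j\<in>{..<n}. B *v (y j - H1 *v f1 m1 j) + C *v w j) :: real)
      \<in> borel_measurable (block_space n \<Otimes>\<^sub>M noise n)" for m1 m2
    unfolding split_def by (rule indicator_decoder_measurable[OF g2]) measurable
  have i2' [measurable]: "(\<lambda>w. indicator {y. g2 y = m2} (\<lambda>j\<in>{..<n}. B *v (y j - H1 *v f1 m1 j) + C *v w j) :: real)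
      \<in> borel_measurable (noise n)" for m1 m2 y
    by (rule indicator_decoder_measurable[OF g2]) measurable
  have i2int: "integrable (noise n) (\<lambda>w. indicator {y. g2 y = m2} (\<lambda>j\<in>{..<n}. B *v (y j - H1 *v f1 m1 j) + C *v w j) :: real)" for m1 m2 y
    by (rule noise.integrable_const_bound[where B = 1]) auto
  have qm [measurable]: "q m1 m2 \<in> borel_measurable (block_space n)" for m1 m2
    unfolding q_def[abs_def] by measurable
  have q0: "0 \<le> q m1 m2 y" for m1 m2 y unfolding q_def by (intro integral_nonneg_AE) auto
  have qsum: "(\<Sum>m2<N2. q m1 m2 y) \<le> 1" for m1 y
  proof -
    have "(\<Sum>m2<N2. q m1 m2 y) = integral\<^sup>L (noise n) (\<lambda>w. \<Sum>m2<N2. indicator {y. g2 y = m2} (\<lambda>j\<in>{..<n}. B *v (y j - H1 *v f1 m1 j) + C *v w j))"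
      unfolding q_def by (rule Bochner_Integration.integral_sum[symmetric]) (rule i2int)
    also have "\<dots> \<le> integral\<^sup>L (noise n :: (nat \<Rightarrow> real^'n) measure) (\<lambda>w. 1)"
      by (intro integral_mono Bochner_Integration.integrable_sum i2int) (auto intro: sum_indicator_decoder)
    finally show ?thesis by (simp add: noise.prob_space)
  qed
  have q1: "q m1 m2 y \<le> 1" if "m2 < N2" for m1 m2 y
  proof -
    have "q m1 m2 y \<le> (\<Sum>m2<N2. q m1 m2 y)" using that q0 by (intro member_le_sum) auto
    then show ?thesis using qsum order_trans by blast
  qed
  have conv: "(\<Sum>m\<in>{..<N1} \<times> {..<N2}. integral\<^sup>L (noise n) (\<lambda>z. \<kappa> m (\<lambda>j\<in>{..<n}. s m j + z j))) * ln (card ({..<N1} \<times> {..<N2}))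
      \<le> card ({..<N1} \<times> {..<N2}) * (n * (1 / 2 * ln (det (mat 1 + avg_cov ({..<N1} \<times> {..<N2}) n (\<lambda>m j. s m j - \<mu> j)))) + ln 2)"
  proof (rule gaussian_converse)
    show "{..<N1} \<times> {..<N2} \<noteq> {}" using N by auto
    show "\<kappa> m \<in> borel_measurable (block_space n)" for m
      using indicator_decoder_measurable[OF g1, of "\<lambda>y. y" "block_space n"]
      by (cases m) (auto simp: \<kappa>_def intro!: borel_measurable_times)
    show "0 \<le> \<kappa> m y" for m y by (cases m) (auto simp: \<kappa>_def q0)
    fix y
    have "(\<Sum>m\<in>{..<N1} \<times> {..<N2}. \<kappa> m y) = (\<Sum>m1<N1. indicator {y. g1 y = m1} y * (\<Sum>m2<N2. q m1 m2 y))"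
      unfolding sum_distrib_left sum.cartesian_product by (rule sum.cong) (auto simp: \<kappa>_def)
    also have "\<dots> \<le> (\<Sum>m1<N1. indicator {y. g1 y = m1} y * 1)"
      by (intro sum_mono mult_left_mono qsum) auto
    also have "\<dots> \<le> 1" using sum_indicator_decoder[of g1 y N1] by simp
    finally show "(\<Sum>m\<in>{..<N1} \<times> {..<N2}. \<kappa> m y) \<le> 1" .
  qed (use n in auto)
  have cov: "avg_cov ({..<N1} \<times> {..<N2}) n (\<lambda>m j. s m j - \<mu> j)
      = H1 ** code_cov N1 n f1 ** transpose H1 + H2 ** code_cov N2 n f2 ** transpose H2"
  proof -
    define a b where "a m j = H1 *v (f1 m j - message_mean N1 f1 j)" and "b m j = H2 *v (f2 m j - message_mean N2 f2 j)" for m j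
    have "(\<Sum>m<N1. a m j) = H1 *v (\<Sum>m<N1. f1 m j - message_mean N1 f1 j)" for j
      unfolding a_def by (rule linear_sum[symmetric]) simp
    moreover have "(\<Sum>m<N2. b m j) = H2 *v (\<Sum>m<N2. f2 m j - message_mean N2 f2 j)" for j
      unfolding b_def by (rule linear_sum[symmetric]) simp
    moreover have "(\<lambda>m j. s m j - \<mu> j) = (\<lambda>(m1, m2) j. a m1 j + b m2 j)"
      by (auto simp: s_def \<mu>_def a_def b_def fun_eq_iff matrix_vector_mult_diff_distrib)
    ultimately have "avg_cov ({..<N1} \<times> {..<N2}) n (\<lambda>m j. s m j - \<mu> j) = avg_cov {..<N1} n a + avg_cov {..<N2} n b"
      using avg_cov_pair[OF N, of a b n] by (simp add: message_mean_diff N)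
    then show ?thesis by (simp only: a_def[abs_def] b_def[abs_def] avg_cov_matrix code_cov_def)
  qed
  have each: "correct_prob g1 n m1 (\<lambda>j. H1 *v f1 m1 j + H2 *v f2 m2 j) + correct_prob g2 n m2 (\<lambda>j. H4 *v f2 m2 j) - 1
      \<le> integral\<^sup>L (noise n) (\<lambda>z. \<kappa> (m1, m2) (\<lambda>j\<in>{..<n}. s (m1, m2) j + z j))" if m2: "m2 < N2" for m1 m2
  proof -
    define I where "I z = (indicator {y. g1 y = m1} (\<lambda>j\<in>{..<n}. s (m1, m2) j + z j) :: real)" for z
    define Q where "Q z = q m1 m2 (\<lambda>j\<in>{..<n}. s (m1, m2) j + z j)" for z
    have Im [measurable]: "I \<in> borel_measurable (noise n)"
      unfolding I_def[abs_def] by (rule indicator_decoder_measurable[OF g1]) measurable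
    have Qm [measurable]: "Q \<in> borel_measurable (noise n)"
      unfolding Q_def[abs_def] by measurable
    have I01: "0 \<le> I z" "I z \<le> 1" for z by (auto simp: I_def indicator_def)
    have Q01: "0 \<le> Q z" "Q z \<le> 1" for z using q0 q1[OF m2] by (auto simp: Q_def)
    have int: "integrable (noise n) I" "integrable (noise n) Q" "integrable (noise n) (\<lambda>z. I z * Q z)"
      by (rule noise.integrable_const_bound[where B = 1]; use I01 Q01 in \<open>auto simp: abs_mult intro!: mult_le_one\<close>)+
    have Q: "integral\<^sup>L (noise n) Q = correct_prob g2 n m2 (\<lambda>j. H4 *v f2 m2 j)"
    proof -
      have *: "(\<lambda>j\<in>{..<n}. B *v ((\<lambda>j\<in>{..<n}. s (m1, m2) j + z j) j - H1 *v f1 m1 j) + C *v w j)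
          = (\<lambda>j\<in>{..<n}. H4 *v f2 m2 j + (B *v z j + C *v w j))" for z w
        by (auto simp: s_def fun_eq_iff matrix_vector_right_distrib BH)
      show ?thesis
        \<comment> \<open>At the signal of the true pair, subtracting the first codeword and
          applying \<open>B\<close> leaves \<open>H4 *v f2 m2 j\<close> plus noise of unit
          covariance, which is the situation at receiver 2.\<close>
        unfolding Q_def q_def * by (rule correct_prob_degraded[OF g2 BC invB])
    qed
    have "integral\<^sup>L (noise n) I + integral\<^sup>L (noise n) Q - 1 = integral\<^sup>L (noise n) (\<lambda>z. I z + Q z - 1)"
      using int by (simp add: noise.prob_space)
    also have "\<dots> \<le> integral\<^sup>L (noise n) (\<lambda>z. I z * Q z)"
    proof (intro integral_mono int Bochner_Integration.integrable_add Bochner_Integration.integrable_diff)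
      fix z
      have "0 \<le> (1 - I z) * (1 - Q z)" using I01[of z] Q01[of z] by simp
      then show "I z + Q z - 1 \<le> I z * Q z" by (simp add: algebra_simps)
    qed simp
    finally show ?thesis by (simp add: Q I_def[abs_def] correct_prob_def \<kappa>_def Q_def s_def)
  qed
  have "(\<Sum>m1<N1. \<Sum>m2<N2. correct_prob g1 n m1 (\<lambda>j. H1 *v f1 m1 j + H2 *v f2 m2 j) + correct_prob g2 n m2 (\<lambda>j. H4 *v f2 m2 j) - 1)
      * ln (N1 * N2) \<le> (\<Sum>m\<in>{..<N1} \<times> {..<N2}. integral\<^sup>L (noise n) (\<lambda>z. \<kappa> m (\<lambda>j\<in>{..<n}. s m j + z j))) * ln (N1 * N2)"
  proof (rule mult_right_mono)
    show "0 \<le> ln (real (N1 * N2))" using N by (intro ln_ge_zero) (simp add: Suc_le_eq del: of_nat_mult)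
    have "(\<Sum>m1<N1. \<Sum>m2<N2. correct_prob g1 n m1 (\<lambda>j. H1 *v f1 m1 j + H2 *v f2 m2 j) + correct_prob g2 n m2 (\<lambda>j. H4 *v f2 m2 j) - 1)
      \<le> (\<Sum>m1<N1. \<Sum>m2<N2. integral\<^sup>L (noise n) (\<lambda>z. \<kappa> (m1, m2) (\<lambda>j\<in>{..<n}. s (m1, m2) j + z j)))"
      by (intro sum_mono each) simp
    also have "\<dots> = (\<Sum>m\<in>{..<N1} \<times> {..<N2}. integral\<^sup>L (noise n) (\<lambda>z. \<kappa> m (\<lambda>j\<in>{..<n}. s m j + z j)))"
      by (simp only: sum.cartesian_product split_def prod.collapse)
    finally show "(\<Sum>m1<N1. \<Sum>m2<N2. correct_prob g1 n m1 (\<lambda>j. H1 *v f1 m1 j + H2 *v f2 m2 j) + correct_prob g2 n m2 (\<lambda>j. H4 *v f2 m2 j) - 1)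
      \<le> (\<Sum>m\<in>{..<N1} \<times> {..<N2}. integral\<^sup>L (noise n) (\<lambda>z. \<kappa> m (\<lambda>j\<in>{..<n}. s m j + z j)))" .
  qed
  also note conv[unfolded cov card_cartesian_product card_lessThan]
  finally show ?thesis by (simp add: half_logdet_def)
qed


text \<open>The three left sides are separate parameters because a code of finite length yields
  perturbed values, the third of which is in general not the sum of the other two.\<close>

definition rate_bounds :: "real^'n^'n \<Rightarrow> real^'n^'n \<Rightarrow> real^'n^'n \<Rightarrow> real^'n^'n \<Rightarrow> real^'n^'n \<Rightarrow> real \<Rightarrow> real \<Rightarrow> real \<Rightarrow> bool" where
  "rate_bounds H1 H2 H4 S1 S2 a b c \<longleftrightarrow>
     a \<le> half_logdet (H1 ** S1 ** transpose H1) \<and>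
     b \<le> half_logdet (H4 ** S2 ** transpose H4) \<and>
     c \<le> half_logdet (H1 ** S1 ** transpose H1 + H2 ** S2 ** transpose H2)"

text \<open>One pair of covariances has to serve all three bounds, and the covariances of the two
  codebooks do. The condition \<open>e1 + e2 \<le> 1\<close> makes the factors in front of the rates
  nonnegative, so the logarithms of the numbers of messages may be replaced by the smaller
  \<open>n * R1\<close> and \<open>n * R2\<close>.\<close>

lemma code_converse:
  fixes H1 H2 H4 :: "real^'n^'n"
  assumes f: "valid_encoder n R1 P1 f1" "valid_encoder n R2 P2 f2"
    and g: "valid_decoder n R1 g1" "valid_decoder n R2 g2" and n: "0 < n"
    and inv: "invertible H2" "invertible H4" and psd: "psd (transpose H2 ** H2 - transpose H4 ** H4)"
  defines "e1 \<equiv> error1 H1 H2 n R1 R2 f1 f2 g1" and "e2 \<equiv> error2 0 H4 n R1 R2 f1 f2 g2"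
  assumes e: "e1 + e2 \<le> 1"
  shows "\<exists>S1 S2. psd S1 \<and> psd S2 \<and> trace S1 \<le> P1 \<and> trace S2 \<le> P2 \<and>
    rate_bounds H1 H2 H4 S1 S2 ((1 - e1) * R1 - ln 2 / n) ((1 - e2) * R2 - ln 2 / n) ((1 - e1 - e2) * (R1 + R2) - ln 2 / n)"
proof -
  define N1 N2 where "N1 = num_messages n R1" and "N2 = num_messages n R2"
  have N: "0 < N1" "0 < N2" by (simp_all add: N1_def N2_def num_messages_pos)
  have lnN: "n * R1 \<le> ln N1" "n * R2 \<le> ln N2" by (simp_all add: N1_def N2_def ln_num_messages)
  have e0: "0 \<le> e1" "0 \<le> e2" by (simp_all add: e1_def e2_def error1_def error2_def)
  define S1 S2 where "S1 = code_cov N1 n f1" and "S2 = code_cov N2 n f2"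
  let ?p1 = "\<lambda>m1 m2. correct_prob g1 n m1 (\<lambda>j. H1 *v f1 m1 j + H2 *v f2 m2 j)"
  let ?p2 = "\<lambda>m2. correct_prob g2 n m2 (\<lambda>j. H4 *v f2 m2 j)"
  have p1: "(\<Sum>m1<N1. \<Sum>m2<N2. ?p1 m1 m2) = (1 - e1) * (N1 * N2)"
    using N unfolding e1_def error1_correct[OF g(1)] by (simp add: N1_def N2_def)
  have p2: "(\<Sum>m2<N2. ?p2 m2) = (1 - e2) * N2"
    using N unfolding e2_def error2_correct[OF g(2)] by (simp add: N1_def N2_def)
  have "psd S1" "psd S2" by (simp_all add: S1_def S2_def code_cov_def psd_avg_cov)
  moreover have "trace S1 \<le> P1" "trace S2 \<le> P2"
    using f n by (simp_all add: S1_def S2_def N1_def N2_def trace_code_cov)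
  moreover have "(1 - e1) * R1 - ln 2 / n \<le> half_logdet (H1 ** S1 ** transpose H1)"
  proof -
    \<comment> \<open>For each fixed \<open>m2\<close> the interference is a known shift, so the
      single-user bound holds with the same right side; it is then summed over
      \<open>m2\<close>.\<close>
    have "(1 - e1) * (N1 * N2) * ln N1 = (\<Sum>m2<N2. (\<Sum>m1<N1. ?p1 m1 m2) * ln N1)"
      by (subst sum_distrib_right[symmetric], subst sum.swap) (simp add: p1)
    also have "\<dots> \<le> (\<Sum>m2<N2. N1 * (n * half_logdet (H1 ** S1 ** transpose H1) + ln 2))"
      unfolding S1_def code_cov_def N1_def
      by (intro sum_mono gaussian_converse_decoder g n)
    finally have "(N1 * N2) * ((1 - e1) * ln N1) \<le> (N1 * N2) * (n * half_logdet (H1 ** S1 ** transpose H1) + ln 2)"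
      by (simp add: mult_ac)
    then have "(1 - e1) * ln N1 \<le> n * half_logdet (H1 ** S1 ** transpose H1) + ln 2"
      using N by (simp only: mult_le_cancel_left_pos of_nat_0_less_iff nat_0_less_mult_iff)
    moreover have "(1 - e1) * (n * R1) \<le> (1 - e1) * ln N1" using e e0 lnN by (intro mult_left_mono) auto
    ultimately show ?thesis using n by (simp add: field_simps)
  qed
  moreover have "(1 - e2) * R2 - ln 2 / n \<le> half_logdet (H4 ** S2 ** transpose H4)"
  proof -
    have "N2 * ((1 - e2) * ln N2) = (\<Sum>m2<N2. ?p2 m2) * ln N2" by (simp add: p2)
    also have "\<dots> \<le> N2 * (n * half_logdet (H4 ** S2 ** transpose H4) + ln 2)"
      using gaussian_converse_decoder[OF g(2) n, where f = f2 and b = "\<lambda>_. 0" and H = H4 and \<mu> = "message_mean N2 f2"]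
      by (simp add: S2_def code_cov_def N2_def)
    finally have "(1 - e2) * ln N2 \<le> n * half_logdet (H4 ** S2 ** transpose H4) + ln 2"
      using N by (simp only: mult_le_cancel_left_pos of_nat_0_less_iff)
    moreover have "(1 - e2) * (n * R2) \<le> (1 - e2) * ln N2" using e e0 lnN by (intro mult_left_mono) auto
    ultimately show ?thesis using n by (simp add: field_simps)
  qed
  moreover have "(1 - e1 - e2) * (R1 + R2) - ln 2 / n \<le> half_logdet (H1 ** S1 ** transpose H1 + H2 ** S2 ** transpose H2)"
  proof -
    have "(\<Sum>m1<N1. \<Sum>m2<N2. ?p1 m1 m2 + ?p2 m2 - 1) = (1 - e1) * (N1 * N2) + N1 * ((1 - e2) * N2) - N1 * N2"
      by (simp add: sum.distrib sum_subtractf p1 p2)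
    also have "\<dots> = (N1 * N2) * (1 - e1 - e2)" by (simp add: algebra_simps)
    finally have "(N1 * N2) * ((1 - e1 - e2) * ln (N1 * N2))
      \<le> (N1 * N2) * (n * half_logdet (H1 ** S1 ** transpose H1 + H2 ** S2 ** transpose H2) + ln 2)"
      using sum_rate_converse[OF g n inv psd, of H1 f1 f2] by (simp add: N1_def N2_def S1_def S2_def)
    then have "(1 - e1 - e2) * ln (N1 * N2) \<le> n * half_logdet (H1 ** S1 ** transpose H1 + H2 ** S2 ** transpose H2) + ln 2"
      using N by (simp only: mult_le_cancel_left_pos of_nat_0_less_iff nat_0_less_mult_iff)
    moreover have "(1 - e1 - e2) * (n * (R1 + R2)) \<le> (1 - e1 - e2) * ln (N1 * N2)"
      using e lnN N by (intro mult_left_mono) (auto simp: ln_mult distrib_left)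
    ultimately show ?thesis using n by (simp add: field_simps)
  qed
  ultimately show ?thesis unfolding rate_bounds_def by blast
qed

section \<open>Compactness of the covariances and closedness of the rate region\<close>

lemma closed_psd: "closed {S :: real^'n^'n. psd S \<and> trace S \<le> P}"
proof -
  have "{S :: real^'n^'n. psd S \<and> trace S \<le> P} =
    (\<Inter>i. \<Inter>j. {S. S $ j $ i = S $ i $ j}) \<inter> (\<Inter>x. {S. 0 \<le> (\<Sum>i\<in>UNIV. x $ i * (\<Sum>j\<in>UNIV. S $ i $ j * x $ j))}) \<inter> {S. (\<Sum>i\<in>UNIV. S $ i $ i) \<le> P}"
    by (auto simp: psd_def transpose_def vec_eq_iff inner_vec_def matrix_vector_mult_def trace_def)
  moreover have "closed \<dots>"
    by (intro closed_Int closed_INT ballI closed_Collect_eq closed_Collect_le continuous_intros)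
  ultimately show ?thesis by simp
qed

text \<open>Diagonal entries are nonnegative and hence at most the trace, and they dominate the
  other entries by \<open>psd_entry_bound\<close>; so the trace constraint bounds the whole
  matrix.\<close>

lemma compact_psd: "compact {S :: real^'n^'n. psd S \<and> trace S \<le> P}"
proof -
  have "norm S \<le> (\<Sum>i\<in>(UNIV :: 'n set). \<Sum>j\<in>(UNIV :: 'n set). P)" if S: "psd S" "trace S \<le> P" for S :: "real^'n^'n"
  proof -
    have entry: "\<bar>S $ i $ j\<bar> \<le> P" for i j
    proof -
      have "S $ k $ k \<le> trace S" for k
        unfolding trace_def using psd_diag[OF S(1)] by (intro member_le_sum) auto
      from this[of i] this[of j] show ?thesis using psd_entry_bound[OF S(1), of i j] S(2) by linarith
    qed
    have "norm S \<le> (\<Sum>i\<in>UNIV. norm (S $ i))" by (simp add: norm_vec_def L2_set_le_sum)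
    also have "\<dots> \<le> (\<Sum>i\<in>UNIV. \<Sum>j\<in>UNIV. \<bar>S $ i $ j\<bar>)" by (intro sum_mono norm_le_l1_cart)
    also have "\<dots> \<le> (\<Sum>i\<in>(UNIV :: 'n set). \<Sum>j\<in>(UNIV :: 'n set). P)" by (intro sum_mono entry)
    finally show ?thesis .
  qed
  then have "bounded {S :: real^'n^'n. psd S \<and> trace S \<le> P}" unfolding bounded_iff by blast
  then show ?thesis using closed_psd by (simp add: compact_eq_bounded_closed)
qed

lemma tendsto_matrix_conj:
  fixes H :: "real^'n^'n"
  assumes "(S \<longlongrightarrow> S0) F"
  shows "((\<lambda>k. H ** S k ** transpose H) \<longlongrightarrow> H ** S0 ** transpose H) F"
proof -
  have "linear (\<lambda>S. H ** S ** transpose H)"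
    by (rule linearI) (simp_all add: matrix_add_ldistrib matrix_add_mult_distrib_right matrix_conj_scaleR)
  then show ?thesis using bounded_linear.tendsto assms by (auto simp: linear_conv_bounded_linear)
qed

text \<open>Positive semidefiniteness is required of the limit only: it keeps
  \<open>det (mat 1 + A0)\<close> away from 0, where the logarithm is not continuous.\<close>

lemma half_logdet_tendsto:
  assumes "(A \<longlongrightarrow> A0) F" "psd A0"
  shows "((\<lambda>k. half_logdet (A k)) \<longlongrightarrow> half_logdet (A0 :: real^'n^'n)) F"
proof -
  have "det (mat 1 + A0) \<noteq> 0" using psd_whitening[OF assms(2)] by metis
  moreover have "((\<lambda>k. det (mat 1 + A k)) \<longlongrightarrow> det (mat 1 + A0)) F"
    unfolding det_def by (intro tendsto_intros assms)
  ultimately show ?thesis unfolding half_logdet_def by (intro tendsto_intros) auto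
qed

text \<open>A convergent subsequence of covariance pairs serves all three bounds at once. The lemma
  is used twice: for the limit of long blocks in the converse, and to see that the region is
  closed.\<close>

lemma rate_bounds_limit:
  fixes H1 H2 H4 :: "real^'n^'n"
  assumes ex: "\<And>k :: nat. \<exists>S1 S2. psd S1 \<and> psd S2 \<and> trace S1 \<le> P1 \<and> trace S2 \<le> P2 \<and> rate_bounds H1 H2 H4 S1 S2 (a k) (b k) (c k)"
    and lim: "a \<longlonglongrightarrow> a0" "b \<longlonglongrightarrow> b0" "c \<longlonglongrightarrow> c0"
  shows "\<exists>S1 S2. psd S1 \<and> psd S2 \<and> trace S1 \<le> P1 \<and> trace S2 \<le> P2 \<and> rate_bounds H1 H2 H4 S1 S2 a0 b0 c0"
proof -
  let ?K = "\<lambda>P. {S :: real^'n^'n. psd S \<and> trace S \<le> P}"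
  obtain S1 S2 where S: "\<And>k. S1 k \<in> ?K P1" "\<And>k. S2 k \<in> ?K P2" "\<And>k. rate_bounds H1 H2 H4 (S1 k) (S2 k) (a k) (b k) (c k)"
    using ex by simp metis
  have "seq_compact (?K P1 \<times> ?K P2)"
    by (intro compact_imp_seq_compact compact_Times compact_psd)
  then obtain l r where l: "l \<in> ?K P1 \<times> ?K P2" "strict_mono r" "((\<lambda>k. (S1 k, S2 k)) \<circ> r) \<longlonglongrightarrow> l"
    using S by (elim seq_compactE[where f = "\<lambda>k. (S1 k, S2 k)"]) auto
  obtain T1 T2 where T: "l = (T1, T2)" by (cases l)
  have psd: "psd T1" "psd T2" "trace T1 \<le> P1" "trace T2 \<le> P2" using l T by auto
  have c1: "(\<lambda>k. S1 (r k)) \<longlonglongrightarrow> T1" using tendsto_fst[OF l(3)] by (simp add: T o_def)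
  have c2: "(\<lambda>k. S2 (r k)) \<longlonglongrightarrow> T2" using tendsto_snd[OF l(3)] by (simp add: T o_def)
  note sub = LIMSEQ_subseq_LIMSEQ[OF _ l(2), unfolded o_def]
  have "a0 \<le> half_logdet (H1 ** T1 ** transpose H1)"
    by (rule LIMSEQ_le[OF sub[OF lim(1)] half_logdet_tendsto[OF tendsto_matrix_conj[OF c1]]])
      (use S(3) psd in \<open>auto simp: rate_bounds_def psd_conj\<close>)
  moreover have "b0 \<le> half_logdet (H4 ** T2 ** transpose H4)"
    by (rule LIMSEQ_le[OF sub[OF lim(2)] half_logdet_tendsto[OF tendsto_matrix_conj[OF c2]]])
      (use S(3) psd in \<open>auto simp: rate_bounds_def psd_conj\<close>)
  moreover have "c0 \<le> half_logdet (H1 ** T1 ** transpose H1 + H2 ** T2 ** transpose H2)"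
    by (rule LIMSEQ_le[OF sub[OF lim(3)] half_logdet_tendsto[OF tendsto_add[OF tendsto_matrix_conj[OF c1] tendsto_matrix_conj[OF c2]]]])
      (use S(3) psd in \<open>auto simp: rate_bounds_def psd_conj psd_add\<close>)
  ultimately show ?thesis using psd unfolding rate_bounds_def by blast
qed

definition rate_region :: "real^'n^'n \<Rightarrow> real^'n^'n \<Rightarrow> real^'n^'n \<Rightarrow> real \<Rightarrow> real \<Rightarrow> (real \<times> real) set" where
  "rate_region H1 H2 H4 P1 P2 = {(R1, R2). 0 \<le> R1 \<and> 0 \<le> R2 \<and>
     (\<exists>S1 S2. psd S1 \<and> psd S2 \<and> trace S1 \<le> P1 \<and> trace S2 \<le> P2 \<and> rate_bounds H1 H2 H4 S1 S2 R1 R2 (R1 + R2))}"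

lemma closed_rate_region: "closed (rate_region H1 H2 H4 P1 P2)"
  unfolding closed_sequential_limits
proof (intro allI impI)
  fix x :: "nat \<Rightarrow> real \<times> real" and l
  assume "(\<forall>k. x k \<in> rate_region H1 H2 H4 P1 P2) \<and> x \<longlonglongrightarrow> l"
  then have x: "\<And>k. x k \<in> rate_region H1 H2 H4 P1 P2" and l: "x \<longlonglongrightarrow> l" by auto
  note lim = tendsto_fst[OF l] tendsto_snd[OF l]
  have "0 \<le> fst l" "0 \<le> snd l"
    using x by (auto intro!: LIMSEQ_le_const[OF lim(1)] LIMSEQ_le_const[OF lim(2)] simp: rate_region_def split_def)
  then show "l \<in> rate_region H1 H2 H4 P1 P2"
    using rate_bounds_limit[of P1 P2 H1 H2 H4 "\<lambda>k. fst (x k)" "\<lambda>k. snd (x k)" "\<lambda>k. fst (x k) + snd (x k)", OF _ lim tendsto_add[OF lim]] x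
    by (simp add: rate_region_def split_def)
qed

lemma achievable_rate_region:
  fixes H1 H2 H4 :: "real^'n^'n"
  assumes ach: "achievable H1 H2 0 H4 P1 P2 R1 R2"
    and inv: "invertible H2" "invertible H4" and psd: "psd (transpose H2 ** H2 - transpose H4 ** H4)"
  shows "(R1, R2) \<in> rate_region H1 H2 H4 P1 P2"
proof -
  obtain f1 f2 g1 g2 where code: "\<And>n. 1 \<le> n \<Longrightarrow> valid_encoder n R1 P1 (f1 n) \<and> valid_encoder n R2 P2 (f2 n) \<and>
                valid_decoder n R1 (g1 n) \<and> valid_decoder n R2 (g2 n)"
    and e1: "(\<lambda>n. error1 H1 H2 n R1 R2 (f1 n) (f2 n) (g1 n)) \<longlonglongrightarrow> 0" (is "?e1 \<longlonglongrightarrow> 0")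
    and e2: "(\<lambda>n. error2 0 H4 n R1 R2 (f1 n) (f2 n) (g2 n)) \<longlonglongrightarrow> 0" (is "?e2 \<longlonglongrightarrow> 0")
    and R: "0 \<le> R1" "0 \<le> R2"
    using ach unfolding achievable_def by blast
  have "(\<lambda>n. ?e1 n + ?e2 n) \<longlonglongrightarrow> 0 + 0" by (intro tendsto_add e1 e2)
  then have "eventually (\<lambda>n. ?e1 n + ?e2 n < 1) sequentially" by (rule order_tendstoD) simp
  then obtain n0 where n0: "\<And>n. n0 \<le> n \<Longrightarrow> ?e1 n + ?e2 n < 1" by (auto simp: eventually_sequentially)
  \<comment> \<open>Discarding the first \<open>n0 + 1\<close> lengths ensures both a nonempty block
    and a sum of error probabilities below 1, as \<open>code_converse\<close> demands.\<close>
  define m where "m k = k + Suc n0" for k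
  have m: "filterlim m at_top sequentially"
    unfolding m_def by (rule filterlim_add_const_nat_at_top)
  have l2: "(\<lambda>k. ln 2 / real (m k)) \<longlonglongrightarrow> 0"
    using m by (intro tendsto_divide_0[OF tendsto_const] filterlim_compose[OF filterlim_at_top_imp_at_infinity[OF filterlim_real_sequentially]])
  have E1: "(\<lambda>k. ?e1 (m k)) \<longlonglongrightarrow> 0" by (rule filterlim_compose[OF e1 m])
  have E2: "(\<lambda>k. ?e2 (m k)) \<longlonglongrightarrow> 0" by (rule filterlim_compose[OF e2 m])
  have "\<exists>S1 S2. psd S1 \<and> psd S2 \<and> trace S1 \<le> P1 \<and> trace S2 \<le> P2 \<and> rate_bounds H1 H2 H4 S1 S2 ((1 - 0) * R1 - 0) ((1 - 0) * R2 - 0) ((1 - 0 - 0) * (R1 + R2) - 0)"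
  proof (rule rate_bounds_limit[where a = "\<lambda>k. (1 - ?e1 (m k)) * R1 - ln 2 / m k" and b = "\<lambda>k. (1 - ?e2 (m k)) * R2 - ln 2 / m k"
        and c = "\<lambda>k. (1 - ?e1 (m k) - ?e2 (m k)) * (R1 + R2) - ln 2 / m k"])
    fix k
    have "1 \<le> m k" "?e1 (m k) + ?e2 (m k) \<le> 1" using n0[of "m k"] by (auto simp: m_def)
    then show "\<exists>S1 S2. psd S1 \<and> psd S2 \<and> trace S1 \<le> P1 \<and> trace S2 \<le> P2 \<and>
      rate_bounds H1 H2 H4 S1 S2 ((1 - ?e1 (m k)) * R1 - ln 2 / m k) ((1 - ?e2 (m k)) * R2 - ln 2 / m k)
        ((1 - ?e1 (m k) - ?e2 (m k)) * (R1 + R2) - ln 2 / m k)"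
      using code[of "m k"] by (intro code_converse inv psd) auto
  qed (intro tendsto_intros E1 E2 l2)+
  then show ?thesis using R by (simp add: rate_region_def)
qed

lemma capacity_region_subset:
  fixes H1 H2 H4 :: "real^'n^'n"
  assumes "invertible H2" "invertible H4" "psd (transpose H2 ** H2 - transpose H4 ** H4)"
  shows "capacity_region H1 H2 0 H4 P1 P2 \<subseteq> rate_region H1 H2 H4 P1 P2"
  unfolding capacity_region_def
  by (intro closure_minimal closed_rate_region) (use achievable_rate_region[OF _ assms] in auto)

section \<open>The direct part\<close>

lemma whitening_ln_det:
  assumes "B ** (mat 1 + S) ** transpose B = (mat 1 :: real^'n^'n)"
  shows "ln \<bar>det B\<bar> = - half_logdet S"
proof -
  have d: "det B \<noteq> 0" using whitening_inverse(1)[OF assms] by (simp add: invertible_det_nz)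
  have "det B * det (mat 1 + S) * det B = 1"
    using arg_cong[OF assms, of det] by (simp add: det_mul)
  then have "det (mat 1 + S) = inverse (\<bar>det B\<bar> ^ 2)" using d by (simp add: field_simps power2_eq_square)
  moreover have "ln (\<bar>det B\<bar> ^ 2) = 2 * ln \<bar>det B\<bar>" using d by (subst ln_realpow) auto
  ultimately show ?thesis using d by (simp only: half_logdet_def ln_inverse)
qed

text \<open>\<open>B\<close> turns the output \<open>G1 u + G2 v + z\<close> of a Gaussian two-user channel into white noise.\<close>

definition whitens :: "real^'n^'n \<Rightarrow> real^'n^'n \<Rightarrow> real^'n^'n \<Rightarrow> bool" where
  "whitens B G1 G2 \<longleftrightarrow> det B \<noteq> 0 \<and> ln \<bar>det B\<bar> = - half_logdet (G1 ** transpose G1 + G2 ** transpose G2) \<and>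
    (\<forall>y. (\<integral>\<^sup>+u. \<integral>\<^sup>+v. ennreal (gauss (y - (G1 *v u + G2 *v v))) \<partial>std_gaussian \<partial>std_gaussian) = ennreal (\<bar>det B\<bar> * gauss (B *v y))) \<and>
    (\<forall>n F. F \<in> borel_measurable (block_space n) \<longrightarrow>
      (\<integral>\<^sup>+u. \<integral>\<^sup>+v. \<integral>\<^sup>+z. F (\<lambda>j\<in>{..<n}. B *v (G1 *v u j + G2 *v v j + z j)) \<partial>noise n \<partial>noise n \<partial>noise n) = (\<integral>\<^sup>+z. F z \<partial>noise n))"

text \<open>Whitening first \<open>I + G2 G2\<^sup>T\<close> and then the remaining covariance works also when \<open>G1\<close> and \<open>G2\<close> are singular.\<close>

lemma ex_whitens:
  fixes G1 G2 :: "real^'n^'n"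
  obtains B where "whitens B G1 G2"
proof -
  obtain B2 :: "real^'n^'n" where B2: "B2 ** (mat 1 + G2 ** transpose G2) ** transpose B2 = mat 1"
    using psd_whitening[OF psd_mult_transpose[of G2]] by metis
  define G where "G = B2 ** G1"
  obtain B1 :: "real^'n^'n" where B1: "B1 ** (mat 1 + G ** transpose G) ** transpose B1 = mat 1"
    using psd_whitening[OF psd_mult_transpose[of G]] by metis
  define B where "B = B1 ** B2"
  have "B ** (mat 1 + (G1 ** transpose G1 + G2 ** transpose G2)) ** transpose B
      = B1 ** (B2 ** (mat 1 + G2 ** transpose G2) ** transpose B2 + G ** transpose G) ** transpose B1"
    by (simp add: B_def G_def matrix_add_ldistrib matrix_add_mult_distrib_right matrix_transpose_mul matrix_mul_assoc add_ac)
  then have B: "B ** (mat 1 + (G1 ** transpose G1 + G2 ** transpose G2)) ** transpose B = mat 1"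
    by (simp add: B2 B1)
  have conv: "(\<integral>\<^sup>+u. \<integral>\<^sup>+v. ennreal (gauss (y - (G1 *v u + G2 *v v))) \<partial>std_gaussian \<partial>std_gaussian) = ennreal (\<bar>det B\<bar> * gauss (B *v y))" for y
  proof -
    have "(\<integral>\<^sup>+v. ennreal (gauss (y - (G1 *v u + G2 *v v))) \<partial>std_gaussian) = ennreal \<bar>det B2\<bar> * ennreal (gauss (B2 *v y - G *v u))" for u
      using gauss_convolution[OF B2, of "y - G1 *v u"]
      by (simp add: diff_diff_eq matrix_vector_mult_diff_distrib G_def matrix_vector_mul_assoc ennreal_mult')
    then show ?thesis
      by (simp add: nn_integral_cmult gauss_convolution[OF B1] B_def det_mul abs_mult matrix_vector_mul_assoc ennreal_mult' mult_ac)
  qed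
  have law: "(\<integral>\<^sup>+u. \<integral>\<^sup>+v. \<integral>\<^sup>+z. F (\<lambda>j\<in>{..<n}. B *v (G1 *v u j + G2 *v v j + z j)) \<partial>noise n \<partial>noise n \<partial>noise n) = (\<integral>\<^sup>+z. F z \<partial>noise n)"
    if F [measurable]: "F \<in> borel_measurable (block_space n)" for n F
  proof -
    have "(\<integral>\<^sup>+v. \<integral>\<^sup>+z. F (\<lambda>j\<in>{..<n}. B *v (G1 *v u j + G2 *v v j + z j)) \<partial>noise n \<partial>noise n)
      = (\<integral>\<^sup>+w. F (\<lambda>j\<in>{..<n}. B1 *v (G *v u j + mat 1 *v w j)) \<partial>noise n)" for u
    proof -
      define F' where "F' w = F (\<lambda>j\<in>{..<n}. B1 *v (G *v u j + w j))" for w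
      have [measurable]: "F' \<in> borel_measurable (block_space n)"
        unfolding F'_def[abs_def] by measurable
      have "(\<integral>\<^sup>+v. \<integral>\<^sup>+z. F' (\<lambda>j\<in>{..<n}. B2 *v (G2 *v v j + mat 1 *v z j)) \<partial>noise n \<partial>noise n) = (\<integral>\<^sup>+w. F' w \<partial>noise n)"
        by (rule nn_integral_noise_sum) (simp_all add: transpose_mat B2 invertible_det_nz)
      moreover have "F' (\<lambda>j\<in>{..<n}. B2 *v (G2 *v v j + mat 1 *v z j)) = F (\<lambda>j\<in>{..<n}. B *v (G1 *v u j + G2 *v v j + z j))" for v z
        unfolding F'_def
        by (rule arg_cong[of _ _ F]) (auto simp: B_def G_def matrix_vector_right_distrib matrix_vector_mul_assoc matrix_mul_assoc add_ac)
      ultimately show ?thesis by (simp add: F'_def)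
    qed
    moreover have "(\<integral>\<^sup>+u. \<integral>\<^sup>+w. F (\<lambda>j\<in>{..<n}. B1 *v (G *v u j + mat 1 *v w j)) \<partial>noise n \<partial>noise n) = (\<integral>\<^sup>+z. F z \<partial>noise n)"
      by (rule nn_integral_noise_sum) (simp_all add: transpose_mat B1 invertible_det_nz)
    ultimately show ?thesis by simp
  qed
  have "whitens B G1 G2"
    using conv law whitening_ln_det[OF B] whitening_inverse(1)[OF B] by (simp add: whitens_def invertible_det_nz)
  then show ?thesis by (rule that)
qed

section \<open>Exponential tail bounds for the norm of white blocks\<close>

lemma nn_integral_exp_norm_square:
  assumes a: "a < 1 / 2"
  shows "(\<integral>\<^sup>+z. ennreal (exp (a * (norm z)\<^sup>2)) \<partial>(std_gaussian :: (real^'n) measure))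
    = ennreal (exp (- (real CARD('n) / 2) * ln (1 - 2 * a)))"
proof -
  \<comment> \<open>The factor \<open>exp (a * (norm z)\<^sup>2)\<close> only rescales the Gaussian
    exponent by \<open>1 - 2 * a\<close>, so the integral is the Jacobian of a dilation by
    \<open>c\<close>.\<close>
  define c where "c = sqrt (1 - 2 * a)"
  have c: "0 < c" "c\<^sup>2 = 1 - 2 * a" using a by (simp_all add: c_def)
  define C :: "real^'n^'n" where "C = mat c"
  have Cz: "C *v z = c *\<^sub>R z" for z
    by (simp add: C_def vec_eq_iff matrix_vector_mult_def mat_def if_distrib[of "\<lambda>x. x * _"] cong: if_cong)
  have dC: "det C = c ^ CARD('n)"
    unfolding C_def by (subst det_diagonal) (auto simp: mat_def)
  have dC0: "det C > 0" using c by (simp add: dC)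
  have lnc: "ln (det C) = real CARD('n) / 2 * ln (1 - 2 * a)"
  proof -
    have "ln (1 - 2 * a) = 2 * ln c" using c(1) by (simp add: ln_realpow flip: c(2))
    then show ?thesis using c by (simp add: dC ln_realpow)
  qed
  have g: "gauss (C *v z) = gauss z * exp (a * (norm z)\<^sup>2)" for z :: "real^'n"
  proof -
    have "- (norm z)\<^sup>2 / 2 + a * (norm z)\<^sup>2 = - (norm (C *v z))\<^sup>2 / 2"
      by (simp add: Cz power_mult_distrib c(2) algebra_simps)
    then show ?thesis unfolding gauss_def mult.assoc exp_add[symmetric] by simp
  qed
  have "(\<integral>\<^sup>+z. ennreal (exp (a * (norm z)\<^sup>2)) \<partial>(std_gaussian :: (real^'n) measure))
     = (\<integral>\<^sup>+z. ennreal (gauss (C *v z + 0)) \<partial>lborel)"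
    by (subst nn_integral_std_gaussian) (auto simp: g ennreal_mult')
  also have "\<dots> = ennreal (1 / det C) * (\<integral>\<^sup>+z. ennreal \<bar>det C\<bar> * ennreal (gauss (C *v z + 0)) \<partial>lborel)"
    using dC0 by (subst nn_integral_cmult) (auto simp: mult.assoc[symmetric] ennreal_mult'[symmetric])
  also have "\<dots> = ennreal (1 / det C)"
    using dC0 by (subst nn_integral_lborel_matrix[where f = "\<lambda>z. ennreal (gauss z)"]) (auto simp: nn_integral_gauss invertible_det_nz)
  also have "1 / det C = exp (- (real CARD('n) / 2) * ln (1 - 2 * a))"
  proof -
    have "1 / det C = exp (- ln (det C))" using dC0 by (simp add: exp_minus inverse_eq_divide)
    then show ?thesis by (simp add: lnc)
  qed
  finally show ?thesis .
qed

lemma chernoff_base: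
  assumes "0 < \<delta>"
  obtains t \<rho> where "0 < t" "t < 1 / 2" "0 < \<rho>" "\<rho> < 1"
    "\<And>a. \<bar>a\<bar> = t \<Longrightarrow> (\<integral>\<^sup>+z. ennreal (exp (a * ((norm z)\<^sup>2 - real CARD('n)) - t * \<delta>)) \<partial>(std_gaussian :: (real^'n) measure)) \<le> ennreal \<rho>"
proof -
  define d where "d = real CARD('n)"
  have d: "0 < d" by (simp add: d_def)
  \<comment> \<open>The bound 1/4 keeps \<open>2 * \<bar>a\<bar>\<close> within the range of the
    quadratic estimate of the logarithm. The resulting error \<open>4 * d * t\<^sup>2\<close> is at
    most \<open>t * \<delta> / 2\<close> by the choice \<open>\<delta> / (8 * d)\<close>, so half of
    the gain \<open>t * \<delta>\<close> survives in \<open>\<rho>\<close>.\<close>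
  define t where "t = min (1 / 4) (\<delta> / (8 * d))"
  have t: "0 < t" "t \<le> 1 / 4" using assms d by (auto simp: t_def)
  have "t \<le> \<delta> / (8 * d)" by (simp add: t_def)
  then have t2: "4 * d * t \<le> \<delta> / 2" using d by (simp add: field_simps)
  define \<rho> where "\<rho> = exp (- (t * \<delta> / 2))"
  have le: "(\<integral>\<^sup>+z. ennreal (exp (a * ((norm z)\<^sup>2 - real CARD('n)) - t * \<delta>)) \<partial>(std_gaussian :: (real^'n) measure)) \<le> ennreal \<rho>"
    if a: "\<bar>a\<bar> = t" for a
  proof -
    have a2: "a < 1 / 2" using a t by auto
    have "(\<integral>\<^sup>+z. ennreal (exp (a * ((norm z)\<^sup>2 - real CARD('n)) - t * \<delta>)) \<partial>(std_gaussian :: (real^'n) measure))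
      = (\<integral>\<^sup>+z. ennreal (exp (- (a * d) - t * \<delta>)) * ennreal (exp (a * (norm z)\<^sup>2)) \<partial>(std_gaussian :: (real^'n) measure))"
      by (intro nn_integral_cong) (simp add: d_def ennreal_mult'[symmetric] exp_add[symmetric] algebra_simps)
    also have "\<dots> = ennreal (exp (- (a * d) - t * \<delta>) * exp (- (d / 2) * ln (1 - 2 * a)))"
      by (subst nn_integral_cmult) (auto simp: nn_integral_exp_norm_square[OF a2] d_def ennreal_mult')
    also have "exp (- (a * d) - t * \<delta>) * exp (- (d / 2) * ln (1 - 2 * a)) = exp (- (a * d) - t * \<delta> - (d / 2) * ln (1 - 2 * a))"
      by (simp flip: exp_add)
    also have "\<dots> \<le> \<rho>"
    proof -
      have "\<bar>ln (1 + (- 2 * a)) - (- 2 * a)\<bar> \<le> 2 * (- 2 * a)\<^sup>2"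
        using a t by (intro abs_ln_one_plus_x_minus_x_bound) auto
      moreover have "(- 2 * a)\<^sup>2 = 4 * t\<^sup>2" by (simp add: power_mult_distrib flip: a)
      ultimately have "- ln (1 - 2 * a) \<le> 2 * a + 8 * t\<^sup>2" by (simp add: abs_le_iff)
      then have "(d / 2) * (- ln (1 - 2 * a)) \<le> (d / 2) * (2 * a + 8 * t\<^sup>2)"
        using d by (intro mult_left_mono) auto
      moreover have "4 * d * t * t \<le> \<delta> / 2 * t" using t2 t by (intro mult_right_mono) auto
      ultimately have "- (a * d) - t * \<delta> - (d / 2) * ln (1 - 2 * a) \<le> - (t * \<delta> / 2)"
        by (simp add: algebra_simps power2_eq_square)
      then show ?thesis by (simp add: \<rho>_def)
    qed
    finally show ?thesis by (simp add: ennreal_leI)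
  qed
  have "0 < t * \<delta>" using t assms by simp
  then show ?thesis using t le by (intro that[of t \<rho>]) (auto simp: \<rho>_def)
qed

definition norm_excess :: "nat \<Rightarrow> (nat \<Rightarrow> real^'n) \<Rightarrow> real" where
  "norm_excess n z = (\<Sum>j<n. (norm (z j))\<^sup>2 - real CARD('n))"

lemma norm_excess_restrict [simp]: "norm_excess n (restrict z {..<n}) = norm_excess n z"
  by (simp add: norm_excess_def)

lemma norm_excess_measurable [measurable (raw)]:
  assumes [measurable]: "\<And>j. j < n \<Longrightarrow> (\<lambda>x. z x j) \<in> borel_measurable M"
  shows "(\<lambda>x. norm_excess n (z x)) \<in> borel_measurable M"
  unfolding norm_excess_def by measurable

lemma borel_measurable_of_bool [measurable (raw)]:
  "Measurable.pred M P \<Longrightarrow> (\<lambda>x. of_bool (P x) :: ennreal) \<in> borel_measurable M"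
  unfolding of_bool_def by measurable

text \<open>The exponential Markov inequality factorises over the channel uses, so the bound for one
  use is raised to the power \<open>n\<close>. The values \<open>t\<close> and \<open>- t\<close> of
  the exponent give the upper and the lower tail with the same \<open>\<rho>\<close>.\<close>

lemma norm_excess_tails:
  assumes "0 < \<delta>"
  obtains \<rho> where "0 < \<rho>" "\<rho> < 1"
    "\<And>n. (\<integral>\<^sup>+(z :: nat \<Rightarrow> real^'n). of_bool (n * \<delta> \<le> norm_excess n z) \<partial>noise n) \<le> ennreal (\<rho> ^ n)"
    "\<And>n. (\<integral>\<^sup>+(z :: nat \<Rightarrow> real^'n). of_bool (norm_excess n z \<le> - (n * \<delta>)) \<partial>noise n) \<le> ennreal (\<rho> ^ n)"
proof -
  obtain t \<rho> where t: "0 < t" and \<rho>: "0 < \<rho>" "\<rho> < 1"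
    and le: "\<And>a. \<bar>a\<bar> = t \<Longrightarrow> (\<integral>\<^sup>+z. ennreal (exp (a * ((norm z)\<^sup>2 - real CARD('n)) - t * \<delta>)) \<partial>(std_gaussian :: (real^'n) measure)) \<le> ennreal \<rho>"
    using chernoff_base[OF assms] by metis
  have tail: "(\<integral>\<^sup>+(z :: nat \<Rightarrow> real^'n). of_bool (t * (n * \<delta>) \<le> a * norm_excess n z) \<partial>noise n) \<le> ennreal (\<rho> ^ n)"
    if a: "\<bar>a\<bar> = t" for a n
  proof -
    let ?h = "\<lambda>z :: real^'n. ennreal (exp (a * ((norm z)\<^sup>2 - real CARD('n)) - t * \<delta>))"
    have "(\<integral>\<^sup>+(z :: nat \<Rightarrow> real^'n). of_bool (t * (n * \<delta>) \<le> a * norm_excess n z) \<partial>noise n) \<le> (\<integral>\<^sup>+z. (\<Prod>j<n. ?h (z j)) \<partial>noise n)"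
    proof (rule nn_integral_mono)
      fix z :: "nat \<Rightarrow> real^'n"
      have "(\<Prod>j<n. ?h (z j)) = ennreal (exp (a * norm_excess n z - t * (n * \<delta>)))"
        by (simp add: norm_excess_def prod_ennreal sum_subtractf sum_distrib_left algebra_simps flip: exp_sum)
      moreover have "1 \<le> exp (a * norm_excess n z - t * (n * \<delta>))" if "t * (n * \<delta>) \<le> a * norm_excess n z"
        using that by simp
      ultimately show "of_bool (t * (n * \<delta>) \<le> a * norm_excess n z) \<le> (\<Prod>j<n. ?h (z j))"
        by (auto simp: of_bool_def simp del: one_le_exp_iff)
    qed
    also have "\<dots> = (\<Prod>j<n. \<integral>\<^sup>+z. ?h z \<partial>std_gaussian)"
      by (rule nn_integral_noise_prod) measurable
    also have "\<dots> \<le> ennreal (\<rho> ^ n)"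
    proof -
      obtain q where "0 \<le> q" "q \<le> \<rho>" "(\<integral>\<^sup>+z. ?h z \<partial>std_gaussian) = ennreal q"
        using le[OF a] \<rho> by (auto simp: le_ennreal_iff)
      then show ?thesis by (simp add: ennreal_power power_mono ennreal_leI)
    qed
    finally show ?thesis .
  qed
  have neg: "t * (n * \<delta>) \<le> - t * x \<longleftrightarrow> x \<le> - (n * \<delta>)" for x and n :: nat
  proof -
    have "t * (n * \<delta>) \<le> - t * x \<longleftrightarrow> t * (n * \<delta>) \<le> t * (- x)" by simp
    also have "\<dots> \<longleftrightarrow> n * \<delta> \<le> - x" using t by (rule mult_le_cancel_left_pos)
    finally show ?thesis by linarith
  qed
  show ?thesis
    by (rule that[OF \<rho>]) (use tail[of t] tail[of "- t", unfolded neg] t in auto)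
qed

section \<open>Threshold test on the information density\<close>

text \<open>Up to the constant \<open>n ln |det B|\<close>, the sum is twice the information density of the block \<open>s\<close> and the output \<open>y\<close>.\<close>

definition typical :: "nat \<Rightarrow> real \<Rightarrow> real^'n^'n \<Rightarrow> (nat \<Rightarrow> real^'n) \<Rightarrow> (nat \<Rightarrow> real^'n) \<Rightarrow> bool" where
  "typical n \<delta> B y s \<longleftrightarrow> - (2 * n * \<delta>) \<le> (\<Sum>j<n. (norm (B *v y j))\<^sup>2 - (norm (y j - s j))\<^sup>2)"

lemma typical_cong:
  "(\<And>j. j < n \<Longrightarrow> y j = y' j) \<Longrightarrow> (\<And>j. j < n \<Longrightarrow> s j = s' j) \<Longrightarrow> typical n \<delta> B y s = typical n \<delta> B y' s'"
  unfolding typical_def by (simp cong: sum.cong_simp)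

lemma typical_measurable [measurable (raw)]:
  assumes [measurable]: "\<And>j. j < n \<Longrightarrow> (\<lambda>x. y x j) \<in> borel_measurable M" "\<And>j. j < n \<Longrightarrow> (\<lambda>x. s x j) \<in> borel_measurable M"
  shows "Measurable.pred M (\<lambda>x. typical n \<delta> B (y x) (s x))"
  unfolding typical_def by measurable

text \<open>The product equals the exponential of \<open>n * \<delta>\<close> plus half the tested
  sum, hence is at least 1 whenever the test accepts. It turns an event about the whole block into a
  product over channel uses.\<close>

lemma of_bool_typical_le:
  fixes y s :: "nat \<Rightarrow> real^'n"
  shows "of_bool (typical n \<delta> B y s)
     \<le> (\<Prod>j<n. ennreal (exp \<delta> / gauss (B *v y j)) * ennreal (gauss (y j - s j)))"
proof -
  have g: "exp \<delta> / gauss (B *v y j) * gauss (y j - s j) = exp (\<delta> + ((norm (B *v y j))\<^sup>2 - (norm (y j - s j))\<^sup>2) / 2)" for j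
  proof -
    have "\<delta> + ((norm (B *v y j))\<^sup>2 - (norm (y j - s j))\<^sup>2) / 2 = \<delta> - (- (norm (B *v y j))\<^sup>2 / 2) + - (norm (y j - s j))\<^sup>2 / 2"
      by (simp add: diff_divide_distrib)
    then show ?thesis unfolding gauss_def by (simp only: exp_add exp_diff) simp
  qed
  have "(\<Prod>j<n. ennreal (exp \<delta> / gauss (B *v y j)) * ennreal (gauss (y j - s j)))
      = (\<Prod>j<n. ennreal (exp (\<delta> + ((norm (B *v y j))\<^sup>2 - (norm (y j - s j))\<^sup>2) / 2)))"
    by (rule prod.cong[OF refl]) (simp only: g[symmetric] ennreal_mult' gauss_nonneg divide_nonneg_nonneg exp_ge_zero)
  also have "\<dots> = ennreal (exp (n * \<delta> + (\<Sum>j<n. (norm (B *v y j))\<^sup>2 - (norm (y j - s j))\<^sup>2) / 2))"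
    by (simp add: prod_ennreal sum.distrib sum_divide_distrib flip: exp_sum)
  finally have eq: "(\<Prod>j<n. ennreal (exp \<delta> / gauss (B *v y j)) * ennreal (gauss (y j - s j)))
     = ennreal (exp (n * \<delta> + (\<Sum>j<n. (norm (B *v y j))\<^sup>2 - (norm (y j - s j))\<^sup>2) / 2))" .
  have "1 \<le> exp (n * \<delta> + (\<Sum>j<n. (norm (B *v y j))\<^sup>2 - (norm (y j - s j))\<^sup>2) / 2)" if "typical n \<delta> B y s"
    using that by (simp add: typical_def)
  then show ?thesis unfolding eq by (auto simp: of_bool_def simp del: one_le_exp_iff)
qed

text \<open>Averaging the likelihood of \<open>y\<close> over fresh codewords gives the output
  density \<open>\<bar>det B\<bar> * gauss (B *v y)\<close>. Its Gaussian factor cancels the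
  denominator from \<open>of_bool_typical_le\<close>, so the bound does not depend on
  \<open>y\<close> and the Jacobian supplies the rate.\<close>

lemma hit_bound:
  fixes G1 G2 B :: "real^'n^'n"
  assumes w: "whitens B G1 G2"
  shows "(\<integral>\<^sup>+u. \<integral>\<^sup>+v. of_bool (typical n \<delta> B y (\<lambda>j. G1 *v u j + G2 *v v j)) \<partial>noise n \<partial>noise n)
    \<le> ennreal (exp (n * (\<delta> - half_logdet (G1 ** transpose G1 + G2 ** transpose G2))))"
proof -
  have dB: "det B \<noteq> 0" using w by (simp add: whitens_def)
  define k where "k j = ennreal (exp \<delta> / gauss (B *v y j))" for j
  have "(\<integral>\<^sup>+u. \<integral>\<^sup>+v. of_bool (typical n \<delta> B y (\<lambda>j. G1 *v u j + G2 *v v j)) \<partial>noise n \<partial>noise n)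
    \<le> (\<integral>\<^sup>+u. \<integral>\<^sup>+v. (\<Prod>j<n. k j * ennreal (gauss (y j - (G1 *v u j + G2 *v v j)))) \<partial>noise n \<partial>noise n)"
    unfolding k_def by (intro nn_integral_mono of_bool_typical_le)
  also have "\<dots> = (\<integral>\<^sup>+u. (\<Prod>j<n. \<integral>\<^sup>+v. k j * ennreal (gauss (y j - (G1 *v u j + G2 *v v))) \<partial>std_gaussian) \<partial>noise n)"
    by (intro nn_integral_cong nn_integral_noise_prod) measurable
  also have "\<dots> = (\<Prod>j<n. \<integral>\<^sup>+u. \<integral>\<^sup>+v. k j * ennreal (gauss (y j - (G1 *v u + G2 *v v))) \<partial>std_gaussian \<partial>std_gaussian)"
    by (rule nn_integral_noise_prod) measurable
  also have "\<dots> = (\<Prod>j<n. k j * ennreal (\<bar>det B\<bar> * gauss (B *v y j)))"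
    using w by (intro prod.cong refl) (simp add: nn_integral_cmult whitens_def)
  also have "\<dots> = (\<Prod>j<n. ennreal (exp (\<delta> + ln \<bar>det B\<bar>)))"
    using dB by (intro prod.cong refl) (simp add: k_def exp_add ennreal_mult'[symmetric])
  also have "\<dots> = ennreal (exp (n * (\<delta> + ln \<bar>det B\<bar>)))"
    by (simp add: prod_ennreal exp_of_nat_mult ennreal_power)
  finally show ?thesis using w by (simp add: whitens_def)
qed

lemma nn_integral_noise3:
  fixes f :: "(nat \<Rightarrow> real^'n) \<Rightarrow> (nat \<Rightarrow> real^'n) \<Rightarrow> (nat \<Rightarrow> real^'n) \<Rightarrow> ennreal"
  assumes f: "(\<lambda>p. f (fst p) (fst (snd p)) (snd (snd p))) \<in> borel_measurable (noise n \<Otimes>\<^sub>M (noise n \<Otimes>\<^sub>M noise n))"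
  shows "(\<integral>\<^sup>+u. \<integral>\<^sup>+v. \<integral>\<^sup>+z. f u v z \<partial>noise n \<partial>noise n \<partial>noise n)
     = (\<integral>\<^sup>+p. f (fst p) (fst (snd p)) (snd (snd p)) \<partial>(noise n \<Otimes>\<^sub>M (noise n \<Otimes>\<^sub>M noise n)))"
proof -
  interpret P: prob_space "noise n \<Otimes>\<^sub>M (noise n :: (nat \<Rightarrow> real^'n) measure)"
    by (intro prob_space_pair prob_space_noise)
  have "(\<integral>\<^sup>+v. \<integral>\<^sup>+z. f u v z \<partial>noise n \<partial>noise n) = (\<integral>\<^sup>+q. f u (fst q) (snd q) \<partial>(noise n \<Otimes>\<^sub>M noise n))" if "u \<in> space (noise n)" for u
    using measurable_compose[OF measurable_Pair1'[OF that] f]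
    by (subst noise.nn_integral_fst[symmetric]) auto
  then show ?thesis
    by (subst P.nn_integral_fst[OF f, symmetric]) (auto intro: nn_integral_cong)
qed

lemma nn_integral_noise3_add:
  fixes f g :: "(nat \<Rightarrow> real^'n) \<Rightarrow> (nat \<Rightarrow> real^'n) \<Rightarrow> (nat \<Rightarrow> real^'n) \<Rightarrow> ennreal"
  assumes f: "(\<lambda>p. f (fst p) (fst (snd p)) (snd (snd p))) \<in> borel_measurable (noise n \<Otimes>\<^sub>M (noise n \<Otimes>\<^sub>M noise n))"
    and g: "(\<lambda>p. g (fst p) (fst (snd p)) (snd (snd p))) \<in> borel_measurable (noise n \<Otimes>\<^sub>M (noise n \<Otimes>\<^sub>M noise n))"
  shows "(\<integral>\<^sup>+u. \<integral>\<^sup>+v. \<integral>\<^sup>+z. f u v z + g u v z \<partial>noise n \<partial>noise n \<partial>noise n)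
     = (\<integral>\<^sup>+u. \<integral>\<^sup>+v. \<integral>\<^sup>+z. f u v z \<partial>noise n \<partial>noise n \<partial>noise n) + (\<integral>\<^sup>+u. \<integral>\<^sup>+v. \<integral>\<^sup>+z. g u v z \<partial>noise n \<partial>noise n \<partial>noise n)"
  by (subst (1 2 3) nn_integral_noise3) (use f g in \<open>auto intro!: nn_integral_add borel_measurable_add\<close>)

text \<open>For the true codewords, \<open>y - s\<close> is the noise and \<open>B *v y\<close> is
  again white, so the tested sum is a difference of two values of \<open>norm_excess\<close>. If it
  falls below \<open>- 2 n \<delta>\<close>, one of them deviates by at least
  \<open>n \<delta>\<close>; each has probability at most \<open>\<rho> ^ n\<close>, whatever the
  matrices are.\<close>

lemma miss_bound:
  assumes "0 < \<delta>"
  obtains \<rho> where "0 < \<rho>" "\<rho> < 1"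
    "\<And>n B G1 (G2 :: real^'n^'n). whitens B G1 G2 \<Longrightarrow>
      (\<integral>\<^sup>+u. \<integral>\<^sup>+v. \<integral>\<^sup>+z. of_bool (\<not> typical n \<delta> B (\<lambda>j. G1 *v u j + G2 *v v j + z j) (\<lambda>j. G1 *v u j + G2 *v v j)) \<partial>noise n \<partial>noise n \<partial>noise n)
        \<le> ennreal (2 * \<rho> ^ n)"
proof -
  obtain \<rho> where \<rho>: "0 < \<rho>" "\<rho> < 1"
    and tails: "\<And>n. (\<integral>\<^sup>+(z :: nat \<Rightarrow> real^'n). of_bool (n * \<delta> \<le> norm_excess n z) \<partial>noise n) \<le> ennreal (\<rho> ^ n)"
      "\<And>n. (\<integral>\<^sup>+(z :: nat \<Rightarrow> real^'n). of_bool (norm_excess n z \<le> - (n * \<delta>)) \<partial>noise n) \<le> ennreal (\<rho> ^ n)"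
    by (rule norm_excess_tails[OF assms]) (rule that)
  have "(\<integral>\<^sup>+u. \<integral>\<^sup>+v. \<integral>\<^sup>+z. of_bool (\<not> typical n \<delta> B (\<lambda>j. G1 *v u j + G2 *v v j + z j) (\<lambda>j. G1 *v u j + G2 *v v j)) \<partial>noise n \<partial>noise n \<partial>noise n)
      \<le> ennreal (2 * \<rho> ^ n)" if w: "whitens B G1 G2" for n and B G1 G2 :: "real^'n^'n"
  proof -
    let ?D = "\<lambda>u v z. of_bool (norm_excess n (\<lambda>j. B *v (G1 *v u j + G2 *v v j + z j)) \<le> - (n * \<delta>)) :: ennreal"
    let ?U = "\<lambda>(u :: nat \<Rightarrow> real^'n) (v :: nat \<Rightarrow> real^'n) (z :: nat \<Rightarrow> real^'n). of_bool (n * \<delta> \<le> norm_excess n z) :: ennreal"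
    have "(\<integral>\<^sup>+u. \<integral>\<^sup>+v. \<integral>\<^sup>+z. of_bool (\<not> typical n \<delta> B (\<lambda>j. G1 *v u j + G2 *v v j + z j) (\<lambda>j. G1 *v u j + G2 *v v j)) \<partial>noise n \<partial>noise n \<partial>noise n)
      \<le> (\<integral>\<^sup>+u. \<integral>\<^sup>+v. \<integral>\<^sup>+z. ?D u v z + ?U u v z \<partial>noise n \<partial>noise n \<partial>noise n)"
    proof (intro nn_integral_mono)
      fix u v z :: "nat \<Rightarrow> real^'n"
      have "norm_excess n (\<lambda>j. B *v (G1 *v u j + G2 *v v j + z j)) \<le> - (n * \<delta>) \<or> n * \<delta> \<le> norm_excess n z"
        if "\<not> typical n \<delta> B (\<lambda>j. G1 *v u j + G2 *v v j + z j) (\<lambda>j. G1 *v u j + G2 *v v j)"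
        using that unfolding typical_def norm_excess_def by (simp add: sum_subtractf) linarith
      then show "of_bool (\<not> typical n \<delta> B (\<lambda>j. G1 *v u j + G2 *v v j + z j) (\<lambda>j. G1 *v u j + G2 *v v j)) \<le> ?D u v z + ?U u v z"
        by (auto simp: of_bool_def)
    qed
    also have "\<dots> = (\<integral>\<^sup>+u. \<integral>\<^sup>+v. \<integral>\<^sup>+z. ?D u v z \<partial>noise n \<partial>noise n \<partial>noise n) + (\<integral>\<^sup>+u. \<integral>\<^sup>+v. \<integral>\<^sup>+z. ?U u v z \<partial>noise n \<partial>noise n \<partial>noise n)"
      by (rule nn_integral_noise3_add) measurable
    also have "(\<integral>\<^sup>+u. \<integral>\<^sup>+v. \<integral>\<^sup>+z. ?D u v z \<partial>noise n \<partial>noise n \<partial>noise n) = (\<integral>\<^sup>+(z :: nat \<Rightarrow> real^'n). of_bool (norm_excess n z \<le> - (n * \<delta>)) \<partial>noise n)"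
    proof -
      have "(\<lambda>z :: nat \<Rightarrow> real^'n. of_bool (norm_excess n z \<le> - (n * \<delta>)) :: ennreal) \<in> borel_measurable (block_space n)"
        by measurable
      from w[unfolded whitens_def, THEN conjunct2, THEN conjunct2, THEN conjunct2, rule_format, OF this] show ?thesis by simp
    qed
    also have "\<dots> + (\<integral>\<^sup>+u. \<integral>\<^sup>+v. \<integral>\<^sup>+z. ?U u v z \<partial>noise n \<partial>noise n \<partial>noise n) \<le> ennreal (\<rho> ^ n) + ennreal (\<rho> ^ n)"
      using tails by (intro add_mono) (simp_all add: noise.emeasure_space_1)
    finally show ?thesis using \<rho> by (simp flip: ennreal_plus)
  qed
  then show ?thesis by (rule that[OF \<rho>])
qed

section \<open>Random codebooks\<close>

interpretation noises: product_sigma_finite "\<lambda>_::nat. noise n" for n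
  by standard (rule noise.sigma_finite_countable)

text \<open>The blocks are white; shaping by a covariance factor is deferred to the encoders, so
  that all components have the same law and may also stand for receiver noise.\<close>

definition codebooks :: "nat set \<Rightarrow> nat \<Rightarrow> (nat \<Rightarrow> nat \<Rightarrow> real^'n) measure" where
  "codebooks I n = PiM I (\<lambda>_. noise n)"

lemma prob_space_codebooks: "prob_space (codebooks I n)"
  unfolding codebooks_def by (intro prob_space_PiM prob_space_noise)

interpretation codebooks: prob_space "codebooks I n" for I n
  by (rule prob_space_codebooks)

lemma codebooks_component [measurable]: "i \<in> I \<Longrightarrow> (\<lambda>c. c i) \<in> measurable (codebooks I n) (noise n)"
  unfolding codebooks_def by simp

lemma codebooks_update [measurable]: "i \<in> I \<Longrightarrow> (\<lambda>(c, u). c(i := u)) \<in> measurable (codebooks (I - {i}) n \<Otimes>\<^sub>M noise n) (codebooks I n)"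
  using measurable_add_dim[of i "I - {i}" "\<lambda>_. noise n"] by (simp add: codebooks_def insert_absorb)

text \<open>Independence in the form needed for random coding: a chosen component is drawn afresh
  while all others stay frozen.\<close>

lemma nn_integral_codebooks_update:
  assumes I: "finite I" "i \<in> I" and f: "f \<in> borel_measurable (codebooks I n)"
  shows "(\<lambda>c. \<integral>\<^sup>+u. f (c(i := u)) \<partial>noise n) \<in> borel_measurable (codebooks (I - {i}) n)"
    and "(\<integral>\<^sup>+c. f c \<partial>codebooks I n) = (\<integral>\<^sup>+c. \<integral>\<^sup>+u. f (c(i := u)) \<partial>noise n \<partial>codebooks (I - {i}) n)"
proof -
  show "(\<lambda>c. \<integral>\<^sup>+u. f (c(i := u)) \<partial>noise n) \<in> borel_measurable (codebooks (I - {i}) n)"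
    using measurable_compose[OF codebooks_update[OF I(2)] f]
    by (intro noise.borel_measurable_nn_integral) (simp add: split_def)
  have *: "insert i (I - {i}) = I" using I by auto
  show "(\<integral>\<^sup>+c. f c \<partial>codebooks I n) = (\<integral>\<^sup>+c. \<integral>\<^sup>+u. f (c(i := u)) \<partial>noise n \<partial>codebooks (I - {i}) n)"
    using noises.product_nn_integral_insert[of "I - {i}" i f n] I f unfolding codebooks_def * by simp
qed

lemma nn_integral_codebooks_le1:
  fixes f :: "(nat \<Rightarrow> nat \<Rightarrow> real^'n) \<Rightarrow> ennreal"
  assumes "finite I" "i \<in> I" "f \<in> borel_measurable (codebooks I n)"
    and "\<And>c. (\<integral>\<^sup>+u. f (c(i := u)) \<partial>noise n) \<le> \<beta>"
  shows "(\<integral>\<^sup>+c. f c \<partial>codebooks I n) \<le> \<beta>"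
proof -
  have "(\<integral>\<^sup>+c. f c \<partial>codebooks I n) \<le> (\<integral>\<^sup>+(c :: nat \<Rightarrow> nat \<Rightarrow> real^'n). \<beta> \<partial>codebooks (I - {i}) n)"
    unfolding nn_integral_codebooks_update(2)[OF assms(1-3)] by (intro nn_integral_mono assms(4))
  then show ?thesis by (simp add: codebooks.emeasure_space_1)
qed

lemma nn_integral_codebooks_le2:
  assumes "finite I" "i \<in> I" "j \<in> I" "i \<noteq> j" "f \<in> borel_measurable (codebooks I n)"
    and "\<And>c. (\<integral>\<^sup>+u. \<integral>\<^sup>+v. f (c(i := u, j := v)) \<partial>noise n \<partial>noise n) \<le> \<beta>"
  shows "(\<integral>\<^sup>+c. f c \<partial>codebooks I n) \<le> \<beta>"
  unfolding nn_integral_codebooks_update(2)[OF assms(1,3,5)]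
  by (rule nn_integral_codebooks_le1[where i = i]) (use assms nn_integral_codebooks_update(1)[OF assms(1,3,5)] in auto)

lemma nn_integral_codebooks_le3:
  assumes "finite I" "i \<in> I" "j \<in> I" "k \<in> I" "i \<noteq> j" "i \<noteq> k" "j \<noteq> k" "f \<in> borel_measurable (codebooks I n)"
    and "\<And>c. (\<integral>\<^sup>+u. \<integral>\<^sup>+v. \<integral>\<^sup>+w. f (c(i := u, j := v, k := w)) \<partial>noise n \<partial>noise n \<partial>noise n) \<le> \<beta>"
  shows "(\<integral>\<^sup>+c. f c \<partial>codebooks I n) \<le> \<beta>"
  unfolding nn_integral_codebooks_update(2)[OF assms(1,4,8)]
  by (rule nn_integral_codebooks_le2[where i = i and j = j]) (use assms nn_integral_codebooks_update(1)[OF assms(1,4,8)] in auto)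

text \<open>The default 0 only keeps the answer inside the message set. If no candidate is accepted
  then the true one is rejected as well, so \<open>first_ok_neq\<close> holds in that case
  too.\<close>

definition first_ok :: "nat \<Rightarrow> (nat \<Rightarrow> bool) \<Rightarrow> nat" where
  "first_ok N ok = (if \<exists>m<N. ok m then LEAST m. m < N \<and> ok m else 0)"

lemma first_ok_less: "0 < N \<Longrightarrow> first_ok N ok < N"
  using LeastI_ex[of "\<lambda>m. m < N \<and> ok m"] by (simp add: first_ok_def)

lemma first_ok_neq: "first_ok N ok \<noteq> m \<Longrightarrow> m < N \<Longrightarrow> \<not> ok m \<or> (\<exists>a<N. a \<noteq> m \<and> ok a)"
  unfolding first_ok_def by (metis (mono_tags, lifting) LeastI)

lemma first_ok_decoder:
  assumes [measurable]: "\<And>m. Measurable.pred (block_space n) (\<lambda>y. ok y m)"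
  shows "valid_decoder n R (\<lambda>y. first_ok (num_messages n R) (ok y))"
proof -
  have "(\<lambda>y. first_ok (num_messages n R) (ok y)) \<in> measurable (block_space n) (count_space UNIV)"
    unfolding first_ok_def by measurable
  then have "(\<lambda>y. first_ok (num_messages n R) (ok y)) -` {k} \<inter> space (block_space n) \<in> sets (block_space n)" for k
    by (rule measurable_sets) simp
  then show ?thesis
    unfolding valid_decoder_def
    by (subst measurable_count_space_eq2) (auto simp: first_ok_less num_messages_pos)
qed

section \<open>Power of a random codebook\<close>

lemma nn_integral_noise_energy:
  fixes A :: "real^'n^'n"
  shows "(\<integral>\<^sup>+u. ennreal (\<Sum>j<n. (norm (A *v u j))\<^sup>2) \<partial>noise n) = ennreal (n * trace (A ** transpose A))"
proof -
  have b: "has_bochner_integral (noise n) (\<lambda>u. \<Sum>j<n. (norm (A *v u j))\<^sup>2) (\<Sum>j<n. trace (A ** transpose A))"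
  proof (intro has_bochner_integral_sum)
    fix j assume "j \<in> {..<n}"
    then show "has_bochner_integral (noise n) (\<lambda>u. (norm (A *v u j))\<^sup>2) (trace (A ** transpose A))"
      using has_bochner_integral_noise_component[OF std_gaussian_norm_square[of A 0], of j n] by simp
  qed
  then show ?thesis
    by (subst nn_integral_eq_integral) (auto simp: has_bochner_integral_iff sum_nonneg)
qed

text \<open>With \<open>I\<close> the indices of one codebook and codewords shaped by
  \<open>A\<close>, this is the average that \<open>valid_encoder\<close> compares with the
  power.\<close>

definition codebook_power :: "nat set \<Rightarrow> nat \<Rightarrow> real^'n^'n \<Rightarrow> (nat \<Rightarrow> nat \<Rightarrow> real^'n) \<Rightarrow> real" where
  "codebook_power I n A c = (\<Sum>i\<in>I. \<Sum>j<n. (norm (A *v c i j))\<^sup>2) / (n * card I)"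

lemma codebook_power_measurable [measurable]:
  fixes A :: "real^'n^'n"
  assumes "I \<subseteq> K"
  shows "codebook_power I n A \<in> borel_measurable (codebooks K n)"
proof -
  have "(\<lambda>c :: nat \<Rightarrow> nat \<Rightarrow> real^'n. c i j) \<in> borel_measurable (codebooks K n)" if "i \<in> I" "j < n" for i j
    by (rule measurable_compose[OF codebooks_component[of i K n]]) (use that assms in \<open>auto simp: measurable_cong_sets[OF sets_noise refl]\<close>)
  then show ?thesis unfolding codebook_power_def[abs_def]
    by (intro borel_measurable_divide borel_measurable_sum borel_measurable_power borel_measurable_norm borel_measurable_matrix_vector borel_measurable_const) (auto intro!: borel_measurable_norm borel_measurable_matrix_vector)
qed

lemma codebook_power_markov:
  fixes A :: "real^'n^'n"
  assumes I: "finite I" "I \<noteq> {}" and n: "0 < n" and t: "0 \<le> t" "t \<le> 1" and tr: "trace (A ** transpose A) \<le> t * P" and P: "0 \<le> P"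
  shows "ennreal (1 - t) \<le> emeasure (codebooks I n) {c \<in> space (codebooks I n). codebook_power I n A c \<le> P}"
proof -
  let ?M = "codebooks I n :: (nat \<Rightarrow> nat \<Rightarrow> real^'n) measure"
  have [measurable]: "codebook_power I n A \<in> borel_measurable ?M" by (rule codebook_power_measurable) simp
  have p0: "0 \<le> codebook_power I n A c" for c by (simp add: codebook_power_def sum_nonneg)
  have bad: "measure ?M {c \<in> space ?M. \<not> codebook_power I n A c \<le> P} \<le> t"
  \<comment> \<open>Markov's inequality divides by \<open>P\<close>. For \<open>P = 0\<close> the
    trace condition forces \<open>A = 0\<close>, and every codebook has power 0.\<close>
  proof (cases "P = 0")
    case True
    then have "(\<Sum>i\<in>UNIV. (norm (A $ i))\<^sup>2) \<le> 0" using tr by (simp add: trace_mult_transpose)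
    then have "\<forall>i. A $ i = 0" by (simp add: sum_nonneg_eq_0_iff sum_nonneg antisym_conv)
    then have "A = 0" by (simp add: vec_eq_iff)
    then have "codebook_power I n A c = 0" for c by (simp add: codebook_power_def)
    then show ?thesis using t by (simp add: True)
  next
    case False
    then have P0: "0 < P" using P by simp
    define k where "k = inverse (real n * real (card I))"
    have k: "0 < k" "k * (real n * real (card I)) = 1" using n I card_gt_0_iff[of I] by (simp_all add: k_def field_simps)
    have "(\<integral>\<^sup>+c. ennreal (codebook_power I n A c) \<partial>?M) = (\<integral>\<^sup>+c. (\<Sum>i\<in>I. ennreal k * ennreal (\<Sum>j<n. (norm (A *v c i j))\<^sup>2)) \<partial>?M)"
      using k by (intro nn_integral_cong)
        (simp add: codebook_power_def sum_nonneg ennreal_mult'[symmetric] sum_distrib_left[symmetric] k_def divide_inverse mult.commute)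
    also have "\<dots> = (\<Sum>i\<in>I. ennreal k * (\<integral>\<^sup>+u. ennreal (\<Sum>j<n. (norm (A *v u j))\<^sup>2) \<partial>noise n))"
    proof -
      have m: "(\<lambda>u. ennreal (\<Sum>j<n. (norm (A *v u j))\<^sup>2)) \<in> borel_measurable (noise n)" by measurable
      have "(\<integral>\<^sup>+c. ennreal (\<Sum>j<n. (norm (A *v c i j))\<^sup>2) \<partial>?M) = (\<integral>\<^sup>+u. ennreal (\<Sum>j<n. (norm (A *v u j))\<^sup>2) \<partial>noise n)" if "i \<in> I" for i
      proof -
        have D: "distr ?M (noise n) (\<lambda>c. c i) = noise n"
          unfolding codebooks_def by (rule distr_PiM_component) (use that prob_space_noise in auto)
        have "(\<integral>\<^sup>+u. ennreal (\<Sum>j<n. (norm (A *v u j))\<^sup>2) \<partial>distr ?M (noise n) (\<lambda>c. c i))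
            = (\<integral>\<^sup>+c. ennreal (\<Sum>j<n. (norm (A *v c i j))\<^sup>2) \<partial>?M)"
          by (rule nn_integral_distr) (use codebooks_component[OF that] m in auto)
        then show ?thesis using D by simp
      qed
      moreover have "(\<lambda>c. ennreal (\<Sum>j<n. (norm (A *v c i j))\<^sup>2)) \<in> borel_measurable ?M" if "i \<in> I" for i
        by (rule measurable_compose[OF codebooks_component[OF that] m])
      ultimately show ?thesis by (subst nn_integral_sum) (auto simp: nn_integral_cmult)
    qed
    also have "\<dots> = ennreal (trace (A ** transpose A))"
    proof -
      have "0 \<le> trace (A ** transpose A)" by (simp add: trace_mult_transpose sum_nonneg)
      then show ?thesis using k
        by (simp add: nn_integral_noise_energy ennreal_mult'[symmetric] ennreal_of_nat_eq_real_of_nat)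
          (simp add: mult_ac k(2)[unfolded mult.commute[of k]])
    qed
    finally have E: "(\<integral>\<^sup>+c. ennreal (codebook_power I n A c) \<partial>?M) \<le> ennreal (t * P)"
      using tr by (simp add: ennreal_leI)
    let ?E = "{c \<in> space ?M. \<not> codebook_power I n A c \<le> P}"
    have Em: "?E \<in> sets ?M" by measurable
    have "ennreal P * emeasure ?M ?E = (\<integral>\<^sup>+c. ennreal P * indicator ?E c \<partial>?M)" using Em by (simp add: nn_integral_cmult)
    also have "\<dots> \<le> (\<integral>\<^sup>+c. ennreal (codebook_power I n A c) \<partial>?M)"
      by (intro nn_integral_mono) (auto simp: indicator_def intro!: ennreal_leI)
    also note E
    finally have "ennreal (P * measure ?M ?E) \<le> ennreal (t * P)"
      using P0 by (simp add: codebooks.emeasure_eq_measure ennreal_mult')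
    then have "P * measure ?M ?E \<le> P * t" using t P0 by (subst (asm) ennreal_le_iff) (auto simp: mult.commute)
    then show ?thesis using P0 by simp
  qed
  have "1 - measure ?M {c \<in> space ?M. codebook_power I n A c \<le> P} = measure ?M {c \<in> space ?M. \<not> codebook_power I n A c \<le> P}"
    by (subst codebooks.prob_neg) auto
  then show ?thesis using bad by (simp add: codebooks.emeasure_eq_measure)
qed

lemma codebook_power_cong: "(\<And>i. i \<in> I \<Longrightarrow> c i = c' i) \<Longrightarrow> codebook_power I n A c = codebook_power I n A c'"
  by (simp add: codebook_power_def)

text \<open>The two codebooks use disjoint index sets and are independent, so the two probabilities
  multiply.\<close>

lemma codebook_power_both:
  fixes A1 A2 :: "real^'n^'n"
  assumes I: "finite I" "I \<noteq> {}" "finite J" "J \<noteq> {}" "I \<inter> J = {}" and n: "0 < n" and t: "0 \<le> t" "t \<le> 1"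
    and tr: "trace (A1 ** transpose A1) \<le> t * P1" "trace (A2 ** transpose A2) \<le> t * P2" and P: "0 \<le> P1" "0 \<le> P2"
  shows "ennreal ((1 - t)\<^sup>2) \<le> (\<integral>\<^sup>+c. indicator {c. codebook_power I n A1 c \<le> P1 \<and> codebook_power J n A2 c \<le> P2} c \<partial>codebooks (I \<union> J) n)"
proof -
  define F where "F c = (if codebook_power I n A1 c \<le> P1 \<and> codebook_power J n A2 c \<le> P2 then 1 else 0 :: ennreal)" for c
  have [measurable]: "codebook_power I n A1 \<in> borel_measurable (codebooks (I \<union> J) n)" "codebook_power J n A2 \<in> borel_measurable (codebooks (I \<union> J) n)"
    by (intro codebook_power_measurable; simp)+
  have m1: "codebook_power I n A1 \<in> borel_measurable (codebooks I n)" and m2: "codebook_power J n A2 \<in> borel_measurable (codebooks J n)"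
    by (intro codebook_power_measurable; simp)+
  define E1 where "E1 = {c \<in> space (codebooks I n). codebook_power I n A1 c \<le> P1}"
  define E2 where "E2 = {c \<in> space (codebooks J n). codebook_power J n A2 c \<le> P2}"
  have E: "E1 \<in> sets (codebooks I n)" "E2 \<in> sets (codebooks J n)"
    unfolding E1_def E2_def using m1 m2 by measurable
  have Fm: "F \<in> borel_measurable (PiM (I \<union> J) (\<lambda>_. noise n))"
    unfolding F_def[abs_def] codebooks_def[symmetric] by measurable
  have "(\<integral>\<^sup>+c. F c \<partial>codebooks (I \<union> J) n) = (\<integral>\<^sup>+x. \<integral>\<^sup>+y. F (merge I J (x, y)) \<partial>codebooks J n \<partial>codebooks I n)"
    unfolding codebooks_def by (rule noises.product_nn_integral_fold) (use I Fm in auto)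
  also have "\<dots> = (\<integral>\<^sup>+x. \<integral>\<^sup>+y. indicator E1 x * indicator E2 y \<partial>codebooks J n \<partial>codebooks I n)"
  proof (intro nn_integral_cong)
    fix x y :: "nat \<Rightarrow> nat \<Rightarrow> real^'n"
    assume "x \<in> space (codebooks I n)" "y \<in> space (codebooks J n)"
    moreover have "codebook_power I n A1 (merge I J (x, y)) = codebook_power I n A1 x"
      by (rule codebook_power_cong) (simp add: merge_def)
    moreover have "codebook_power J n A2 (merge I J (x, y)) = codebook_power J n A2 y"
      using I(5) by (intro codebook_power_cong) (auto simp: merge_def)
    ultimately show "F (merge I J (x, y)) = indicator E1 x * indicator E2 y"
      by (auto simp: F_def E1_def E2_def indicator_def)
  qed
  also have "\<dots> = emeasure (codebooks I n) E1 * emeasure (codebooks J n) E2"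
    using E by (simp add: nn_integral_cmult nn_integral_multc)
  also have "ennreal (1 - t) * ennreal (1 - t) \<le> \<dots>"
    unfolding E1_def E2_def by (intro mult_mono codebook_power_markov I n t tr P) auto
  also have "F = indicator {c. codebook_power I n A1 c \<le> P1 \<and> codebook_power J n A2 c \<le> P2}"
    by (auto simp: F_def indicator_def)
  finally show ?thesis
    using t by (simp add: power2_eq_square ennreal_mult')
qed

text \<open>The codebooks of both transmitters are drawn as one family of \<open>N1 + N2\<close> independent blocks; the noise block
  at a receiver is component \<open>N1 + N2\<close>.\<close>

lemma exists_good_code:
  fixes H1 H2 H4 A1 A2 :: "real^'n^'n" and R1 R2 :: real and ok1 :: "(nat \<Rightarrow> real^'n) \<Rightarrow> (nat \<Rightarrow> real^'n) \<Rightarrow> (nat \<Rightarrow> real^'n) \<Rightarrow> bool"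
    and ok2 :: "(nat \<Rightarrow> real^'n) \<Rightarrow> (nat \<Rightarrow> real^'n) \<Rightarrow> bool"
  assumes n: "0 < n" and t: "0 \<le> t" "t < 1" and P: "0 \<le> P1" "0 \<le> P2"
    and tr: "trace (A1 ** transpose A1) \<le> t * P1" "trace (A2 ** transpose A2) \<le> t * P2"
    and ok1m: "Measurable.pred (noise n \<Otimes>\<^sub>M (noise n \<Otimes>\<^sub>M block_space n)) (\<lambda>p. ok1 (fst p) (fst (snd p)) (snd (snd p)))"
    and ok2m: "Measurable.pred (noise n \<Otimes>\<^sub>M block_space n) (\<lambda>p. ok2 (fst p) (snd p))"
  defines "y1 \<equiv> \<lambda>u v z. received n H1 H2 (\<lambda>j. A1 *v u j) (\<lambda>j. A2 *v v j) z"
    and "y2 \<equiv> \<lambda>v z. received n (0 :: real^'n^'n) H4 (\<lambda>j. 0) (\<lambda>j. A2 *v v j) z"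
  assumes miss1: "(\<integral>\<^sup>+u. \<integral>\<^sup>+v. \<integral>\<^sup>+z. of_bool (\<not> ok1 u v (y1 u v z)) \<partial>noise n \<partial>noise n \<partial>noise n) \<le> ennreal \<mu>1"
    and hit1: "\<And>v y. (\<integral>\<^sup>+u. of_bool (ok1 u v y) \<partial>noise n) \<le> ennreal \<beta>1"
    and hit12: "\<And>y. (\<integral>\<^sup>+u. \<integral>\<^sup>+v. of_bool (ok1 u v y) \<partial>noise n \<partial>noise n) \<le> ennreal \<beta>12"
    and miss2: "(\<integral>\<^sup>+v. \<integral>\<^sup>+z. of_bool (\<not> ok2 v (y2 v z)) \<partial>noise n \<partial>noise n) \<le> ennreal \<mu>2"
    and hit2: "\<And>y. (\<integral>\<^sup>+v. of_bool (ok2 v y) \<partial>noise n) \<le> ennreal \<beta>2"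
    and pos: "0 \<le> \<mu>1" "0 \<le> \<beta>1" "0 \<le> \<beta>12" "0 \<le> \<mu>2" "0 \<le> \<beta>2"
  defines "N1 \<equiv> num_messages n R1" and "N2 \<equiv> num_messages n R2"
  assumes \<epsilon>: "\<mu>1 + (N1 - 1) * (\<beta>1 + (N2 - 1) * \<beta>12) + \<mu>2 + (N2 - 1) * \<beta>2 \<le> \<epsilon>" "0 < \<epsilon>"
  shows "\<exists>f1 f2 g1 g2. valid_encoder n R1 P1 f1 \<and> valid_encoder n R2 P2 f2 \<and> valid_decoder n R1 g1 \<and> valid_decoder n R2 g2 \<and>
    error1 H1 H2 n R1 R2 f1 f2 g1 + error2 0 H4 n R1 R2 f1 f2 g2 \<le> 2 * \<epsilon> / (1 - t)\<^sup>2"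
proof -
  have N: "0 < N1" "0 < N2" by (simp_all add: N1_def N2_def num_messages_pos)
  define K where "K = N1 + N2"
  define M where "M = (codebooks {..<Suc K} n :: (nat \<Rightarrow> nat \<Rightarrow> real^'n) measure)"
  have comp [measurable]: "(\<lambda>c. c i) \<in> measurable M (noise n)" if "i < Suc K" for i
    unfolding M_def using that by (intro codebooks_component) simp
  have compj: "(\<lambda>c. c i j) \<in> borel_measurable M" if "i < Suc K" "j < n" for i j
    by (rule measurable_compose[OF comp[OF that(1)]]) (use that in \<open>auto simp: measurable_cong_sets[OF sets_noise refl]\<close>)
  have y1m: "(\<lambda>c. y1 (c i) (c k) (c K)) \<in> measurable M (block_space n)" if "i < K" "k < K" for i k
    unfolding y1_def received_def
    by (intro measurable_restrict borel_measurable_add borel_measurable_matrix_vector compj) (use that in auto)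
  have y2m: "(\<lambda>c. y2 (c k) (c K)) \<in> measurable M (block_space n)" if "k < K" for k
    unfolding y2_def received_def
    by (intro measurable_restrict borel_measurable_add borel_measurable_matrix_vector compj borel_measurable_const) (use that in auto)
  have ok1M: "Measurable.pred M (\<lambda>c. ok1 (c a) (c b) (y1 (c i) (c k) (c K)))" if "a < K" "b < K" "i < K" "k < K" for a b i k
  proof -
    have "(\<lambda>c. (c a, c b, y1 (c i) (c k) (c K))) \<in> measurable M (noise n \<Otimes>\<^sub>M (noise n \<Otimes>\<^sub>M block_space n))"
      using that by (intro measurable_Pair comp y1m) auto
    from measurable_compose[OF this ok1m] show ?thesis by simp
  qed
  have ok2M: "Measurable.pred M (\<lambda>c. ok2 (c b) (y2 (c k) (c K)))" if "b < K" "k < K" for b k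
  proof -
    have "(\<lambda>c. (c b, y2 (c k) (c K))) \<in> measurable M (noise n \<Otimes>\<^sub>M block_space n)"
      using that by (intro measurable_Pair comp y2m) auto
    from measurable_compose[OF this ok2m] show ?thesis by simp
  qed
  \<comment> \<open>Primed events are rejections of the true codewords, unprimed ones acceptances of wrong ones.\<close>
  define T1 where "T1 m1 m2 a b c = (of_bool (ok1 (c a) (c (N1 + b)) (y1 (c m1) (c (N1 + m2)) (c K))) :: ennreal)" for m1 m2 a b c
  define T1' where "T1' m1 m2 c = (of_bool (\<not> ok1 (c m1) (c (N1 + m2)) (y1 (c m1) (c (N1 + m2)) (c K))) :: ennreal)" for m1 m2 c
  define T2 where "T2 m2 b c = (of_bool (ok2 (c (N1 + b)) (y2 (c (N1 + m2)) (c K))) :: ennreal)" for m2 b c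
  define T2' where "T2' m2 c = (of_bool (\<not> ok2 (c (N1 + m2)) (y2 (c (N1 + m2)) (c K))) :: ennreal)" for m2 c
  define e where "e m1 m2 c = T1' m1 m2 c + (\<Sum>a\<in>{..<N1} - {m1}. \<Sum>b<N2. T1 m1 m2 a b c)
      + T2' m2 c + (\<Sum>b\<in>{..<N2} - {m2}. T2 m2 b c)" for m1 m2 c
  have Tm: "T1 m1 m2 a b \<in> borel_measurable M" "T1' m1 m2 \<in> borel_measurable M" "T2 m2 b \<in> borel_measurable M" "T2' m2 \<in> borel_measurable M"
    if "m1 < N1" "m2 < N2" "a < N1" "b < N2" for m1 m2 a b
    unfolding T1_def[abs_def] T1'_def[abs_def] T2_def[abs_def] T2'_def[abs_def]
    by (intro borel_measurable_of_bool pred_intros_logic ok1M ok2M; use that in \<open>simp add: K_def\<close>)+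
  have em: "e m1 m2 \<in> borel_measurable M" if "m1 < N1" "m2 < N2" for m1 m2
    unfolding e_def[abs_def] using that by (intro borel_measurable_add borel_measurable_sum Tm) auto
  have I1: "(\<integral>\<^sup>+c. T1' m1 m2 c \<partial>M) \<le> ennreal \<mu>1" if "m1 < N1" "m2 < N2" for m1 m2
    unfolding M_def
    by (rule nn_integral_codebooks_le3[where i = m1 and j = "N1 + m2" and k = K])
      (use that Tm(2)[OF that that] miss1 in \<open>auto simp: K_def T1'_def[abs_def] M_def\<close>)
  \<comment> \<open>If \<open>b = m2\<close>, only block \<open>a\<close> is independent of the
    output. If \<open>b\<close> differs from \<open>m2\<close>, both blocks \<open>a\<close> and
    \<open>N1 + b\<close> are fresh. The two cases call for different exponents.\<close>
  have I2: "(\<integral>\<^sup>+c. T1 m1 m2 a b c \<partial>M) \<le> ennreal (if b = m2 then \<beta>1 else \<beta>12)" if "m1 < N1" "m2 < N2" "a < N1" "b < N2" "a \<noteq> m1" for m1 m2 a b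
  proof (cases "b = m2")
    case True
    show ?thesis
      unfolding M_def
      by (rule nn_integral_codebooks_le1[where i = a])
        (use that True Tm(1)[OF that(1-4)] hit1 in \<open>auto simp: K_def T1_def[abs_def] M_def\<close>)
  next
    case False
    then show ?thesis
      unfolding M_def
      by (intro nn_integral_codebooks_le2[where i = a and j = "N1 + b"])
        (use that Tm(1)[OF that(1-4)] hit12 in \<open>auto simp: K_def T1_def[abs_def] M_def\<close>)
  qed
  have I3: "(\<integral>\<^sup>+c. T2' m2 c \<partial>M) \<le> ennreal \<mu>2" if "m2 < N2" for m2
    unfolding M_def
    by (rule nn_integral_codebooks_le2[where i = "N1 + m2" and j = K])
      (use that Tm(4)[OF N(1) that N(1) that] miss2 in \<open>auto simp: K_def T2'_def[abs_def] M_def\<close>)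
  have I4: "(\<integral>\<^sup>+c. T2 m2 b c \<partial>M) \<le> ennreal \<beta>2" if "m2 < N2" "b < N2" "b \<noteq> m2" for m2 b
    unfolding M_def
    by (rule nn_integral_codebooks_le1[where i = "N1 + b"])
      (use that Tm(3)[OF N(1) that(1) N(1) that(2)] hit2 in \<open>auto simp: K_def T2_def[abs_def] M_def\<close>)
  have Ie: "(\<integral>\<^sup>+c. e m1 m2 c \<partial>M) \<le> ennreal \<epsilon>" if m: "m1 < N1" "m2 < N2" for m1 m2
  proof -
    note ms = borel_measurable_add borel_measurable_sum Tm[OF m]
    have "(\<integral>\<^sup>+c. e m1 m2 c \<partial>M) = (\<integral>\<^sup>+c. T1' m1 m2 c \<partial>M) + (\<integral>\<^sup>+c. (\<Sum>a\<in>{..<N1} - {m1}. \<Sum>b<N2. T1 m1 m2 a b c) \<partial>M)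
      + (\<integral>\<^sup>+c. T2' m2 c \<partial>M) + (\<integral>\<^sup>+c. (\<Sum>b\<in>{..<N2} - {m2}. T2 m2 b c) \<partial>M)"
      unfolding e_def using m by ((subst nn_integral_add; (intro ms; simp)?)+) (rule refl)
    also have "(\<integral>\<^sup>+c. (\<Sum>a\<in>{..<N1} - {m1}. \<Sum>b<N2. T1 m1 m2 a b c) \<partial>M) = (\<Sum>a\<in>{..<N1} - {m1}. \<integral>\<^sup>+c. (\<Sum>b<N2. T1 m1 m2 a b c) \<partial>M)"
      by (intro nn_integral_sum ms) auto
    also have "\<dots> = (\<Sum>a\<in>{..<N1} - {m1}. \<Sum>b<N2. \<integral>\<^sup>+c. T1 m1 m2 a b c \<partial>M)"
      by (intro sum.cong refl nn_integral_sum ms) auto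
    also have "(\<integral>\<^sup>+c. (\<Sum>b\<in>{..<N2} - {m2}. T2 m2 b c) \<partial>M) = (\<Sum>b\<in>{..<N2} - {m2}. \<integral>\<^sup>+c. T2 m2 b c \<partial>M)"
      using m by (intro nn_integral_sum Tm) auto
    also have "(\<integral>\<^sup>+c. T1' m1 m2 c \<partial>M) + (\<Sum>a\<in>{..<N1} - {m1}. \<Sum>b<N2. \<integral>\<^sup>+c. T1 m1 m2 a b c \<partial>M) + (\<integral>\<^sup>+c. T2' m2 c \<partial>M) + (\<Sum>b\<in>{..<N2} - {m2}. \<integral>\<^sup>+c. T2 m2 b c \<partial>M)
      \<le> ennreal \<mu>1 + (\<Sum>a\<in>{..<N1} - {m1}. \<Sum>b<N2. ennreal (if b = m2 then \<beta>1 else \<beta>12)) + ennreal \<mu>2 + (\<Sum>b\<in>{..<N2} - {m2}. ennreal \<beta>2)"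
      using m by (intro add_mono sum_mono I1 I2 I3 I4) auto
    also have "\<dots> = ennreal (\<mu>1 + (\<Sum>a\<in>{..<N1} - {m1}. \<Sum>b<N2. if b = m2 then \<beta>1 else \<beta>12) + \<mu>2 + (\<Sum>b\<in>{..<N2} - {m2}. \<beta>2))"
      using pos by (simp add: ennreal_plus sum_nonneg del: sum_constant flip: sum_ennreal)
    also have "(\<Sum>b<N2. if b = m2 then \<beta>1 else \<beta>12) = \<beta>1 + (N2 - 1) * \<beta>12"
      using m by (subst sum.remove[of _ m2]) auto
    also have "ennreal (\<mu>1 + (\<Sum>a\<in>{..<N1} - {m1}. \<beta>1 + (N2 - 1) * \<beta>12) + \<mu>2 + (\<Sum>b\<in>{..<N2} - {m2}. \<beta>2)) \<le> ennreal \<epsilon>"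
      using m \<epsilon>(1) by (intro ennreal_leI) simp
    finally show ?thesis .
  qed
  \<comment> \<open>\<open>J c\<close> will dominate the sum of both error probabilities of the code
    built from \<open>c\<close>. The codebook uses only components below \<open>K\<close>, so
    component \<open>K\<close> can be integrated out inside as the noise.\<close>
  define J where "J c = ennreal (1 / (N1 * N2)) * (\<Sum>m1<N1. \<Sum>m2<N2. \<integral>\<^sup>+z. e m1 m2 (c(K := z)) \<partial>noise n)" for c
  define \<Omega> where "\<Omega> = (codebooks {..<K} n :: (nat \<Rightarrow> nat \<Rightarrow> real^'n) measure)"
  have K: "{..<Suc K} - {K} = {..<K}" by auto
  have IJ: "(\<integral>\<^sup>+c. J c \<partial>\<Omega>) \<le> ennreal \<epsilon>"
  proof -
    note up = nn_integral_codebooks_update[of "{..<Suc K}" K, unfolded K]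
    have m [measurable]: "(\<lambda>c. \<integral>\<^sup>+z. e m1 m2 (c(K := z)) \<partial>noise n) \<in> borel_measurable \<Omega>" if "m1 < N1" "m2 < N2" for m1 m2
      using up(1)[OF _ _ em[OF that, unfolded M_def]] by (simp add: \<Omega>_def)
    have "(\<integral>\<^sup>+c. J c \<partial>\<Omega>) = ennreal (1 / (N1 * N2)) * (\<Sum>m1<N1. \<Sum>m2<N2. \<integral>\<^sup>+c. \<integral>\<^sup>+z. e m1 m2 (c(K := z)) \<partial>noise n \<partial>\<Omega>)"
    proof -
      have "(\<integral>\<^sup>+c. J c \<partial>\<Omega>) = ennreal (1 / (N1 * N2)) * (\<integral>\<^sup>+c. (\<Sum>m1<N1. \<Sum>m2<N2. \<integral>\<^sup>+z. e m1 m2 (c(K := z)) \<partial>noise n) \<partial>\<Omega>)"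
        unfolding J_def by (intro nn_integral_cmult borel_measurable_sum m) auto
      also have "(\<integral>\<^sup>+c. (\<Sum>m1<N1. \<Sum>m2<N2. \<integral>\<^sup>+z. e m1 m2 (c(K := z)) \<partial>noise n) \<partial>\<Omega>)
          = (\<Sum>m1<N1. \<integral>\<^sup>+c. (\<Sum>m2<N2. \<integral>\<^sup>+z. e m1 m2 (c(K := z)) \<partial>noise n) \<partial>\<Omega>)"
        by (intro nn_integral_sum borel_measurable_sum m) auto
      also have "\<dots> = (\<Sum>m1<N1. \<Sum>m2<N2. \<integral>\<^sup>+c. \<integral>\<^sup>+z. e m1 m2 (c(K := z)) \<partial>noise n \<partial>\<Omega>)"
        by (intro sum.cong refl nn_integral_sum m) auto
      finally show ?thesis .
    qed
    also have "\<dots> \<le> ennreal (1 / (N1 * N2)) * (\<Sum>m1<N1. \<Sum>m2<N2. ennreal \<epsilon>)"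
    proof (intro mult_left_mono sum_mono)
      fix m1 m2 assume "m1 \<in> {..<N1}" "m2 \<in> {..<N2}"
      then have m12: "m1 < N1" "m2 < N2" by auto
      show "(\<integral>\<^sup>+c. \<integral>\<^sup>+z. e m1 m2 (c(K := z)) \<partial>noise n \<partial>\<Omega>) \<le> ennreal \<epsilon>"
        using Ie[OF m12] up(2)[OF _ _ em[OF m12, unfolded M_def]] by (simp add: \<Omega>_def M_def)
    qed simp
    also have "\<dots> = ennreal (1 / (N1 * N2) * (N1 * (N2 * \<epsilon>)))"
      using \<epsilon>(2) by (simp add: ennreal_of_nat_eq_real_of_nat ennreal_mult'[symmetric] mult.assoc)
    finally show ?thesis using N by simp
  qed
  have split: "{..<N1} \<union> {N1..<K} = {..<K}" by (auto simp: K_def)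
  define good where "good c \<longleftrightarrow> codebook_power {..<N1} n A1 c \<le> P1 \<and> codebook_power {N1..<K} n A2 c \<le> P2" for c
  \<comment> \<open>Otherwise the codebooks within the power limits, of probability at least
    \<open>(1 - t)\<^sup>2\<close>, would alone contribute \<open>2 * \<epsilon>\<close> to an
    expectation of at most \<open>\<epsilon>\<close>; the factor 2 makes the contradiction
    strict.\<close>
  have "\<exists>c\<in>space \<Omega>. good c \<and> J c \<le> ennreal (2 * \<epsilon> / (1 - t)\<^sup>2)"
  proof (rule ccontr)
    assume "\<not> ?thesis"
    then have bad: "ennreal (2 * \<epsilon> / (1 - t)\<^sup>2) \<le> J c" if "c \<in> space \<Omega>" "good c" for c
      using that by (auto simp: not_le intro: less_imp_le)
    have [measurable]: "codebook_power {..<N1} n A1 \<in> borel_measurable \<Omega>" "codebook_power {N1..<K} n A2 \<in> borel_measurable \<Omega>"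
      unfolding \<Omega>_def by (intro codebook_power_measurable; auto simp: K_def)+
    have gm: "(\<lambda>c. of_bool (good c) :: ennreal) \<in> borel_measurable \<Omega>"
      unfolding good_def by (intro borel_measurable_of_bool) measurable
    have k: "ennreal ((1 - t)\<^sup>2) \<le> (\<integral>\<^sup>+c. of_bool (good c) \<partial>\<Omega>)"
    proof -
      have "{..<N1} \<noteq> {}" "{..<N1} \<inter> {N1..<K} = {}" "{N1..<K} \<noteq> {}" using N by (auto simp: K_def)
      then show ?thesis
        using codebook_power_both[of "{..<N1}" "{N1..<K}" n t A1 P1 A2 P2, unfolded split, folded \<Omega>_def good_def] n t tr P
        by (simp add: indicator_def)
    qed
    have "ennreal (2 * \<epsilon>) = ennreal (2 * \<epsilon> / (1 - t)\<^sup>2) * ennreal ((1 - t)\<^sup>2)"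
      using t \<epsilon>(2) by (simp add: ennreal_mult'[symmetric])
    also have "\<dots> \<le> ennreal (2 * \<epsilon> / (1 - t)\<^sup>2) * (\<integral>\<^sup>+c. of_bool (good c) \<partial>\<Omega>)"
      by (intro mult_left_mono k) simp
    also have "\<dots> = (\<integral>\<^sup>+c. ennreal (2 * \<epsilon> / (1 - t)\<^sup>2) * of_bool (good c) \<partial>\<Omega>)"
      using gm by (simp add: nn_integral_cmult)
    also have "\<dots> \<le> (\<integral>\<^sup>+c. J c \<partial>\<Omega>)"
      using bad by (intro nn_integral_mono) (auto simp: of_bool_def)
    also note IJ
    finally show False using \<epsilon>(2) by (simp add: ennreal_le_iff)
  qed
  then obtain c where c: "c \<in> space \<Omega>" "good c" "J c \<le> ennreal (2 * \<epsilon> / (1 - t)\<^sup>2)" by auto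
  define f1 where "f1 m j = A1 *v c m j" for m j
  define f2 where "f2 m j = A2 *v c (N1 + m) j" for m j
  \<comment> \<open>The condition \<open>a < N1\<close> is repeated inside the test because
    \<open>first_ok_decoder\<close> asks for measurability at every index, and \<open>c a\<close>
    need not be a codeword of the first codebook beyond \<open>N1\<close>.\<close>
  define g1 where "g1 y = first_ok N1 (\<lambda>a. a < N1 \<and> (\<exists>b<N2. ok1 (c a) (c (N1 + b)) y))" for y
  define g2 where "g2 y = first_ok N2 (\<lambda>b. b < N2 \<and> ok2 (c (N1 + b)) y)" for y
  have "valid_encoder n R1 P1 f1"
    using c(2) by (simp add: valid_encoder_def expectation_message N1_def[symmetric] good_def codebook_power_def f1_def
        sum_divide_distrib[symmetric] mult.commute sum.swap[of _ "{..<N1}"])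
  moreover have "valid_encoder n R2 P2 f2"
  proof -
    have "(\<Sum>i = N1..<K. \<Sum>j<n. (norm (A2 *v c i j))\<^sup>2) = (\<Sum>m<N2. \<Sum>j<n. (norm (f2 m j))\<^sup>2)"
      by (rule sum.reindex_bij_witness[where i = "\<lambda>m. N1 + m" and j = "\<lambda>i. i - N1"]) (auto simp: K_def f2_def)
    then show ?thesis
      using c(2) by (simp add: valid_encoder_def expectation_message N2_def[symmetric] good_def codebook_power_def
        sum_divide_distrib[symmetric] mult.commute sum.swap[of _ "{..<N2}"] K_def)
  qed
  moreover have cs: "c i \<in> space (noise n)" if "i < K" for i
    using c(1) that by (auto simp: \<Omega>_def codebooks_def space_PiM)
  have g1: "valid_decoder n R1 g1"
    unfolding g1_def N1_def
  proof (rule first_ok_decoder, fold N1_def)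
    fix a
    have "Measurable.pred (block_space n) (\<lambda>y. ok1 (c a) (c (N1 + b)) y)" if "a < N1" "b < N2" for b
    proof -
      have "(\<lambda>y. (c a, c (N1 + b), y)) \<in> measurable (block_space n) (noise n \<Otimes>\<^sub>M (noise n \<Otimes>\<^sub>M block_space n))"
        using that by (intro measurable_Pair measurable_const cs measurable_ident) (auto simp: K_def)
      from measurable_compose[OF this ok1m] show ?thesis by simp
    qed
    then show "Measurable.pred (block_space n) (\<lambda>y. a < N1 \<and> (\<exists>b<N2. ok1 (c a) (c (N1 + b)) y))"
      by (cases "a < N1") (auto intro!: pred_intros_finite)
  qed
  moreover have g2: "valid_decoder n R2 g2"
    unfolding g2_def N2_def
  proof (rule first_ok_decoder, fold N2_def)
    fix b
    have "Measurable.pred (block_space n) (\<lambda>y. ok2 (c (N1 + b)) y)" if "b < N2"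
    proof -
      have "(\<lambda>y. (c (N1 + b), y)) \<in> measurable (block_space n) (noise n \<Otimes>\<^sub>M block_space n)"
        using that by (intro measurable_Pair measurable_const cs measurable_ident) (auto simp: K_def)
      from measurable_compose[OF this ok2m] show ?thesis by simp
    qed
    then show "Measurable.pred (block_space n) (\<lambda>y. b < N2 \<and> ok2 (c (N1 + b)) y)"
      by (cases "b < N2") auto
  qed
  moreover have "error1 H1 H2 n R1 R2 f1 f2 g1 + error2 0 H4 n R1 R2 f1 f2 g2 \<le> 2 * \<epsilon> / (1 - t)\<^sup>2"
  proof -
    define E1 where "E1 m1 m2 = {z \<in> space (noise n). g1 (received n H1 H2 (f1 m1) (f2 m2) z) \<noteq> m1}" for m1 m2
    define E2 where "E2 m1 m2 = {z \<in> space (noise n). g2 (received n 0 H4 (f1 m1) (f2 m2) z) \<noteq> m2}" for m1 m2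
    have E: "E1 m1 m2 \<in> sets (noise n)" "E2 m1 m2 \<in> sets (noise n)" for m1 m2
      unfolding E1_def E2_def
      using valid_decoder_pred(2)[OF g1 received_measurable] valid_decoder_pred(2)[OF g2 received_measurable] by measurable
    have "error1 H1 H2 n R1 R2 f1 f2 g1 + error2 0 H4 n R1 R2 f1 f2 g2
       = (\<Sum>m1<N1. \<Sum>m2<N2. measure (noise n) (E1 m1 m2) + measure (noise n) (E2 m1 m2)) / (N1 * N2)"
      unfolding error1_def error2_def
      by (subst (1 2) measure_receiver_space)
        (auto simp: N1_def N2_def E1_def E2_def sum.distrib add_divide_distrib
          intro: valid_decoder_pred(2)[OF g1 received_measurable] valid_decoder_pred(2)[OF g2 received_measurable])
    also have "ennreal \<dots> = ennreal (1 / (N1 * N2)) * (\<Sum>m1<N1. \<Sum>m2<N2. ennreal (measure (noise n) (E1 m1 m2) + measure (noise n) (E2 m1 m2)))"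
      by (simp add: sum_ennreal sum_nonneg ennreal_mult'[symmetric] del: ennreal_plus)
    also have "\<dots> \<le> J c"
      unfolding J_def
    proof (intro mult_left_mono sum_mono)
      fix m1 m2 assume "m1 \<in> {..<N1}" "m2 \<in> {..<N2}"
      then have m: "m1 < N1" "m2 < N2" by auto
      have "ennreal (measure (noise n) (E1 m1 m2) + measure (noise n) (E2 m1 m2)) = (\<integral>\<^sup>+z. indicator (E1 m1 m2) z + indicator (E2 m1 m2) z \<partial>noise n)"
        using E by (simp add: nn_integral_add noise.emeasure_eq_measure)
      also have "\<dots> \<le> (\<integral>\<^sup>+z. e m1 m2 (c(K := z)) \<partial>noise n)"
      proof (rule nn_integral_mono)
        fix z
        define Y1 where "Y1 = y1 (c m1) (c (N1 + m2)) z"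
        define Y2 where "Y2 = y2 (c (N1 + m2)) z"
        have Y1: "received n H1 H2 (f1 m1) (f2 m2) z = Y1" by (simp add: Y1_def y1_def f1_def[abs_def] f2_def[abs_def])
        have Y2: "received n 0 H4 (f1 m1) (f2 m2) z = Y2" by (simp add: Y2_def y2_def received_def f2_def)
        define a1 where "a1 = (of_bool (\<not> ok1 (c m1) (c (N1 + m2)) Y1) :: ennreal)"
        define a2 where "a2 = (\<Sum>a\<in>{..<N1} - {m1}. \<Sum>b<N2. of_bool (ok1 (c a) (c (N1 + b)) Y1) :: ennreal)"
        define a4 where "a4 = (of_bool (\<not> ok2 (c (N1 + m2)) Y2) :: ennreal)"
        define a5 where "a5 = (\<Sum>b\<in>{..<N2} - {m2}. of_bool (ok2 (c (N1 + b)) Y2) :: ennreal)"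
        have e: "e m1 m2 (c(K := z)) = a1 + a2 + a4 + a5"
          using m by (simp add: e_def T1_def T1'_def T2_def T2'_def Y1_def Y2_def K_def a1_def a2_def a4_def a5_def)
        have one: "1 \<le> (\<Sum>a\<in>S. h a :: ennreal)" if "finite S" "a \<in> S" "1 \<le> h a" for S and a :: nat and h
          using member_le_sum[of a S h] that by (auto intro: order_trans)
        have "indicator (E1 m1 m2) z \<le> a1 + a2"
        proof (cases "z \<in> E1 m1 m2")
          case True
          then have "g1 Y1 \<noteq> m1" by (simp add: E1_def Y1)
          then consider "\<not> ok1 (c m1) (c (N1 + m2)) Y1" | a b where "a < N1" "a \<noteq> m1" "b < N2" "ok1 (c a) (c (N1 + b)) Y1"
            using first_ok_neq[of N1 _ m1] m unfolding g1_def by blast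
          then have "1 \<le> a1 \<or> 1 \<le> a2"
          proof cases
            case (2 a b)
            then have "1 \<le> a2" unfolding a2_def by (intro one[of _ a] one[of _ b]) auto
            then show ?thesis by simp
          qed (simp add: a1_def)
          then have "1 \<le> a1 + a2"
            by (elim disjE) (auto intro: order_trans add_increasing add_increasing2)
          then show ?thesis by (simp add: True)
        qed simp
        moreover have "indicator (E2 m1 m2) z \<le> a4 + a5"
        proof (cases "z \<in> E2 m1 m2")
          case True
          then have "g2 Y2 \<noteq> m2" by (simp add: E2_def Y2)
          then consider "\<not> ok2 (c (N1 + m2)) Y2" | b where "b \<noteq> m2" "b < N2" "ok2 (c (N1 + b)) Y2"
            using first_ok_neq[of N2 _ m2] m unfolding g2_def by blast
          then have "1 \<le> a4 \<or> 1 \<le> a5"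
          proof cases
            case 1
            then show ?thesis by (simp add: a4_def)
          next
            case (2 b)
            then have "1 \<le> a5" unfolding a5_def by (intro one[of _ b]) auto
            then show ?thesis by simp
          qed
          then have "1 \<le> a4 + a5"
            by (elim disjE) (auto intro: order_trans add_increasing add_increasing2)
          then show ?thesis by (simp add: True)
        qed simp
        ultimately show "indicator (E1 m1 m2) z + indicator (E2 m1 m2) z \<le> e m1 m2 (c(K := z))"
          unfolding e using add_mono by (fastforce simp: add.assoc)
      qed
      finally show "ennreal (measure (noise n) (E1 m1 m2) + measure (noise n) (E2 m1 m2)) \<le> (\<integral>\<^sup>+z. e m1 m2 (c(K := z)) \<partial>noise n)" .
    qed simp
    also note c(3)
    finally show ?thesis using \<epsilon>(2) by (subst (asm) ennreal_le_iff) auto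
  qed
  ultimately show ?thesis by blast
qed

section \<open>Achievability of the rate region\<close>

lemma zero_matrix_mult [simp]: "(0 :: real^'n^'n) ** A = 0"
  by (simp add: matrix_matrix_mult_def vec_eq_iff)

text \<open>The point-to-point channel is treated as a two-user channel whose second user has matrix
  0 and integrates out trivially.\<close>

lemma hit_bound_single:
  assumes "whitens B G (0 :: real^'n^'n)"
  shows "(\<integral>\<^sup>+u. of_bool (typical n \<delta> B y (\<lambda>j. G *v u j)) \<partial>noise n) \<le> ennreal (exp (n * (\<delta> - half_logdet (G ** transpose G))))"
  using hit_bound[OF assms, of n \<delta> y] by (simp add: noise.emeasure_space_1)

text \<open>Counts the wrong candidates: removing the true message absorbs the rounding up, and at
  rate 0 nothing is left. This is why a zero rate needs no strict inequality.\<close>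

lemma num_messages_le: "real (num_messages n R - 1) \<le> (if 0 < R then exp (n * R) else 0)" if "0 \<le> R"
proof (cases "0 < R")
  case True
  have "real (num_messages n R) < exp (n * R) + 1"
    unfolding num_messages_def using of_int_ceiling_le_add_one[of "exp (n * R)"]
    by (simp add: of_nat_nat) linarith
  then show ?thesis using True num_messages_pos[of n R] by (simp add: of_nat_diff)
next
  case False
  then have "R = 0" using that by simp
  then show ?thesis by (simp add: num_messages_def)
qed

text \<open>Each strict inequality is asked for only when wrong messages of the kind in question
  exist. This includes corner points such as \<open>R1 = 0\<close> with \<open>A1 = 0\<close>, where
  the bound itself is 0.\<close>

lemma achievable_gaussian:
  fixes H1 H2 H4 A1 A2 :: "real^'n^'n"
  assumes t: "0 \<le> t" "t < 1" and P: "0 \<le> P1" "0 \<le> P2" and R: "0 \<le> R1" "0 \<le> R2"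
    and tr: "trace (A1 ** transpose A1) \<le> t * P1" "trace (A2 ** transpose A2) \<le> t * P2"
  defines "G1 \<equiv> H1 ** A1" and "G2 \<equiv> H2 ** A2" and "G4 \<equiv> H4 ** A2"
  assumes r1: "0 < R1 \<Longrightarrow> R1 < half_logdet (G1 ** transpose G1)"
    and r2: "0 < R2 \<Longrightarrow> R2 < half_logdet (G4 ** transpose G4)"
    and r12: "0 < R1 \<Longrightarrow> 0 < R2 \<Longrightarrow> R1 + R2 < half_logdet (G1 ** transpose G1 + G2 ** transpose G2)"
  shows "achievable H1 H2 0 H4 P1 P2 R1 R2"
proof -
  let ?b1 = "half_logdet (G1 ** transpose G1)" and ?b2 = "half_logdet (G4 ** transpose G4)"
    and ?b12 = "half_logdet (G1 ** transpose G1 + G2 ** transpose G2)"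
  \<comment> \<open>Half of the least slack among the relevant inequalities; the element 1 keeps the
    set nonempty when both rates are 0.\<close>
  define \<delta> where "\<delta> = (1 / 2) * Min ({1} \<union> (if 0 < R1 then {?b1 - R1} else {}) \<union> (if 0 < R2 then {?b2 - R2} else {})
      \<union> (if 0 < R1 \<and> 0 < R2 then {?b12 - (R1 + R2)} else {}))"
  have \<delta>: "0 < \<delta>" unfolding \<delta>_def using r1 r2 r12 by (auto simp: Min_gr_iff)
  have d1: "R1 + \<delta> < ?b1" if "0 < R1"
  proof -
    have "2 * \<delta> \<le> ?b1 - R1" unfolding \<delta>_def using that by (auto intro!: Min_le)
    then show ?thesis using \<delta> by linarith
  qed
  have d2: "R2 + \<delta> < ?b2" if "0 < R2"
  proof -
    have "2 * \<delta> \<le> ?b2 - R2" unfolding \<delta>_def using that by (auto intro!: Min_le)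
    then show ?thesis using \<delta> by linarith
  qed
  have d12: "R1 + R2 + \<delta> < ?b12" if "0 < R1" "0 < R2"
  proof -
    have "2 * \<delta> \<le> ?b12 - (R1 + R2)" unfolding \<delta>_def using that by (auto intro!: Min_le)
    then show ?thesis using \<delta> by linarith
  qed
  obtain B1 B2 B12 where B: "whitens B1 G1 0" "whitens B2 G4 0" "whitens B12 G1 G2"
    using ex_whitens by metis
  obtain \<rho> where \<rho>: "0 < \<rho>" "\<rho> < 1" and miss: "\<And>n B G1 (G2 :: real^'n^'n). whitens B G1 G2 \<Longrightarrow>
      (\<integral>\<^sup>+u. \<integral>\<^sup>+v. \<integral>\<^sup>+z. of_bool (\<not> typical n \<delta> B (\<lambda>j. G1 *v u j + G2 *v v j + z j) (\<lambda>j. G1 *v u j + G2 *v v j)) \<partial>noise n \<partial>noise n \<partial>noise n)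
        \<le> ennreal (2 * \<rho> ^ n)"
    by (rule miss_bound[OF \<delta>]) (rule that)
  define q1 where "q1 = (if 0 < R1 then exp (R1 + \<delta> - ?b1) else 0)"
  define q2 where "q2 = (if 0 < R2 then exp (R2 + \<delta> - ?b2) else 0)"
  define q12 where "q12 = (if 0 < R1 \<and> 0 < R2 then exp (R1 + R2 + \<delta> - ?b12) else 0)"
  have q: "0 \<le> q1" "q1 < 1" "0 \<le> q2" "q2 < 1" "0 \<le> q12" "q12 < 1"
    using d1 d2 d12 by (auto simp: q1_def q2_def q12_def)
  \<comment> \<open>The coefficient 6 collects \<open>2 * \<rho> ^ n\<close> for each of three
    tests, two at receiver 1 and one at receiver 2. The powers of \<open>q1\<close>,
    \<open>q12\<close> and \<open>q2\<close> bound the false acceptances.\<close>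
  define \<epsilon> where "\<epsilon> n = 6 * \<rho> ^ n + q1 ^ n + q12 ^ n + q2 ^ n + 1 / n" for n :: nat
  have code: "\<exists>f1 f2 g1 g2. valid_encoder n R1 P1 f1 \<and> valid_encoder n R2 P2 f2 \<and> valid_decoder n R1 g1 \<and> valid_decoder n R2 g2 \<and>
    error1 H1 H2 n R1 R2 f1 f2 g1 + error2 0 H4 n R1 R2 f1 f2 g2 \<le> 2 * \<epsilon> n / (1 - t)\<^sup>2" if n: "1 \<le> n" for n
  proof -
    \<comment> \<open>The first test has the interference removed and handles a wrong first message
      next to the true second one; the joint test handles the case that both are wrong.\<close>
    define ok1 where "ok1 u v y \<longleftrightarrow> typical n \<delta> B1 (\<lambda>j. y j - G2 *v v j) (\<lambda>j. G1 *v u j) \<and> typical n \<delta> B12 y (\<lambda>j. G1 *v u j + G2 *v v j)" for u v y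
    define ok2 where "ok2 v y \<longleftrightarrow> typical n \<delta> B2 y (\<lambda>j. G4 *v v j)" for v y
    have Gv: "H1 *v (A1 *v x) = G1 *v x" "H2 *v (A2 *v x) = G2 *v x" "H4 *v (A2 *v x) = G4 *v x" for x
      by (simp_all add: G1_def G2_def G4_def matrix_vector_mul_assoc)
    show ?thesis
    proof (rule exists_good_code[where ?ok1.0 = ok1 and ?ok2.0 = ok2 and t = t and ?\<mu>1.0 = "4 * \<rho> ^ n" and ?\<mu>2.0 = "2 * \<rho> ^ n"
          and ?\<beta>1.0 = "exp (n * (\<delta> - ?b1))" and ?\<beta>2.0 = "exp (n * (\<delta> - ?b2))" and ?\<beta>12.0 = "exp (n * (\<delta> - ?b12))"])
      show "Measurable.pred (noise n \<Otimes>\<^sub>M (noise n \<Otimes>\<^sub>M block_space n)) (\<lambda>p. ok1 (fst p) (fst (snd p)) (snd (snd p)))"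
        unfolding ok1_def by measurable
      show "Measurable.pred (noise n \<Otimes>\<^sub>M block_space n) (\<lambda>p. ok2 (fst p) (snd p))"
        unfolding ok2_def by measurable
      show "(\<integral>\<^sup>+u. \<integral>\<^sup>+v. \<integral>\<^sup>+z. of_bool (\<not> ok1 u v (received n H1 H2 (\<lambda>j. A1 *v u j) (\<lambda>j. A2 *v v j) z)) \<partial>noise n \<partial>noise n \<partial>noise n) \<le> ennreal (4 * \<rho> ^ n)"
      proof -
        let ?f = "\<lambda>u (v :: nat \<Rightarrow> real^'n) z. of_bool (\<not> typical n \<delta> B1 (\<lambda>j. G1 *v u j + z j) (\<lambda>j. G1 *v u j)) :: ennreal"
        let ?g = "\<lambda>u v z. of_bool (\<not> typical n \<delta> B12 (\<lambda>j. G1 *v u j + G2 *v v j + z j) (\<lambda>j. G1 *v u j + G2 *v v j)) :: ennreal"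
        have "(\<integral>\<^sup>+u. \<integral>\<^sup>+v. \<integral>\<^sup>+z. of_bool (\<not> ok1 u v (received n H1 H2 (\<lambda>j. A1 *v u j) (\<lambda>j. A2 *v v j) z)) \<partial>noise n \<partial>noise n \<partial>noise n)
          \<le> (\<integral>\<^sup>+u. \<integral>\<^sup>+v. \<integral>\<^sup>+z. ?f u v z + ?g u v z \<partial>noise n \<partial>noise n \<partial>noise n)"
        proof (intro nn_integral_mono)
          fix u v z :: "nat \<Rightarrow> real^'n"
          let ?y = "received n H1 H2 (\<lambda>j. A1 *v u j) (\<lambda>j. A2 *v v j) z"
          have 1: "typical n \<delta> B1 (\<lambda>j. ?y j - G2 *v v j) (\<lambda>j. G1 *v u j) = typical n \<delta> B1 (\<lambda>j. G1 *v u j + z j) (\<lambda>j. G1 *v u j)"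
            by (rule typical_cong) (simp_all add: received_def Gv)
          have 2: "typical n \<delta> B12 ?y (\<lambda>j. G1 *v u j + G2 *v v j) = typical n \<delta> B12 (\<lambda>j. G1 *v u j + G2 *v v j + z j) (\<lambda>j. G1 *v u j + G2 *v v j)"
            by (rule typical_cong) (simp_all add: received_def Gv)
          show "of_bool (\<not> ok1 u v ?y) \<le> ?f u v z + ?g u v z"
            unfolding ok1_def 1 2 by (auto simp: of_bool_def)
        qed
        also have "\<dots> = (\<integral>\<^sup>+u. \<integral>\<^sup>+(v :: nat \<Rightarrow> real^'n). \<integral>\<^sup>+z. ?f u v z \<partial>noise n \<partial>noise n \<partial>noise n) + (\<integral>\<^sup>+u. \<integral>\<^sup>+v. \<integral>\<^sup>+z. ?g u v z \<partial>noise n \<partial>noise n \<partial>noise n)"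
          by (rule nn_integral_noise3_add) measurable
        also have "\<dots> \<le> ennreal (2 * \<rho> ^ n) + ennreal (2 * \<rho> ^ n)"
          using miss[OF B(1), of n] miss[OF B(3), of n] by (intro add_mono) (simp_all add: noise.emeasure_space_1)
        also have "\<dots> = ennreal (4 * \<rho> ^ n)" using \<rho> by (simp flip: ennreal_plus)
        finally show ?thesis .
      qed
      show "(\<integral>\<^sup>+u. of_bool (ok1 u v y) \<partial>noise n) \<le> ennreal (exp (n * (\<delta> - ?b1)))" for v y
      proof -
        have "(\<integral>\<^sup>+u. of_bool (ok1 u v y) \<partial>noise n) \<le> (\<integral>\<^sup>+u. of_bool (typical n \<delta> B1 (\<lambda>j. y j - G2 *v v j) (\<lambda>j. G1 *v u j)) \<partial>noise n)"
          by (intro nn_integral_mono) (auto simp: ok1_def of_bool_def)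
        also note hit_bound_single[OF B(1)]
        finally show ?thesis .
      qed
      show "(\<integral>\<^sup>+u. \<integral>\<^sup>+v. of_bool (ok1 u v y) \<partial>noise n \<partial>noise n) \<le> ennreal (exp (n * (\<delta> - ?b12)))" for y
      proof -
        have "(\<integral>\<^sup>+u. \<integral>\<^sup>+v. of_bool (ok1 u v y) \<partial>noise n \<partial>noise n)
           \<le> (\<integral>\<^sup>+u. \<integral>\<^sup>+v. of_bool (typical n \<delta> B12 y (\<lambda>j. G1 *v u j + G2 *v v j)) \<partial>noise n \<partial>noise n)"
          by (intro nn_integral_mono) (auto simp: ok1_def of_bool_def)
        also note hit_bound[OF B(3)]
        finally show ?thesis .
      qed
      show "(\<integral>\<^sup>+v. \<integral>\<^sup>+z. of_bool (\<not> ok2 v (received n (0 :: real^'n^'n) H4 (\<lambda>j. 0) (\<lambda>j. A2 *v v j) z)) \<partial>noise n \<partial>noise n) \<le> ennreal (2 * \<rho> ^ n)"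
      proof -
        have "ok2 v (received n (0 :: real^'n^'n) H4 (\<lambda>j. 0) (\<lambda>j. A2 *v v j) z) = typical n \<delta> B2 (\<lambda>j. G4 *v v j + z j) (\<lambda>j. G4 *v v j)" for v z
          unfolding ok2_def by (rule typical_cong) (simp_all add: received_def Gv)
        then show ?thesis using miss[OF B(2), of n] by (simp add: noise.emeasure_space_1)
      qed
      show "(\<integral>\<^sup>+v. of_bool (ok2 v y) \<partial>noise n) \<le> ennreal (exp (n * (\<delta> - ?b2)))" for y
        unfolding ok2_def by (rule hit_bound_single[OF B(2)])
      define m1 m2 where "m1 = real (num_messages n R1 - 1)" and "m2 = real (num_messages n R2 - 1)"
      have m: "0 \<le> m1" "0 \<le> m2" "m1 \<le> (if 0 < R1 then exp (n * R1) else 0)" "m2 \<le> (if 0 < R2 then exp (n * R2) else 0)"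
        using num_messages_le[OF R(1), of n] num_messages_le[OF R(2), of n] by (simp_all add: m1_def m2_def)
      have "m1 * exp (n * (\<delta> - ?b1)) \<le> (if 0 < R1 then exp (n * R1) else 0) * exp (n * (\<delta> - ?b1))"
        by (intro mult_right_mono m) simp
      also have "\<dots> = q1 ^ n" using n by (simp add: q1_def exp_of_nat_mult[symmetric] exp_add[symmetric] algebra_simps)
      finally have 1: "m1 * exp (n * (\<delta> - ?b1)) \<le> q1 ^ n" .
      have "m2 * exp (n * (\<delta> - ?b2)) \<le> (if 0 < R2 then exp (n * R2) else 0) * exp (n * (\<delta> - ?b2))"
        by (intro mult_right_mono m) simp
      also have "\<dots> = q2 ^ n" using n by (simp add: q2_def exp_of_nat_mult[symmetric] exp_add[symmetric] algebra_simps)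
      finally have 2: "m2 * exp (n * (\<delta> - ?b2)) \<le> q2 ^ n" .
      have "m1 * (m2 * exp (n * (\<delta> - ?b12))) \<le> (if 0 < R1 then exp (n * R1) else 0) * ((if 0 < R2 then exp (n * R2) else 0) * exp (n * (\<delta> - ?b12)))"
        by (intro mult_mono mult_right_mono m) (auto intro!: mult_nonneg_nonneg m)
      also have "\<dots> = q12 ^ n" using n by (simp add: q12_def exp_of_nat_mult[symmetric] exp_add[symmetric] algebra_simps)
      finally have 3: "m1 * (m2 * exp (n * (\<delta> - ?b12))) \<le> q12 ^ n" .
      have "0 \<le> 1 / real n" by simp
      with 1 2 3 show "4 * \<rho> ^ n + real (num_messages n R1 - 1) * (exp (n * (\<delta> - ?b1)) + real (num_messages n R2 - 1) * exp (n * (\<delta> - ?b12)))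
          + 2 * \<rho> ^ n + real (num_messages n R2 - 1) * exp (n * (\<delta> - ?b2)) \<le> \<epsilon> n"
        unfolding m1_def[symmetric] m2_def[symmetric] \<epsilon>_def distrib_left by linarith
      show "0 < \<epsilon> n" unfolding \<epsilon>_def using n q \<rho> by (intro add_nonneg_pos) auto
    qed (use n t P tr \<rho> in auto)
  qed
  define Q where "Q n C \<longleftrightarrow> (case C of (f1, f2, g1, g2) \<Rightarrow> valid_encoder n R1 P1 f1 \<and> valid_encoder n R2 P2 f2 \<and> valid_decoder n R1 g1 \<and> valid_decoder n R2 g2 \<and>
    error1 H1 H2 n R1 R2 f1 f2 g1 + error2 0 H4 n R1 R2 f1 f2 g2 \<le> 2 * \<epsilon> n / (1 - t)\<^sup>2)" for n C
  have "\<forall>n. \<exists>C. 1 \<le> n \<longrightarrow> Q n C" using code by (auto simp: Q_def)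
  then obtain C where C: "\<And>n. 1 \<le> n \<Longrightarrow> Q n (C n)" by metis
  define f1 f2 g1 g2 where "f1 n = fst (C n)" and "f2 n = fst (snd (C n))" and "g1 n = fst (snd (snd (C n)))" and "g2 n = snd (snd (snd (C n)))" for n
  have v: "valid_encoder n R1 P1 (f1 n) \<and> valid_encoder n R2 P2 (f2 n) \<and> valid_decoder n R1 (g1 n) \<and> valid_decoder n R2 (g2 n)"
    and e: "error1 H1 H2 n R1 R2 (f1 n) (f2 n) (g1 n) + error2 0 H4 n R1 R2 (f1 n) (f2 n) (g2 n) \<le> 2 * \<epsilon> n / (1 - t)\<^sup>2" if "1 \<le> n" for n
    using C[OF that] by (auto simp: Q_def f1_def f2_def g1_def g2_def split_def)
  have e0: "0 \<le> error1 H1 H2 n R1 R2 (f1 n) (f2 n) (g1 n)" "0 \<le> error2 0 H4 n R1 R2 (f1 n) (f2 n) (g2 n)" for n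
    by (simp_all add: error1_def error2_def)
  have "\<epsilon> \<longlonglongrightarrow> 6 * 0 + 0 + 0 + 0 + 0"
    unfolding \<epsilon>_def by (intro tendsto_add tendsto_mult tendsto_const LIMSEQ_realpow_zero lim_1_over_n) (use \<rho> q in auto)
  then have lim: "(\<lambda>n. 2 * \<epsilon> n / (1 - t)\<^sup>2) \<longlonglongrightarrow> 0"
    using t by (auto intro!: tendsto_eq_intros)
  have "(\<lambda>n. error1 H1 H2 n R1 R2 (f1 n) (f2 n) (g1 n)) \<longlonglongrightarrow> 0"
  proof (rule tendsto_sandwich[OF _ _ tendsto_const lim])
    show "eventually (\<lambda>n. error1 H1 H2 n R1 R2 (f1 n) (f2 n) (g1 n) \<le> 2 * \<epsilon> n / (1 - t)\<^sup>2) sequentially"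
      using eventually_ge_at_top[of 1] by eventually_elim (use e e0 in \<open>fastforce intro: order_trans[rotated]\<close>)
  qed (simp add: e0)
  moreover have "(\<lambda>n. error2 0 H4 n R1 R2 (f1 n) (f2 n) (g2 n)) \<longlonglongrightarrow> 0"
  proof (rule tendsto_sandwich[OF _ _ tendsto_const lim])
    show "eventually (\<lambda>n. error2 0 H4 n R1 R2 (f1 n) (f2 n) (g2 n) \<le> 2 * \<epsilon> n / (1 - t)\<^sup>2) sequentially"
      using eventually_ge_at_top[of 1] by eventually_elim (use e e0 in \<open>fastforce intro: order_trans[rotated]\<close>)
  qed (simp add: e0)
  ultimately show ?thesis using R v unfolding achievable_def by blast
qed

text \<open>Two slacks are created. Scaling the rates by \<open>s < 1\<close> makes the inequalities
  strict for positive rates; by continuity they stay strict when the covariances shrink by a factor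
  \<open>\<tau> k\<close> near 1, which gives the power margin for Markov's inequality. The closure
  absorbs the limit of \<open>s\<close> to 1.\<close>

lemma rate_region_subset:
  fixes H1 H2 H4 :: "real^'n^'n"
  shows "rate_region H1 H2 H4 P1 P2 \<subseteq> capacity_region H1 H2 0 H4 P1 P2"
proof safe
  fix R1 R2 assume "(R1, R2) \<in> rate_region H1 H2 H4 P1 P2"
  then obtain S1 S2 where R: "0 \<le> R1" "0 \<le> R2" and S: "psd S1" "psd S2" "trace S1 \<le> P1" "trace S2 \<le> P2"
    and b: "R1 \<le> half_logdet (H1 ** S1 ** transpose H1)" "R2 \<le> half_logdet (H4 ** S2 ** transpose H4)"
      "R1 + R2 \<le> half_logdet (H1 ** S1 ** transpose H1 + H2 ** S2 ** transpose H2)"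
    by (auto simp: rate_region_def rate_bounds_def)
  \<comment> \<open>Nonnegative powers are not assumed; they follow from the existence of admissible
    covariances.\<close>
  have P: "0 \<le> P1" "0 \<le> P2" using psd_trace_nonneg[OF S(1)] psd_trace_nonneg[OF S(2)] S(3,4) by linarith+
  have ach: "achievable H1 H2 0 H4 P1 P2 (s * R1) (s * R2)" if s: "0 \<le> s" "s < 1" for s
  proof -
    define \<tau> where "\<tau> k = 1 - inverse (real (Suc k))" for k
    have \<tau>: "0 \<le> \<tau> k" "\<tau> k < 1" for k by (auto simp: \<tau>_def field_simps)
    have "\<tau> \<longlonglongrightarrow> 1 - 0" unfolding \<tau>_def by (intro tendsto_intros LIMSEQ_inverse_real_of_nat)
    then have \<tau>1: "\<tau> \<longlonglongrightarrow> 1" by simp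
    have scale: "(\<lambda>k. \<tau> k *\<^sub>R S) \<longlonglongrightarrow> S" for S :: "real^'n^'n"
      using tendsto_scaleR[OF \<tau>1 tendsto_const[of S]] by simp
    note c = tendsto_matrix_conj[OF scale]
    \<comment> \<open>The premise \<open>0 < x\<close> is essential, since \<open>s * x < x\<close>
      fails at 0; this is the form in which \<open>achievable_gaussian\<close> asks for its
      inequalities.\<close>
    have strict: "eventually (\<lambda>k. 0 < x \<longrightarrow> s * x < h k) sequentially" if "h \<longlonglongrightarrow> y" "x \<le> y" for h y x
    proof (cases "0 < x")
      case True
      then have "s * x < 1 * x" using s by (intro mult_strict_right_mono)
      then have "s * x < y" using that(2) by simp
      from order_tendstoD(1)[OF that(1) this] show ?thesis by eventually_elim simp
    qed simp
    have "eventually (\<lambda>k. (0 < R1 \<longrightarrow> s * R1 < half_logdet (H1 ** (\<tau> k *\<^sub>R S1) ** transpose H1)) \<and>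
        (0 < R2 \<longrightarrow> s * R2 < half_logdet (H4 ** (\<tau> k *\<^sub>R S2) ** transpose H4)) \<and>
        (0 < R1 + R2 \<longrightarrow> s * (R1 + R2) < half_logdet (H1 ** (\<tau> k *\<^sub>R S1) ** transpose H1 + H2 ** (\<tau> k *\<^sub>R S2) ** transpose H2))) sequentially"
      by (intro eventually_conj strict[OF half_logdet_tendsto[OF c] b(1)] strict[OF half_logdet_tendsto[OF c] b(2)]
          strict[OF half_logdet_tendsto[OF tendsto_add[OF c c]] b(3)] psd_add psd_conj S)
    then obtain k where k: "0 < R1 \<Longrightarrow> s * R1 < half_logdet (H1 ** (\<tau> k *\<^sub>R S1) ** transpose H1)"
        "0 < R2 \<Longrightarrow> s * R2 < half_logdet (H4 ** (\<tau> k *\<^sub>R S2) ** transpose H4)"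
        "0 < R1 + R2 \<Longrightarrow> s * (R1 + R2) < half_logdet (H1 ** (\<tau> k *\<^sub>R S1) ** transpose H1 + H2 ** (\<tau> k *\<^sub>R S2) ** transpose H2)"
      using eventually_happens'[OF sequentially_bot] by blast
    obtain A1 :: "real^'n^'n" where A1: "\<tau> k *\<^sub>R S1 = A1 ** transpose A1"
      using psd_factor[OF psd_scaleR[OF S(1) \<tau>(1)[of k]]] by metis
    obtain A2 :: "real^'n^'n" where A2: "\<tau> k *\<^sub>R S2 = A2 ** transpose A2"
      using psd_factor[OF psd_scaleR[OF S(2) \<tau>(1)[of k]]] by metis
    have conj: "H ** (A ** transpose A) ** transpose H = (H ** A) ** transpose (H ** A)" for H A :: "real^'n^'n"
      by (simp add: matrix_transpose_mul matrix_mul_assoc)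
    show ?thesis
    proof (rule achievable_gaussian[OF \<tau> P])
      show "trace (A1 ** transpose A1) \<le> \<tau> k * P1" "trace (A2 ** transpose A2) \<le> \<tau> k * P2"
        using S(3,4) \<tau>(1) by (simp_all flip: A1 A2 add: trace_scaleR mult_left_mono)
    next
      assume "0 < s * R1"
      then have "0 < R1" using R(1) by (metis less_eq_real_def mult_zero_right order_less_irrefl)
      then show "s * R1 < half_logdet (H1 ** A1 ** transpose (H1 ** A1))" using k(1) unfolding A1 conj by simp
    next
      assume "0 < s * R2"
      then have "0 < R2" using R(2) by (metis less_eq_real_def mult_zero_right order_less_irrefl)
      then show "s * R2 < half_logdet (H4 ** A2 ** transpose (H4 ** A2))" using k(2) unfolding A2 conj by simp
    next
      assume "0 < s * R1" "0 < s * R2"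
      then have "0 < R1" using R(1) by (metis less_eq_real_def mult_zero_right order_less_irrefl)
      then have "0 < R1 + R2" using R(2) by simp
      then show "s * R1 + s * R2 < half_logdet (H1 ** A1 ** transpose (H1 ** A1) + H2 ** A2 ** transpose (H2 ** A2))"
        using k(3) unfolding A1 A2 conj by (simp add: distrib_left)
    qed (use s R in auto)
  qed
  define \<sigma> where "\<sigma> k = 1 - inverse (real (Suc k))" for k
  have "\<sigma> \<longlonglongrightarrow> 1 - 0" unfolding \<sigma>_def by (intro tendsto_intros LIMSEQ_inverse_real_of_nat)
  then have "(\<lambda>k. (\<sigma> k * R1, \<sigma> k * R2)) \<longlonglongrightarrow> (1 * R1, 1 * R2)"
    by (intro tendsto_Pair tendsto_mult tendsto_const) auto
  moreover have "achievable H1 H2 0 H4 P1 P2 (\<sigma> k * R1) (\<sigma> k * R2)" for k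
    by (rule ach) (auto simp: \<sigma>_def field_simps)
  ultimately show "(R1, R2) \<in> capacity_region H1 H2 0 H4 P1 P2"
    unfolding capacity_region_def closure_sequential by (intro exI[of _ "\<lambda>k. (\<sigma> k * R1, \<sigma> k * R2)"]) auto
qed

theorem theorem6:
  fixes H1 H2 H3 H4 :: "real^'n^'n" and P1 P2 :: real
  assumes "H3 = 0"
    and "invertible H1" and "invertible H2" and "invertible H4"
    and "psd (transpose H2 ** H2 - transpose H4 ** H4)"
  shows "capacity_region H1 H2 H3 H4 P1 P2 =
    (\<Union>(S1, S2) \<in> {(S1, S2). psd S1 \<and> psd S2 \<and> trace S1 \<le> P1 \<and> trace S2 \<le> P2}.
      {(R1, R2). 0 \<le> R1 \<and> 0 \<le> R2 \<and>
        R1 \<le> 1 / 2 * ln (det (mat 1 + H1 ** S1 ** transpose H1)) \<and>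
        R2 \<le> 1 / 2 * ln (det (mat 1 + H4 ** S2 ** transpose H4)) \<and>
        R1 + R2 \<le> 1 / 2 * ln (det (mat 1 + H1 ** S1 ** transpose H1
                                           + H2 ** S2 ** transpose H2))})"
proof -
  have region: "capacity_region H1 H2 H3 H4 P1 P2 = rate_region H1 H2 H4 P1 P2"
    using capacity_region_subset[OF assms(3,4,5)] rate_region_subset unfolding assms(1) by blast
  show ?thesis
    unfolding region rate_region_def rate_bounds_def half_logdet_def add.assoc[symmetric] by fastforce
qed

end
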